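(* Let $X\subset\mathbb{C}^3$ (coordinates $(x,y,z)$) be a weighted homogeneous complex algebraic surface with respect to positive weights $w_1\ge w_2>w_3$ of $x,y,z$ respectively, having an isolated singularity at $0$. If $(X\setminus\{0\})\cap\{z=0\}$ is not connected, then $X$ has a separating set at $0$.
   Context: $X$ is viewed as a real 4-dimensional semialgebraic subset of $\mathbb{C}^3=\mathbb{R}^6$. Weighted homogeneous means $X$ is the zero set of a polynomial $f$ with $f(t^{w_1}x,t^{w_2}y,t^{w_3}z)=t^df(x,y,z)$ for some $d$ and all $t\in\mathbb{C}^*$. Densities: $\underline\Theta^j(W,x_0)=\liminf_{\epsilon\to0^+}\frac{\mathcal H^j(W\cap \epsilon B(x_0))}{\eta\epsilon^j}$, $\overline\Theta^j(W,x_0)=\limsup_{\epsilon\to0^+}\frac{\mathcal H^j(W\cap \epsilon B(x_0))}{\eta\epsilon^j}$ ($\mathcal H^j$ Hausdorff measure, $\epsilon B(x_0)$ closed Euclidean ball, $\eta$ volume of unit $j$-ball). Separating set: for a $k$-dimensional semialgebraic $X\subset\mathbb{R}^n$ and $x_0\in X$ with connected link and positive $k$-density at $x_0$, a $(k-1)$-dimensional rectifiable $Y\subset X$ with $x_0\in Y$ is a separating set at $x_0$ if for some small $\epsilon>0$, $(\epsilon B(x_0)\cap X)\setminus Y$ has at least two connected components $A,B$ with $\overline\Theta^{k-1}(Y,x_0)=0$ and $\underline\Theta^k(A,x_0)>0$, $\underline\Theta^k(B,x_0)>0$. "$X$ has a separating set at $x_0$" means these hypotheses on $x_0$ hold and such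 a $Y$ exists. *)

theory Defs
  imports "HOL-Analysis.Analysis"
begin

text \<open>The j-dimensional Hausdorff measure (normalized so that it agrees with Lebesgue
  measure on R^j): covers by countably many bounded sets of diameter at most delta.\<close>

definition hausdorff_approx :: "nat \<Rightarrow> real \<Rightarrow> 'a::euclidean_space set \<Rightarrow> ennreal" where
  "hausdorff_approx j \<delta> A =
     (INF C \<in> {C :: nat \<Rightarrow> 'a set. A \<subseteq> (\<Union>i. C i) \<and>
                   (\<forall>i. bounded (C i) \<and> diameter (C i) \<le> \<delta>)}.
        (\<Sum>i. (if C i = {} then 0
               else ennreal (unit_ball_vol (real j) * (diameter (C i) / 2) ^ j))))"

definition hausdorff_measure :: "nat \<Rightarrow> 'a::euclidean_space set \<Rightarrow> ennreal" where
  "hausdorff_measure j A = (SUP \<delta> \<in> {0<..}. hausdorff_approx j \<delta> A)"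

definition lower_density :: "nat \<Rightarrow> 'a::euclidean_space set \<Rightarrow> 'a \<Rightarrow> ennreal" where
  "lower_density j W x0 = Liminf (at_right 0)
     (\<lambda>\<epsilon>. hausdorff_measure j (W \<inter> cball x0 \<epsilon>) / ennreal (unit_ball_vol (real j) * \<epsilon> ^ j))"

definition upper_density :: "nat \<Rightarrow> 'a::euclidean_space set \<Rightarrow> 'a \<Rightarrow> ennreal" where
  "upper_density j W x0 = Limsup (at_right 0)
     (\<lambda>\<epsilon>. hausdorff_measure j (W \<inter> cball x0 \<epsilon>) / ennreal (unit_ball_vol (real j) * \<epsilon> ^ j))"

text \<open>Countably m-rectifiable: up to an H^m-null set, Y is covered by countably many
  Lipschitz images of subsets of m-dimensional (linear) subspaces; a subset of an
  m-dimensional subspace of a Euclidean space is isometric to a subset of R^m.\<close>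

definition countably_rectifiable :: "nat \<Rightarrow> 'a::euclidean_space set \<Rightarrow> bool" where
  "countably_rectifiable m Y \<longleftrightarrow>
     (\<exists>(E :: nat \<Rightarrow> 'a set) (f :: nat \<Rightarrow> 'a \<Rightarrow> 'a) N.
        hausdorff_measure m N = 0 \<and> Y \<subseteq> N \<union> (\<Union>i. f i ` E i) \<and>
        (\<forall>i. dim (E i) \<le> m \<and> (\<exists>L. L-lipschitz_on (E i) (f i))))"

definition connected_link :: "'a::euclidean_space set \<Rightarrow> 'a \<Rightarrow> bool" where
  "connected_link X x0 \<longleftrightarrow> (\<exists>\<epsilon>0>0. \<forall>\<epsilon>. 0 < \<epsilon> \<and> \<epsilon> < \<epsilon>0 \<longrightarrow> connected (X \<inter> sphere x0 \<epsilon>))"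

definition is_separating_set :: "nat \<Rightarrow> 'a::euclidean_space set \<Rightarrow> 'a \<Rightarrow> 'a set \<Rightarrow> bool" where
  "is_separating_set k X x0 Y \<longleftrightarrow>
     Y \<subseteq> X \<and> x0 \<in> Y \<and> countably_rectifiable (k - 1) Y \<and>
     (\<exists>\<epsilon>>0. \<exists>A B. A \<in> components ((cball x0 \<epsilon> \<inter> X) - Y) \<and>
                    B \<in> components ((cball x0 \<epsilon> \<inter> X) - Y) \<and> A \<noteq> B \<and>
                    upper_density (k - 1) Y x0 = 0 \<and>
                    lower_density k A x0 > 0 \<and> lower_density k B x0 > 0)"

definition has_separating_set :: "nat \<Rightarrow> 'a::euclidean_space set \<Rightarrow> 'a \<Rightarrow> bool" where
  "has_separating_set k X x0 \<longleftrightarrow>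
     x0 \<in> X \<and> connected_link X x0 \<and> lower_density k X x0 > 0 \<and>
     (\<exists>Y. is_separating_set k X x0 Y)"

type_synonym cpoly3 = "nat \<times> nat \<times> nat \<Rightarrow> complex"

definition poly3_support :: "cpoly3 \<Rightarrow> (nat \<times> nat \<times> nat) set" where
  "poly3_support c = {e. c e \<noteq> 0}"

definition is_poly3 :: "cpoly3 \<Rightarrow> bool" where
  "is_poly3 c \<longleftrightarrow> finite (poly3_support c)"

definition eval3 :: "cpoly3 \<Rightarrow> complex \<times> complex \<times> complex \<Rightarrow> complex" where
  "eval3 c p = (\<Sum>(i,j,k)\<in>poly3_support c. c (i,j,k) * fst p ^ i * fst (snd p) ^ j * snd (snd p) ^ k)"

definition dx3 :: "cpoly3 \<Rightarrow> cpoly3" where "dx3 c = (\<lambda>(i,j,k). of_nat (Suc i) * c (Suc i, j, k))"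
definition dy3 :: "cpoly3 \<Rightarrow> cpoly3" where "dy3 c = (\<lambda>(i,j,k). of_nat (Suc j) * c (i, Suc j, k))"
definition dz3 :: "cpoly3 \<Rightarrow> cpoly3" where "dz3 c = (\<lambda>(i,j,k). of_nat (Suc k) * c (i, j, Suc k))"

definition zero_set3 :: "cpoly3 \<Rightarrow> (complex \<times> complex \<times> complex) set" where
  "zero_set3 c = {p. eval3 c p = 0}"

text \<open>Singular points of the hypersurface f = 0 (f taken reduced).\<close>
definition sing3 :: "cpoly3 \<Rightarrow> (complex \<times> complex \<times> complex) set" where
  "sing3 c = {p \<in> zero_set3 c. eval3 (dx3 c) p = 0 \<and> eval3 (dy3 c) p = 0 \<and> eval3 (dz3 c) p = 0}"

definition weighted_homogeneous3 :: "cpoly3 \<Rightarrow> nat \<Rightarrow> nat \<Rightarrow> nat \<Rightarrow> nat \<Rightarrow> bool" where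
  "weighted_homogeneous3 c w1 w2 w3 d \<longleftrightarrow>
     (\<forall>t x y z. t \<noteq> 0 \<longrightarrow>
        eval3 c (t ^ w1 * x, t ^ w2 * y, t ^ w3 * z) = t ^ d * eval3 c (x, y, z))"

end

theory Submission
  imports Defs "HOL-Complex_Analysis.Complex_Analysis"
    "HOL-Computational_Algebra.Fundamental_Theorem_Algebra"
begin

text \<open>
  The weighted \<open>\<complex>\<^sup>*\<close>-action contracts \<open>x\<close> and \<open>y\<close> faster than \<open>z\<close> near \<open>0\<close>. By hypothesis \<open>X \<inter> {z = 0}\<close>
  contains at least two orbits. Around a point of one orbit, a slice of \<open>X\<close> transversal to the orbit is
  a smooth disc; let \<open>W\<close> be the saturation of the open disc and \<open>Y\<close> that of its boundary circle,
  together with \<open>0\<close>. Then \<open>W - Y\<close> is relatively clopen in \<open>X - Y\<close>. On \<open>Y\<close> one has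
  \<open>|z| \<sim> |t|^w3\<close> while \<open>x, y = O(|t|^(w3 + 1))\<close>, and since \<open>z\<close> carries only two real dimensions,
  covering by cells of size \<open>|t|^(w3 + 1)\<close> gives \<open>H\<^sup>3(Y \<inter> \<epsilon>B) = o(\<epsilon>\<^sup>3)\<close>.
  Conversely, near an orbit in \<open>{z = 0}\<close> the set \<open>X\<close> projects, inside \<open>\<epsilon>B\<close>, onto a set containing a ball of
  radius comparable to \<open>\<epsilon>\<close> in \<open>\<complex>\<^sup>2\<close>, which bounds the lower 4-density of both components from below.

  Connectedness of the link reduces to that of \<open>X - {0}\<close>. Project by
  \<open>(a, b, s) \<mapsto> (a + \<nu> s^w1, b + \<mu> s^w2, s^w3)\<close>, so that \<open>f\<close> becomes a polynomial in \<open>s\<close> of degree \<open>d\<close>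
  with constant leading coefficient. For a clopen part of \<open>X - {0}\<close>, the sums of the residues of \<open>s^l / f\<close>
  over its roots are entire along \<open>a = 1\<close> and along \<open>b = 1\<close> and homogeneous of degree \<open>l + 1 - d \<le> 0\<close>;
  by Liouville they vanish for \<open>l < d - 1\<close> and are constant for \<open>l = d - 1\<close>. Lagrange interpolation
  expresses the indicator function of the part through them, so it is constant.
\<close>

section \<open>Hausdorff measure and densities\<close>

text \<open>The case split in the lower density estimate depends on which coordinate dominates an
  orbit in {z = 0}. The estimate needs all coordinates of the points over x = t^w1 to be O(|t|^w1).
  An orbit with y nonzero is therefore normalised to y = 1 and treated after exchanging x and y, so
  that the normalised coordinate has the smaller weight \<open>w2\<close>. An orbit with y = 0 is
  normalised to (1, 0, 0). There the other weight may be smaller, and the slope of the slice decides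
  whether the projection keeps z or y.

  Isolatedness of the singularity enters through Euler's identity: at a point with x = 1, z = 0 the
  vanishing of the y and z derivatives would force that of the x derivative.

  In the connectedness argument individual roots cannot be followed, since they may collide. Residue
  sums are symmetric in the colliding roots and stay holomorphic there, and the constant leading
  coefficient prevents roots from escaping to infinity.\<close>

lemma hausdorff_approx_antimono:
  assumes "\<delta> \<le> \<delta>'"
  shows "hausdorff_approx j \<delta>' A \<le> hausdorff_approx j \<delta> A"
  unfolding hausdorff_approx_def by (rule INF_superset_mono) (auto intro: order_trans[OF _ assms])

lemma hausdorff_approx_mono:
  assumes "A \<subseteq> B"
  shows "hausdorff_approx j \<delta> A \<le> hausdorff_approx j \<delta> B"
  unfolding hausdorff_approx_def by (rule INF_superset_mono) (use assms in force)+

lemma hausdorff_measure_mono: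
  assumes "A \<subseteq> B"
  shows "hausdorff_measure j A \<le> hausdorff_measure j B"
  unfolding hausdorff_measure_def by (rule SUP_mono') (rule hausdorff_approx_mono[OF assms])

text \<open>The fibres of \<open>key\<close> on \<open>A\<close> are the covering sets, enumerated
  through \<open>I\<close> and followed by empty sets, which cost 0 by definition.\<close>

lemma hausdorff_approx_le_card:
  fixes A :: "'a::euclidean_space set" and key :: "'a \<Rightarrow> 'k"
  assumes fin: "finite I" and key: "\<And>x. x \<in> A \<Longrightarrow> key x \<in> I"
    and d: "\<And>x y. x \<in> A \<Longrightarrow> y \<in> A \<Longrightarrow> key x = key y \<Longrightarrow> dist x y \<le> \<delta>" and "\<delta> \<ge> 0"
  shows "hausdorff_approx j \<delta> A \<le> ennreal (real (card I) * (unit_ball_vol (real j) * (\<delta> / 2) ^ j))"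
proof -
  obtain h where h: "bij_betw h {0..<card I} I"
    using ex_bij_betw_nat_finite[OF fin] by blast
  define C where "C i = (if i < card I then {x \<in> A. key x = h i} else {})" for i
  have bd: "bounded (C i)" for i
  proof (cases "C i = {}")
    case False
    then obtain a where "a \<in> C i" by blast
    hence "C i \<subseteq> cball a \<delta>" using d by (auto simp: C_def split: if_splits)
    thus ?thesis using bounded_cball bounded_subset by blast
  qed auto
  have diam: "diameter (C i) \<le> \<delta>" for i
    by (rule diameter_le) (use \<open>\<delta> \<ge> 0\<close> d in \<open>auto simp: C_def dist_norm split: if_splits\<close>)
  have cov: "A \<subseteq> (\<Union>i. C i)"
  proof
    fix x assume "x \<in> A"
    hence "key x \<in> h ` {0..<card I}" using key h by (simp add: bij_betw_def)
    thus "x \<in> (\<Union>i. C i)" using \<open>x \<in> A\<close> by (auto simp: C_def)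
  qed
  let ?v = "unit_ball_vol (real j) * (\<delta> / 2) ^ j"
  let ?t = "\<lambda>i. (if C i = {} then 0 else ennreal (unit_ball_vol (real j) * (diameter (C i) / 2) ^ j))"
  have "hausdorff_approx j \<delta> A \<le> (\<Sum>i. ?t i)"
    unfolding hausdorff_approx_def by (rule INF_lower) (use bd diam cov in auto)
  also have "\<dots> = (\<Sum>i<card I. ?t i)"
    by (rule suminf_finite) (auto simp: C_def)
  also have "\<dots> \<le> (\<Sum>i<card I. ennreal ?v)"
  proof (rule sum_mono)
    fix i
    have "(diameter (C i) / 2) ^ j \<le> (\<delta> / 2) ^ j"
      by (rule power_mono) (use diam diameter_ge_0[OF bd] in auto)
    thus "?t i \<le> ennreal ?v" by (auto intro!: ennreal_leI mult_left_mono)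
  qed
  also have "\<dots> = ennreal (real (card I) * ?v)"
    using \<open>\<delta> \<ge> 0\<close> by (simp add: ennreal_mult ennreal_of_nat_eq_real_of_nat)
  finally show ?thesis .
qed

text \<open>The approximations grow as the scale shrinks, so bounds at arbitrarily small scales
  control the supremum.\<close>

lemma hausdorff_measure_leI:
  assumes "\<And>\<delta>. \<delta> > 0 \<Longrightarrow> \<exists>\<delta>'. \<delta>' \<le> \<delta> \<and> hausdorff_approx j \<delta>' A \<le> V"
  shows "hausdorff_measure j A \<le> V"
  unfolding hausdorff_measure_def
proof (rule SUP_least)
  fix \<delta> :: real assume "\<delta> \<in> {0<..}"
  then obtain \<delta>' where "\<delta>' \<le> \<delta>" "hausdorff_approx j \<delta>' A \<le> V" using assms by auto
  thus "hausdorff_approx j \<delta> A \<le> V" using hausdorff_approx_antimono order_trans by blast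
qed

lemma hausdorff_measure_empty [simp]: "hausdorff_measure j {} = 0"
proof -
  have "hausdorff_measure j ({}::'a set) \<le> 0"
  proof (rule hausdorff_measure_leI)
    fix \<delta> :: real assume "\<delta> > 0"
    thus "\<exists>\<delta>'. \<delta>' \<le> \<delta> \<and> hausdorff_approx j \<delta>' ({}::'a set) \<le> 0"
      using hausdorff_approx_le_card[of "{}" "{}::'a set" "\<lambda>_. ()" \<delta> j] by auto
  qed
  thus ?thesis by simp
qed

text \<open>The image of a covering set lies in a ball whose radius is the full diameter of the set,
  not half of it. This costs a factor 2 per dimension, which is harmless for positivity of densities
  and avoids the isodiametric inequality.\<close>

lemma emeasure_le_hausdorff_measure:
  fixes g :: "'a::euclidean_space \<Rightarrow> 'b::euclidean_space"
  assumes lip: "\<And>x y. x \<in> S \<Longrightarrow> y \<in> S \<Longrightarrow> dist (g x) (g y) \<le> dist x y"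
    and D: "D \<subseteq> g ` S" "D \<in> sets lborel"
  shows "emeasure lborel D \<le> 2 ^ DIM('b) * hausdorff_measure (DIM('b)) S"
proof -
  let ?j = "DIM('b)"
  let ?v = "\<lambda>C :: 'a set. if C = {} then 0 else ennreal (unit_ball_vol (real ?j) * (diameter C / 2) ^ ?j)"
  have e: "(2::ennreal) ^ ?j = ennreal (2 ^ ?j)" by (simp add: ennreal_power[symmetric])
  hence pos: "(0::ennreal) < 2 ^ ?j" by simp
  have key: "emeasure lborel D \<le> 2 ^ ?j * (\<Sum>i. ?v (C i))"
    if C: "S \<subseteq> (\<Union>i. C i)" "\<And>i. bounded (C i)" for C :: "nat \<Rightarrow> 'a set"
  proof -
    \<comment> \<open>The centre must come from \<open>S\<close>, because \<open>g\<close> is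
      controlled on \<open>S\<close> only.\<close>
    define x where "x i = (SOME x. x \<in> C i \<inter> S)" for i
    define B where "B i = (if C i \<inter> S = {} then {} else cball (g (x i)) (diameter (C i)))" for i
    have x: "x i \<in> C i \<inter> S" if "C i \<inter> S \<noteq> {}" for i
      unfolding x_def using that by (metis equals0I someI_ex)
    have "D \<subseteq> (\<Union>i. B i)"
    proof
      fix d assume "d \<in> D"
      then obtain s where s: "s \<in> S" "d = g s" using D by auto
      then obtain i where i: "s \<in> C i" using C by blast
      hence ne: "C i \<inter> S \<noteq> {}" using s by blast
      have "dist (g (x i)) (g s) \<le> dist (x i) s" using lip x[OF ne] s by blast
      also have "\<dots> \<le> diameter (C i)" using diameter_bounded_bound[OF C(2)] x[OF ne] i by blast
      finally show "d \<in> (\<Union>i. B i)" using s ne by (auto simp: B_def)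
    qed
    hence "emeasure lborel D \<le> emeasure lborel (\<Union>i. B i)"
      by (rule emeasure_mono) (auto simp: B_def)
    also have "\<dots> \<le> (\<Sum>i. emeasure lborel (B i))"
      by (rule emeasure_subadditive_countably) (auto simp: B_def)
    also have "\<dots> \<le> (\<Sum>i. 2 ^ ?j * ?v (C i))"
    proof (rule suminf_le)
      fix i
      have d0: "diameter (C i) \<ge> 0" by (rule diameter_ge_0[OF C(2)])
      have "emeasure lborel (cball (g (x i)) (diameter (C i)))
          = ennreal (unit_ball_vol (real ?j) * diameter (C i) ^ ?j)"
        using d0 by (simp add: emeasure_cball)
      also have "\<dots> = ennreal (2 ^ ?j * (unit_ball_vol (real ?j) * (diameter (C i) / 2) ^ ?j))"
        by (simp add: power_divide)
      also have "\<dots> = 2 ^ ?j * ennreal (unit_ball_vol (real ?j) * (diameter (C i) / 2) ^ ?j)"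
        using d0 by (subst ennreal_mult) (auto simp: ennreal_power[symmetric])
      finally show "emeasure lborel (B i) \<le> 2 ^ ?j * ?v (C i)"
        by (auto simp: B_def)
    qed auto
    finally show ?thesis by simp
  qed
  have "emeasure lborel D / 2 ^ ?j \<le> hausdorff_approx ?j 1 S"
    unfolding hausdorff_approx_def
  proof (rule INF_greatest)
    fix C assume "C \<in> {C :: nat \<Rightarrow> 'a set. S \<subseteq> (\<Union>i. C i) \<and> (\<forall>i. bounded (C i) \<and> diameter (C i) \<le> 1)}"
    hence "emeasure lborel D \<le> 2 ^ ?j * (\<Sum>i. ?v (C i))"
      by (intro key) auto
    thus "emeasure lborel D / 2 ^ ?j \<le> (\<Sum>i. ?v (C i))"
      by (intro divide_le_posI_ennreal pos) (auto simp: mult.commute)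
  qed
  also have "\<dots> \<le> hausdorff_measure ?j S"
    unfolding hausdorff_measure_def by (rule SUP_upper) auto
  finally have "2 ^ ?j * (emeasure lborel D / 2 ^ ?j) \<le> 2 ^ ?j * hausdorff_measure ?j S"
    by (rule mult_left_mono) auto
  moreover have "2 ^ ?j * (emeasure lborel D / 2 ^ ?j) = emeasure lborel D"
    unfolding e ennreal_times_divide
    by (simp add: ennreal_divide_times[symmetric] ennreal_mult_divide_eq mult.commute)
  ultimately show ?thesis by simp
qed

section \<open>Criteria for positive lower density and zero upper density\<close>

lemma lower_density_mono:
  assumes "A \<subseteq> B"
  shows "lower_density j A x \<le> lower_density j B x"
  unfolding lower_density_def
  by (intro Liminf_mono always_eventually allI divide_right_mono_ennreal hausdorff_measure_mono)
     (use assms in auto)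

text \<open>The resulting bound is \<open>(\<kappa>/2) ^ j\<close>; the 2 is the factor lost in
  \<open>emeasure_le_hausdorff_measure\<close>.\<close>

lemma lower_density_pos:
  fixes g :: "'a::euclidean_space \<Rightarrow> 'b::euclidean_space"
  assumes k: "\<kappa> > 0" and e0: "\<epsilon>0 > 0"
    and lip: "\<And>x y. x \<in> S \<Longrightarrow> y \<in> S \<Longrightarrow> dist (g x) (g y) \<le> dist x y"
    and D: "\<And>\<epsilon>. 0 < \<epsilon> \<Longrightarrow> \<epsilon> < \<epsilon>0 \<Longrightarrow> \<exists>c. ball c (\<kappa> * \<epsilon>) \<subseteq> g ` (S \<inter> cball x0 \<epsilon>)"
  shows "lower_density (DIM('b)) S x0 > 0"
proof -
  let ?j = "DIM('b)"
  have "ennreal ((\<kappa>/2) ^ ?j) \<le> lower_density ?j S x0"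
    unfolding lower_density_def
  proof (rule Liminf_bounded)
    show "\<forall>\<^sub>F \<epsilon> in at_right 0. ennreal ((\<kappa>/2) ^ ?j) \<le>
       hausdorff_measure ?j (S \<inter> cball x0 \<epsilon>) / ennreal (unit_ball_vol (real ?j) * \<epsilon> ^ ?j)"
      unfolding eventually_at_right_field
    proof (intro exI[of _ \<epsilon>0] conjI allI impI e0)
      fix \<epsilon> :: real assume e: "0 < \<epsilon>" "\<epsilon> < \<epsilon>0"
      then obtain c where c: "ball c (\<kappa> * \<epsilon>) \<subseteq> g ` (S \<inter> cball x0 \<epsilon>)" using D by blast
      have u: "unit_ball_vol (real ?j) > 0" by simp
      have "ennreal (unit_ball_vol (real ?j) * (\<kappa> * \<epsilon>) ^ ?j) = emeasure lborel (ball c (\<kappa> * \<epsilon>))"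
        using k e by (subst emeasure_ball) auto
      also have "\<dots> \<le> 2 ^ ?j * hausdorff_measure ?j (S \<inter> cball x0 \<epsilon>)"
        by (rule emeasure_le_hausdorff_measure[OF _ c]) (use lip in auto)
      finally have le: "ennreal (unit_ball_vol (real ?j) * (\<kappa> * \<epsilon>) ^ ?j) \<le> 2 ^ ?j * hausdorff_measure ?j (S \<inter> cball x0 \<epsilon>)" .
      have two: "(2::ennreal) ^ ?j = ennreal (2 ^ ?j)" by (simp add: ennreal_power[symmetric])
      show "ennreal ((\<kappa>/2) ^ ?j) \<le>
       hausdorff_measure ?j (S \<inter> cball x0 \<epsilon>) / ennreal (unit_ball_vol (real ?j) * \<epsilon> ^ ?j)"
      proof (cases "hausdorff_measure ?j (S \<inter> cball x0 \<epsilon>)")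
        case (real r)
        have "unit_ball_vol (real ?j) * (\<kappa> * \<epsilon>) ^ ?j \<le> 2 ^ ?j * r"
          using le real two k e by (simp add: ennreal_mult[symmetric])
        hence "(\<kappa>/2) ^ ?j \<le> r / (unit_ball_vol (real ?j) * \<epsilon> ^ ?j)"
          using u e by (simp add: field_simps power_divide power_mult_distrib)
        thus ?thesis using real u e by (simp add: divide_ennreal ennreal_leI)
      next
        case top
        thus ?thesis using u e by (simp add: ennreal_top_divide)
      qed
    qed
  qed
  moreover have "ennreal ((\<kappa>/2) ^ ?j) > 0" using k by simp
  ultimately show ?thesis by (rule less_le_trans[rotated])
qed

lemma upper_density_zero:
  assumes "((\<lambda>\<epsilon>. V \<epsilon> / \<epsilon> ^ j) \<longlongrightarrow> 0) (at_right 0)"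
    and "\<forall>\<^sub>F \<epsilon> in at_right 0. V \<epsilon> \<ge> 0 \<and> hausdorff_measure j (W \<inter> cball x0 \<epsilon>) \<le> ennreal (V \<epsilon>)"
  shows "upper_density j W x0 = 0"
proof -
  let ?u = "unit_ball_vol (real j)"
  have u: "?u > 0" by simp
  hence u0: "?u \<noteq> 0" by (metis less_irrefl)
  have "((\<lambda>\<epsilon>. ennreal (V \<epsilon> / \<epsilon> ^ j / ?u)) \<longlongrightarrow> ennreal (0 / ?u)) (at_right 0)"
    by (intro tendsto_ennrealI tendsto_divide assms tendsto_const u0)
  hence lim: "Limsup (at_right 0) (\<lambda>\<epsilon>. ennreal (V \<epsilon> / \<epsilon> ^ j / ?u)) = 0"
    using lim_imp_Limsup[OF trivial_limit_at_right_real] by fastforce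
  have "upper_density j W x0 \<le> Limsup (at_right 0) (\<lambda>\<epsilon>. ennreal (V \<epsilon> / \<epsilon> ^ j / ?u))"
    unfolding upper_density_def
  proof (rule Limsup_mono)
    show "\<forall>\<^sub>F \<epsilon> in at_right 0. hausdorff_measure j (W \<inter> cball x0 \<epsilon>) / ennreal (?u * \<epsilon> ^ j)
        \<le> ennreal (V \<epsilon> / \<epsilon> ^ j / ?u)"
      using assms(2) eventually_at_right_less[of 0]
    proof eventually_elim
      case (elim \<epsilon>)
      have "hausdorff_measure j (W \<inter> cball x0 \<epsilon>) / ennreal (?u * \<epsilon> ^ j) \<le> ennreal (V \<epsilon>) / ennreal (?u * \<epsilon> ^ j)"
        by (intro divide_right_mono_ennreal) (use elim in auto)
      also have "\<dots> = ennreal (V \<epsilon> / \<epsilon> ^ j / ?u)"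
        using elim u by (subst divide_ennreal) (auto simp: mult.commute)
      finally show ?case .
    qed
  qed
  thus ?thesis using lim by simp
qed

text \<open>Cells are drawn in the parameter space, where counting is easy; each image point is
  filed under one chosen parameter.\<close>

lemma hausdorff_approx_image_le_card:
  fixes \<Phi> :: "'p \<Rightarrow> 'a::euclidean_space" and key :: "'p \<Rightarrow> 'k"
  assumes fin: "finite I" and key: "\<And>p. p \<in> P \<Longrightarrow> key p \<in> I"
    and d: "\<And>p p'. p \<in> P \<Longrightarrow> p' \<in> P \<Longrightarrow> key p = key p' \<Longrightarrow> dist (\<Phi> p) (\<Phi> p') \<le> \<delta>" and "\<delta> \<ge> 0"
  shows "hausdorff_approx j \<delta> (\<Phi> ` P) \<le> ennreal (real (card I) * (unit_ball_vol (real j) * (\<delta> / 2) ^ j))"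
proof -
  define c where "c x = (SOME p. p \<in> P \<and> \<Phi> p = x)" for x
  have c: "c x \<in> P" "\<Phi> (c x) = x" if "x \<in> \<Phi> ` P" for x
    using someI_ex[of "\<lambda>p. p \<in> P \<and> \<Phi> p = x"] that unfolding c_def by blast+
  show ?thesis
  proof (rule hausdorff_approx_le_card[OF fin _ _ \<open>\<delta> \<ge> 0\<close>, where key="\<lambda>x. key (c x)"])
    show "key (c x) \<in> I" if "x \<in> \<Phi> ` P" for x using c[OF that] key by blast
    show "dist x y \<le> \<delta>" if "x \<in> \<Phi> ` P" "y \<in> \<Phi> ` P" "key (c x) = key (c y)" for x y
      using d[OF c(1)[OF that(1)] c(1)[OF that(2)] that(3)] c(2) that by metis
  qed
qed

lemma hausdorff_approx_image_le:
  fixes g :: "'a::euclidean_space \<Rightarrow> 'b::euclidean_space"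
  assumes g: "\<And>x y. dist (g x) (g y) \<le> dist x y"
  shows "hausdorff_approx j \<delta> (g ` S) \<le> hausdorff_approx j \<delta> S"
  unfolding hausdorff_approx_def
proof (rule INF_greatest)
  let ?D = "{C. g ` S \<subseteq> (\<Union>i. C i) \<and> (\<forall>i. bounded (C i) \<and> diameter (C i) \<le> \<delta>)}"
  let ?v = "\<lambda>C. if C = {} then 0 else ennreal (unit_ball_vol (real j) * (diameter C / 2) ^ j)"
  fix C :: "nat \<Rightarrow> 'a set" assume "C \<in> {C. S \<subseteq> (\<Union>i. C i) \<and> (\<forall>i. bounded (C i) \<and> diameter (C i) \<le> \<delta>)}"
  hence C: "S \<subseteq> (\<Union>i. C i)" "\<And>i. bounded (C i)" "\<And>i. diameter (C i) \<le> \<delta>" by auto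
  have b: "bounded (g ` C i)" for i
  proof (cases "C i = {}")
    case False
    then obtain a where a: "a \<in> C i" by blast
    have "g ` C i \<subseteq> cball (g a) (diameter (C i))"
      using g[of a] diameter_bounded_bound[OF C(2) a] by (force intro: order_trans)
    thus ?thesis using bounded_cball bounded_subset by blast
  qed simp
  have d: "diameter (g ` C i) \<le> diameter (C i)" for i
  proof (rule diameter_le)
    show "g ` C i \<noteq> {} \<or> 0 \<le> diameter (C i)" using diameter_ge_0[OF C(2)] by blast
    fix x y assume "x \<in> g ` C i" "y \<in> g ` C i"
    then obtain a b where "a \<in> C i" "b \<in> C i" "x = g a" "y = g b" by blast
    thus "norm (x - y) \<le> diameter (C i)"
      using order_trans[OF g diameter_bounded_bound[OF C(2)]] by (simp add: dist_norm)
  qed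
  have "g ` S \<subseteq> (\<Union>i. g ` C i)" using C(1) by blast
  moreover have "diameter (g ` C i) \<le> \<delta>" for i using order_trans[OF d C(3)] .
  ultimately have "(\<lambda>i. g ` C i) \<in> ?D"
    using b by blast
  hence "(INF C \<in> ?D.
        (\<Sum>i. ?v (C i)))
    \<le> (\<Sum>i. ?v (g ` C i))"
    by (rule INF_lower)
  also have "\<dots> \<le> (\<Sum>i. ?v (C i))"
  proof (rule suminf_le)
    fix i
    have "(diameter (g ` C i) / 2) ^ j \<le> (diameter (C i) / 2) ^ j"
      using d diameter_ge_0[OF b] by (intro power_mono divide_right_mono) auto
    thus "?v (g ` C i)
      \<le> ?v (C i)"
      by (auto intro!: ennreal_leI mult_left_mono)
  qed auto
  finally show "(INF C \<in> ?D.
        (\<Sum>i. ?v (C i)))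
    \<le> (\<Sum>i. ?v (C i))" .
qed

lemma hausdorff_measure_image_le:
  fixes g :: "'a::euclidean_space \<Rightarrow> 'b::euclidean_space"
  assumes "\<And>x y. dist (g x) (g y) \<le> dist x y"
  shows "hausdorff_measure j (g ` S) \<le> hausdorff_measure j S"
  unfolding hausdorff_measure_def by (rule SUP_mono') (rule hausdorff_approx_image_le[OF assms])

section \<open>Residue sums over the roots of a family of polynomials\<close>

lemma poly_eq_sum_atMost:
  fixes p :: "'a::comm_semiring_1 poly"
  assumes "degree p \<le> d"
  shows "poly p x = (\<Sum>i\<le>d. coeff p i * x ^ i)"
  unfolding poly_altdef using assms
  by (intro sum.mono_neutral_left) (auto simp: coeff_eq_0)

text \<open>Both residues are the same Taylor coefficient of \<open>g\<close> at
  \<open>u * \<alpha>\<close>. The chain rule contributes \<open>u ^ m\<close> and the pole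
  \<open>u ^ Suc m\<close>, which leaves \<open>1 / u\<close>.\<close>

lemma residue_rational_scale:
  fixes p q :: "complex poly"
  assumes "p \<noteq> 0" "u \<noteq> 0"
  shows "residue (\<lambda>v. poly q (u * v) / poly p (u * v)) \<alpha>
       = residue (\<lambda>w. poly q w / poly p w) (u * \<alpha>) / u"
proof -
  define z where "z = u * \<alpha>"
  define m where "m = order z p"
  obtain r where r: "p = [:-z, 1:] ^ m * r" "\<not> [:-z, 1:] dvd r"
    using order_decomp[OF \<open>p \<noteq> 0\<close>] unfolding m_def by blast
  hence rz: "poly r z \<noteq> 0" by (simp add: poly_eq_0_iff_dvd)
  define T where "T = {w. poly r w \<noteq> 0}"
  have T: "open T" "z \<in> T"
    unfolding T_def using rz by (auto intro!: open_Collect_neq continuous_intros)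
  \<comment> \<open>The extra factor \<open>w - z\<close> raises the exponent of the pole to
    \<open>Suc m\<close>, the form that the residue formula expects, also when \<open>z\<close> is
    no root and \<open>m = 0\<close>.\<close>
  define g where "g = (\<lambda>w. (w - z) * poly q w / poly r w)"
  have g: "g holomorphic_on T" unfolding g_def T_def by (intro holomorphic_intros) auto
  define S where "S = (\<lambda>v. u * v) -` T"
  have S: "open S" "\<alpha> \<in> S"
    using T by (auto simp: S_def z_def intro!: open_vimage continuous_intros)
  have pw: "poly p w = (w - z) ^ m * poly r w" for w by (subst r(1)) (simp add: poly_power)
  have eq1: "residue (\<lambda>w. poly q w / poly p w) z = residue (\<lambda>w. g w / (w - z) ^ Suc m) z"
    by (rule residue_cong) (auto simp: eventually_at_filter g_def pw divide_simps)
  have uz: "u * v - z = u * (v - \<alpha>)" for v by (simp add: z_def algebra_simps)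
  have eq2: "residue (\<lambda>v. poly q (u * v) / poly p (u * v)) \<alpha>
      = residue (\<lambda>v. (g (u * v) / u ^ Suc m) / (v - \<alpha>) ^ Suc m) \<alpha>"
    by (rule residue_cong)
       (use \<open>u \<noteq> 0\<close> in \<open>auto simp: eventually_at_filter g_def pw uz power_mult_distrib divide_simps\<close>)
  have gu: "(\<lambda>v. g (u * v)) holomorphic_on S"
    using holomorphic_on_compose_gen[OF _ g, of "\<lambda>v. u * v" S]
    by (auto simp: S_def o_def intro!: holomorphic_intros)
  have "residue (\<lambda>v. (g (u * v) / u ^ Suc m) / (v - \<alpha>) ^ Suc m) \<alpha>
      = (deriv ^^ m) (\<lambda>v. g (u * v) / u ^ Suc m) \<alpha> / fact m"
    by (rule residue_holomorphic_over_power[OF S]) (use gu \<open>u \<noteq> 0\<close> in \<open>auto intro!: holomorphic_intros\<close>)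
  also have "(deriv ^^ m) (\<lambda>v. g (u * v) / u ^ Suc m) \<alpha>
      = u ^ m * (deriv ^^ m) (\<lambda>w. g w / u ^ Suc m) (u * \<alpha>)"
    by (rule higher_deriv_compose_linear[OF _ S(1) T(1) S(2)])
       (use g \<open>u \<noteq> 0\<close> in \<open>auto simp: S_def intro!: holomorphic_intros\<close>)
  also have "(\<lambda>w. g w / u ^ Suc m) = (\<lambda>w. (1 / u ^ Suc m) * g w)" by auto
  also have "(deriv ^^ m) \<dots> (u * \<alpha>) = (1 / u ^ Suc m) * (deriv ^^ m) g (u * \<alpha>)"
    by (rule higher_deriv_cmult[OF g]) (use T in \<open>auto simp: z_def\<close>)
  also have "u ^ m * (1 / u ^ Suc m * (deriv ^^ m) g (u * \<alpha>)) / fact m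
      = ((deriv ^^ m) g z / fact m) / u"
    using \<open>u \<noteq> 0\<close> by (simp add: z_def field_simps)
  also have "(deriv ^^ m) g z / fact m = residue (\<lambda>w. g w / (w - z) ^ Suc m) z"
    by (rule residue_holomorphic_over_power[OF T g, symmetric])
  finally show ?thesis unfolding eq2 eq1[unfolded z_def] by (simp add: z_def)
qed

text \<open>Cauchy's bound. It depends on \<open>p\<close> only through \<open>d\<close>,
  \<open>c\<close> and \<open>M\<close>, so it confines the roots of a whole family to one compact
  disc.\<close>

lemma root_norm_le:
  fixes p :: "complex poly"
  assumes "degree p \<le> d" "coeff p d = c" "c \<noteq> 0" "poly p s = 0"
    and M: "\<And>i. i < d \<Longrightarrow> norm (coeff p i) \<le> M" "M \<ge> 0"
  shows "norm s \<le> 1 + real d * M / norm c"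
proof (rule ccontr)
  assume "\<not> ?thesis"
  hence gt: "norm s > 1 + real d * M / norm c" by simp
  have s1: "norm s \<ge> 1" using gt M(2) by (smt (verit) divide_nonneg_nonneg mult_nonneg_nonneg norm_ge_zero of_nat_0_le_iff)
  have "d > 0"
  proof (rule ccontr)
    assume "\<not> d > 0"
    hence "poly p s = c" using assms(1,2) poly_eq_sum_atMost[of p 0 s] by simp
    thus False using assms by simp
  qed
  then obtain e where e: "d = Suc e" by (cases d) auto
  have "0 = (\<Sum>i\<le>d. coeff p i * s ^ i)" using assms poly_eq_sum_atMost by metis
  also have "\<dots> = c * s ^ d + (\<Sum>i\<le>e. coeff p i * s ^ i)" using assms(2) by (simp add: e)
  finally have "c * s ^ d = - (\<Sum>i\<le>e. coeff p i * s ^ i)" by (simp add: add_eq_0_iff)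
  hence "norm c * norm s ^ d = norm (\<Sum>i\<le>e. coeff p i * s ^ i)"
    by (metis norm_minus_cancel norm_mult norm_power)
  also have "\<dots> \<le> (\<Sum>i\<le>e. M * norm s ^ e)"
  proof (rule sum_norm_le)
    fix i assume "i \<in> {..e}"
    thus "norm (coeff p i * s ^ i) \<le> M * norm s ^ e"
      unfolding norm_mult norm_power
      by (intro mult_mono M power_increasing s1) (auto simp: e)
  qed
  also have "\<dots> = (real d * M) * norm s ^ e" by (simp add: e)
  finally have "norm s ^ e * (norm c * norm s) \<le> norm s ^ e * (real d * M)"
    by (simp add: e mult_ac)
  moreover have "norm s ^ e > 0" using s1 by (metis less_le_trans zero_less_one zero_less_power)
  ultimately have "norm c * norm s \<le> real d * M" by simp
  hence "norm s \<le> real d * M / norm c" using assms(3) by (simp add: field_simps)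
  thus False using gt by simp
qed

text \<open>Near a parameter \<open>t0\<close> the roots in \<open>A\<close> stay inside fixed small
  discs about the roots in \<open>A\<close> over \<open>t0\<close>, and those in \<open>B\<close>
  stay outside. The sum is then a finite sum of contour integrals over fixed circles, which may be
  differentiated under the integral sign. How roots split or merge inside a disc does not
  matter.\<close>

lemma residue_sum_holomorphic:
  fixes P :: "complex \<Rightarrow> complex poly" and A B :: "(complex \<times> complex) set"
  assumes deg: "\<And>t. degree (P t) \<le> d"
    and hol: "\<And>i. (\<lambda>t. coeff (P t) i) holomorphic_on UNIV"
    and lead: "\<And>t. coeff (P t) d = c" and c: "c \<noteq> 0"
    and cl: "closed A" "closed B" and disj: "A \<inter> B = {}"
    and roots: "{(t, s). poly (P t) s = 0} = A \<union> B"
  shows "(\<lambda>t. \<Sum>s | (t, s) \<in> A. residue (\<lambda>w. w ^ l / poly (P t) w) s) holomorphic_on UNIV"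
proof -
  define F where "F t w = poly (P t) w" for t w
  define F' where "F' t w = (\<Sum>i\<le>d. deriv (\<lambda>t. coeff (P t) i) t * w ^ i)" for t w
  have P0: "P t \<noteq> 0" for t using lead[of t] c by auto
  have Fsum: "F t w = (\<Sum>i\<le>d. coeff (P t) i * w ^ i)" for t w
    unfolding F_def by (rule poly_eq_sum_atMost[OF deg])
  have FD: "((\<lambda>t. F t w) has_field_derivative F' t w) (at t within U)" for t w U
    unfolding Fsum F'_def
    by (rule DERIV_sum, rule DERIV_cmult_right,
        rule has_field_derivative_at_within[OF holomorphic_derivI[OF hol open_UNIV UNIV_I]])
  have coc: "continuous_on S (\<lambda>t. coeff (P t) i)" for i S
    using holomorphic_on_imp_continuous_on[OF hol] continuous_on_subset by blast
  have cod: "continuous_on S (deriv (\<lambda>t. coeff (P t) i))" for i S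
    using holomorphic_on_imp_continuous_on[OF holomorphic_deriv[OF hol open_UNIV]] continuous_on_subset by blast
  have Fc: "continuous_on S (\<lambda>x. F (f x) (g x))" if "continuous_on S f" "continuous_on S g"
    for S and f g :: "'z::topological_space \<Rightarrow> complex"
    unfolding Fsum by (intro continuous_intros continuous_on_compose2[OF coc that(1)] that) auto
  have F'c: "continuous_on S (\<lambda>x. F' (f x) (g x))" if "continuous_on S f" "continuous_on S g"
    for S and f g :: "'z::topological_space \<Rightarrow> complex"
    unfolding F'_def by (intro continuous_intros continuous_on_compose2[OF cod that(1)] that) auto
  have rt: "F t s = 0 \<longleftrightarrow> (t, s) \<in> A \<or> (t, s) \<in> B" for t s
    using roots unfolding F_def by (auto simp: set_eq_iff)
  have finA: "finite {s. (t, s) \<in> A}" for t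
    by (rule finite_subset[OF _ poly_roots_finite[OF P0[of t]]]) (use rt F_def in auto)
  let ?h = "\<lambda>t. \<Sum>s | (t, s) \<in> A. residue (\<lambda>w. w ^ l / F t w) s"
  have "\<exists>\<delta>>0. \<exists>g. g holomorphic_on ball t0 \<delta> \<and> (\<forall>t\<in>ball t0 \<delta>. ?h t = g t)" for t0
  proof -
    define R where "R = {s. (t0, s) \<in> A}"
    have finR: "finite R" unfolding R_def by (rule finA)
    define Z where "Z = {s. F t0 s = 0}"
    have finZ: "finite Z" unfolding Z_def F_def by (rule poly_roots_finite[OF P0])
    have RZ: "R \<subseteq> Z" by (auto simp: R_def Z_def rt)
    \<comment> \<open>Closed discs of radius \<open>r\<close> about distinct roots over
      \<open>t0\<close> are disjoint, roots in \<open>B\<close> included.\<close>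
    obtain r where r: "r > 0" "\<And>a b. a \<in> Z \<Longrightarrow> b \<in> Z \<Longrightarrow> a \<noteq> b \<Longrightarrow> dist a b > 2 * r"
    proof -
      let ?D = "(\<lambda>(a, b). dist a b) ` {(a, b). a \<in> Z \<and> b \<in> Z \<and> a \<noteq> b}"
      have "{(a, b). a \<in> Z \<and> b \<in> Z \<and> a \<noteq> b} \<subseteq> Z \<times> Z" by auto
      hence fin: "finite ?D" using finZ finite_subset by blast
      define m where "m = Min (insert 1 ?D)"
      have "m > 0" unfolding m_def using fin by (subst Min_gr_iff) auto
      moreover have "dist a b \<ge> m" if "a \<in> Z" "b \<in> Z" "a \<noteq> b" for a b
        unfolding m_def using fin that by (intro Min_le) auto
      ultimately show ?thesis by (intro that[of "m / 3"]) force+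
    qed
    define C where "C = (\<Union>\<alpha>\<in>R. sphere \<alpha> r)"
    define D where "D = (\<Union>\<alpha>\<in>R. cball \<alpha> r)"
    define V where "V = (\<Union>\<alpha>\<in>R. ball \<alpha> r)"
    have comp: "compact C" "compact D" unfolding C_def D_def using finR by (auto intro!: compact_UN)
    have openV: "open V" unfolding V_def by auto
    obtain M where M: "M \<ge> 0" "\<And>t i. t \<in> cball t0 1 \<Longrightarrow> i \<le> d \<Longrightarrow> norm (coeff (P t) i) \<le> M"
    proof -
      have "\<exists>M. \<forall>t\<in>cball t0 1. norm (coeff (P t) i) \<le> M" for i
        using compact_imp_bounded[OF compact_continuous_image[OF coc[of "cball t0 1" i]]]
        by (auto simp: bounded_iff)
      then obtain M where M: "\<And>i t. t \<in> cball t0 1 \<Longrightarrow> norm (coeff (P t) i) \<le> M i" by metis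
      have "norm (coeff (P t) i) \<le> (\<Sum>i\<le>d. \<bar>M i\<bar>)" if "t \<in> cball t0 1" "i \<le> d" for t i
      proof -
        have "norm (coeff (P t) i) \<le> \<bar>M i\<bar>" using M[OF that(1), of i] by linarith
        also have "\<dots> \<le> (\<Sum>i\<le>d. \<bar>M i\<bar>)" using that by (intro member_le_sum) auto
        finally show ?thesis .
      qed
      thus ?thesis by (intro that[of "\<Sum>i\<le>d. \<bar>M i\<bar>"]) (auto intro!: sum_nonneg)
    qed
    \<comment> \<open>Any root outside the discs lies in this compact set; compactness makes the
      projections to the parameter closed.\<close>
    define K where "K = cball 0 (1 + real d * M / norm c) - V"
    have compK: "compact K" unfolding K_def using openV by (intro compact_diff) auto
    have inK: "s \<in> K" if "F t s = 0" "t \<in> cball t0 1" "s \<notin> V" for s t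
    proof -
      have "norm s \<le> 1 + real d * M / norm c"
        using that M by (intro root_norm_le[OF deg[of t] lead c]) (auto simp: F_def)
      thus ?thesis using that by (simp add: K_def)
    qed
    have clsw: "closed {(s, t). (t, s) \<in> E}" if "closed E" for E :: "(complex \<times> complex) set"
    proof -
      have "{(s, t). (t, s) \<in> E} = prod.swap -` E" by auto
      also have "closed \<dots>" by (rule closed_vimage[OF that]) (auto intro!: continuous_intros simp: prod.swap_def)
      finally show ?thesis .
    qed
    have proj: "closed {t. \<exists>s. s \<in> Q \<and> (t, s) \<in> E}" if "compact Q" "closed E"
      for Q and E :: "(complex \<times> complex) set"
      using closed_compact_projection[OF that(1) clsw[OF that(2)]] by simp
    \<comment> \<open>Parameters with no root on the circles, no root of \<open>B\<close> in the
      closed discs and no root of \<open>A\<close> in \<open>K\<close>.\<close>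
    define N where "N = - ({t. \<exists>s. s \<in> C \<and> (t, s) \<in> A \<union> B} \<union> {t. \<exists>s. s \<in> D \<and> (t, s) \<in> B}
        \<union> {t. \<exists>s. s \<in> K \<and> (t, s) \<in> A})"
    have "open N" unfolding N_def open_closed[symmetric] double_complement
      by (intro open_Compl closed_Un proj comp compK cl)
    have notC: "s \<notin> Z" if sC: "s \<in> C" for s
    proof
      assume s: "s \<in> Z"
      obtain \<alpha> where a: "\<alpha> \<in> R" "dist \<alpha> s = r" using sC by (auto simp: C_def)
      hence "\<alpha> \<noteq> s" using r by auto
      thus False using r(2)[of \<alpha> s] a RZ s r(1) by auto
    qed
    have Dz: "s \<in> R" if sD: "s \<in> D" "s \<in> Z" for s
    proof -
      obtain \<alpha> where a: "\<alpha> \<in> R" "dist \<alpha> s \<le> r" using sD by (auto simp: D_def)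
      show ?thesis
      proof (cases "\<alpha> = s")
        case False
        thus ?thesis using r(2)[of \<alpha> s] a RZ sD r(1) by auto
      qed (use a in auto)
    qed
    have "t0 \<in> N"
      using notC Dz disj r(1) unfolding N_def K_def V_def Z_def R_def rt by fastforce
    then obtain \<delta>' where d': "\<delta>' > 0" "ball t0 \<delta>' \<subseteq> N" using \<open>open N\<close> open_contains_ball by blast
    \<comment> \<open>The bound \<open>M\<close>, and with it \<open>K\<close>, is valid only within
      distance 1 of \<open>t0\<close>.\<close>
    define \<delta> where "\<delta> = min \<delta>' 1"
    have dl: "\<delta> > 0" "ball t0 \<delta> \<subseteq> N" "ball t0 \<delta> \<subseteq> cball t0 1" using d' by (auto simp: \<delta>_def)
    have ne: "F t s \<noteq> 0" if "t \<in> ball t0 \<delta>" "s \<in> C" for t s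
      using that dl(2) unfolding rt N_def by blast
    have RA: "{s. (t, s) \<in> A} = (\<Union>\<alpha>\<in>R. {s \<in> ball \<alpha> r. F t s = 0})" if t: "t \<in> ball t0 \<delta>" for t
    proof (intro set_eqI iffI)
      fix s assume "s \<in> {s. (t, s) \<in> A}"
      hence s: "(t, s) \<in> A" by simp
      have "s \<notin> K" using s t dl(2) unfolding N_def by blast
      hence "s \<in> V" using inK[of t s] s rt t dl(3) by blast
      thus "s \<in> (\<Union>\<alpha>\<in>R. {s \<in> ball \<alpha> r. F t s = 0})" using s rt by (auto simp: V_def)
    next
      fix s assume "s \<in> (\<Union>\<alpha>\<in>R. {s \<in> ball \<alpha> r. F t s = 0})"
      hence s: "s \<in> D" "F t s = 0" by (force simp: D_def)+
      hence "(t, s) \<notin> B" using t dl(2) unfolding N_def by blast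
      thus "s \<in> {s. (t, s) \<in> A}" using s rt by auto
    qed
    define g where "g t = (\<Sum>\<alpha>\<in>R. contour_integral (circlepath \<alpha> r) (\<lambda>w. w ^ l / F t w) / (2 * pi * \<i>))" for t
    have eq: "?h t = g t" if t: "t \<in> ball t0 \<delta>" for t
    proof -
      have finZt: "finite {s. F t s = 0}" unfolding F_def by (rule poly_roots_finite[OF P0])
      have "?h t = (\<Sum>\<alpha>\<in>R. \<Sum>s\<in>{s \<in> ball \<alpha> r. F t s = 0}. residue (\<lambda>w. w ^ l / F t w) s)"
        unfolding RA[OF t]
      proof (rule sum.UNION_disjoint)
        show "\<forall>i\<in>R. finite {s \<in> ball i r. F t s = 0}" using finZt by auto
        show "\<forall>i\<in>R. \<forall>j\<in>R. i \<noteq> j \<longrightarrow> {s \<in> ball i r. F t s = 0} \<inter> {s \<in> ball j r. F t s = 0} = {}"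
        proof (intro ballI impI)
          fix i j assume ij: "i \<in> R" "j \<in> R" "i \<noteq> j"
          have "dist i j > 2 * r" using ij RZ r by blast
          thus "{s \<in> ball i r. F t s = 0} \<inter> {s \<in> ball j r. F t s = 0} = {}"
            using dist_triangle_less_add[of i _ r j r] by (fastforce simp: dist_commute)
        qed
      qed (rule finR)
      also have "\<dots> = g t"
        unfolding g_def
      proof (rule sum.cong[OF refl])
        fix \<alpha> assume a: "\<alpha> \<in> R"
        let ?f = "\<lambda>w. w ^ l / F t w" and ?Z = "{s. F t s = 0}"
        have sub: "sphere \<alpha> r \<subseteq> C" using a by (auto simp: C_def)
        have "contour_integral (circlepath \<alpha> r) ?f
          = 2 * pi * \<i> * (\<Sum>p\<in>?Z. winding_number (circlepath \<alpha> r) p * residue ?f p)"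
        proof (rule Residue_theorem[where S=UNIV])
          show "?f holomorphic_on UNIV - ?Z"
            unfolding F_def by (intro holomorphic_intros) auto
          show "path_image (circlepath \<alpha> r) \<subseteq> UNIV - ?Z"
            using ne[OF t] sub r(1) by auto
        qed (use finZt in auto)
        also have "(\<Sum>p\<in>?Z. winding_number (circlepath \<alpha> r) p * residue ?f p)
          = (\<Sum>p\<in>{s \<in> ball \<alpha> r. F t s = 0}. winding_number (circlepath \<alpha> r) p * residue ?f p)"
        proof (rule sum.mono_neutral_right[OF finZt])
          show "\<forall>i\<in>?Z - {s \<in> ball \<alpha> r. F t s = 0}. winding_number (circlepath \<alpha> r) i * residue ?f i = 0"
          proof
            fix i assume i: "i \<in> ?Z - {s \<in> ball \<alpha> r. F t s = 0}"
            hence "i \<notin> sphere \<alpha> r" using ne[OF t] sub by blast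
            hence "i \<notin> cball \<alpha> r" using i by auto
            hence "winding_number (circlepath \<alpha> r) i = 0"
              using r(1) by (intro winding_number_zero_outside[of _ "cball \<alpha> r"]) auto
            thus "winding_number (circlepath \<alpha> r) i * residue ?f i = 0" by simp
          qed
        qed auto
        also have "\<dots> = (\<Sum>p\<in>{s \<in> ball \<alpha> r. F t s = 0}. residue ?f p)"
          by (rule sum.cong[OF refl]) (auto simp: winding_number_circlepath dist_norm norm_minus_commute)
        finally show "(\<Sum>s\<in>{s \<in> ball \<alpha> r. F t s = 0}. residue ?f s)
            = contour_integral (circlepath \<alpha> r) ?f / (2 * pi * \<i>)" by simp
      qed
      finally show ?thesis .
    qed
    have "g holomorphic_on ball t0 \<delta>"
      unfolding g_def
    proof (intro holomorphic_on_sum holomorphic_on_divide holomorphic_on_const)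
      fix \<alpha> assume a: "\<alpha> \<in> R"
      let ?c = "circlepath \<alpha> r"
      define c' where "c' x = 2 * pi * \<i> * r * exp (2 * of_real pi * \<i> * of_real x)" for x
      have inC: "?c x \<in> C" for x
      proof -
        have "norm (exp (2 * of_real pi * \<i> * of_real x)) = 1"
          using norm_exp_i_times[of "2 * pi * x"] by (simp add: mult_ac)
        hence "dist \<alpha> (?c x) = r" using r(1) by (simp add: circlepath dist_norm norm_mult)
        thus ?thesis using a by (auto simp: C_def)
      qed
      have vd: "vector_derivative ?c (at x) = c' x" for x
        unfolding c'_def by (rule vector_derivative_circlepath)
      have cc: "continuous_on S ?c" for S unfolding circlepath by (intro continuous_intros)
      have cc': "continuous_on S c'" for S unfolding c'_def by (intro continuous_intros)
      have "contour_integral ?c (\<lambda>w. w ^ l / F t w)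
          = integral (cbox 0 1) (\<lambda>x. ?c x ^ l / F t (?c x) * c' x)" for t
        unfolding contour_integral_integral cbox_interval
        by (rule integral_cong) (simp add: vd)
      moreover have "(\<lambda>t. integral (cbox 0 1) (\<lambda>x. ?c x ^ l / F t (?c x) * c' x)) holomorphic_on ball t0 \<delta>"
      proof (rule leibniz_rule_holomorphic)
        show "((\<lambda>t. ?c x ^ l / F t (?c x) * c' x) has_field_derivative
            (- (?c x ^ l * F' t (?c x)) / (F t (?c x))\<^sup>2 * c' x)) (at t within ball t0 \<delta>)"
          if "t \<in> ball t0 \<delta>" for t x
          by (rule derivative_eq_intros FD ne[OF that inC] refl)+ (simp add: power2_eq_square)
        show "(\<lambda>x. ?c x ^ l / F t (?c x) * c' x) integrable_on cbox 0 1" if "t \<in> ball t0 \<delta>" for t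
          by (intro integrable_continuous continuous_intros cc cc' Fc) (use ne[OF that inC] in auto)
        show "continuous_on (ball t0 \<delta> \<times> cbox 0 1)
            (\<lambda>(t, x). - (?c x ^ l * F' t (?c x)) / (F t (?c x))\<^sup>2 * c' x)"
          unfolding split_beta
          by (intro continuous_intros Fc F'c continuous_on_compose2[OF cc[of UNIV]]
              continuous_on_compose2[OF cc'[of UNIV]]) (use ne inC in auto)
      qed auto
      ultimately show "(\<lambda>t. contour_integral ?c (\<lambda>w. w ^ l / F t w)) holomorphic_on ball t0 \<delta>" by simp
    qed auto
    thus ?thesis using dl(1) eq by (intro exI[of _ \<delta>] exI[of _ g] conjI ballI) auto
  qed
  hence ex: "\<And>t0. \<exists>\<delta>>0. \<exists>g. g holomorphic_on ball t0 \<delta> \<and> (\<forall>t\<in>ball t0 \<delta>. ?h t = g t)" .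
  have "?h field_differentiable (at t0)" for t0
  proof -
    obtain \<delta> g where d: "\<delta> > 0" "g holomorphic_on ball t0 \<delta>" "\<forall>t\<in>ball t0 \<delta>. ?h t = g t"
      using ex[of t0] by (elim exE conjE)
    have "?h holomorphic_on ball t0 \<delta>"
      by (rule holomorphic_transform[OF d(2)]) (simp only: d(3)[rule_format])
    thus ?thesis
      by (rule holomorphic_on_imp_differentiable_at) (use d(1) in auto)
  qed
  thus ?thesis unfolding F_def holomorphic_on_def by blast
qed

section \<open>Small roots and implicit functions\<close>

text \<open>Up to sign, \<open>coeff p m / coeff p 0\<close> is an elementary symmetric function of
  the reciprocals of the roots, with at most \<open>2 ^ degree p\<close> summands of size at most
  \<open>1 / \<rho> ^ m\<close>. The induction splits off one root at a time, and each root doubles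
  the bound.\<close>

lemma poly_coeff_bound_of_roots:
  fixes p :: "complex poly"
  assumes "\<rho> > 0" "poly p 0 \<noteq> 0" "\<And>z. poly p z = 0 \<Longrightarrow> \<rho> \<le> norm z"
  shows "norm (coeff p m) * \<rho> ^ m \<le> 2 ^ degree p * norm (coeff p 0)"
  using assms(2,3)
proof (induction "degree p" arbitrary: p m)
  case 0
  then obtain c where "p = [:c:]" using degree_eq_zeroE by metis
  thus ?case by (cases m) auto
next
  case (Suc n)
  have "\<not> constant (poly p)" using Suc.hyps(2) constant_degree by (metis nat.distinct(1))
  then obtain z where z: "poly p z = 0" using fundamental_theorem_of_algebra by blast
  then obtain q where q: "p = [:-z, 1:] * q" unfolding poly_eq_0_iff_dvd by (auto elim: dvdE)
  have q0: "poly q 0 \<noteq> 0" using Suc.prems(1) by (simp add: q)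
  hence "q \<noteq> 0" by auto
  hence deg: "degree p = Suc (degree q)" unfolding q by (subst degree_mult_eq) auto
  have IH: "norm (coeff q m) * \<rho> ^ m \<le> 2 ^ degree q * norm (coeff q 0)" for m
    by (rule Suc.hyps(1)) (use deg Suc.hyps(2) q0 Suc.prems(2) in \<open>auto simp: q\<close>)
  have p0: "norm (coeff p 0) = norm z * norm (coeff q 0)"
    by (simp add: q norm_mult)
  have rz: "\<rho> \<le> norm z" using Suc.prems(2)[OF z] .
  show ?case
  proof (cases m)
    case 0
    have "1 * norm (coeff p 0) \<le> 2 ^ degree p * norm (coeff p 0)"
      by (intro mult_right_mono) auto
    thus ?thesis using 0 by simp
  next
    case (Suc k)
    have "coeff p m = coeff q k - z * coeff q m" by (simp add: q Suc)
    hence "norm (coeff p m) * \<rho> ^ m \<le> (norm (coeff q k) + norm z * norm (coeff q m)) * \<rho> ^ m"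
      using \<open>\<rho> > 0\<close> by (intro mult_right_mono) (auto intro: order_trans[OF norm_triangle_ineq4] simp: norm_mult)
    also have "\<dots> = \<rho> * (norm (coeff q k) * \<rho> ^ k) + norm z * (norm (coeff q m) * \<rho> ^ m)"
      by (simp add: Suc algebra_simps)
    also have "\<dots> \<le> norm z * (2 ^ degree q * norm (coeff q 0)) + norm z * (2 ^ degree q * norm (coeff q 0))"
      using \<open>\<rho> > 0\<close> by (intro add_mono mult_mono[OF rz IH] mult_left_mono[OF IH]) auto
    also have "\<dots> = 2 ^ degree p * norm (coeff p 0)" by (simp add: p0 deg)
    finally show ?thesis .
  qed
qed

text \<open>The coefficient bound is applied with the smallest root modulus as
  \<open>\<rho>\<close>. Multiplicities are irrelevant, so this gives continuity of roots even at a
  multiple root.\<close>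

lemma poly_small_root:
  fixes p :: "complex poly"
  assumes "degree p \<le> n" "coeff p m \<noteq> 0" "m > 0"
  shows "\<exists>z. poly p z = 0 \<and> norm (coeff p m) * norm z ^ m \<le> 2 ^ n * norm (coeff p 0)"
proof (cases "poly p 0 = 0")
  case True
  thus ?thesis using assms(3) by (intro exI[of _ 0]) (auto simp: zero_power)
next
  case False
  have "degree p > 0" using assms(2,3) le_degree by (metis gr0I leD)
  hence "\<not> constant (poly p)" using constant_degree by (metis less_irrefl)
  then obtain z0 where z0: "poly p z0 = 0" using fundamental_theorem_of_algebra by blast
  have "p \<noteq> 0" using assms(2) by auto
  hence fin: "finite (norm ` {z. poly p z = 0})" using poly_roots_finite by blast
  have ne: "norm ` {z. poly p z = 0} \<noteq> {}" using z0 by blast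
  obtain z where z: "poly p z = 0" "norm z = Min (norm ` {z. poly p z = 0})"
    using Min_in[OF fin ne] by auto
  have "norm (coeff p m) * norm z ^ m \<le> 2 ^ degree p * norm (coeff p 0)"
  proof (rule poly_coeff_bound_of_roots)
    show "norm z > 0" using False z(1) by auto
    show "norm z \<le> norm y" if "poly p y = 0" for y
      unfolding z(2) by (rule Min_le[OF fin]) (use that in auto)
  qed (rule False)
  also have "\<dots> \<le> 2 ^ n * norm (coeff p 0)"
    using assms(1) by (intro mult_right_mono power_increasing) auto
  finally show ?thesis using z(1) by blast
qed

text \<open>Implicit function theorem by the contraction \<open>a - h a b / \<alpha>\<close>.
  Lipschitz dependence and uniqueness in a full box are part of the conclusion: the curve has to be
  rectifiable and has to be the whole zero set nearby.\<close>

lemma implicit_curve: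
  fixes h :: "complex \<Rightarrow> complex \<Rightarrow> complex"
  assumes h0: "h a0 b0 = 0" and \<alpha>: "\<alpha> \<noteq> 0" and R: "R > 0"
    and strict: "\<And>e. e > 0 \<Longrightarrow> \<exists>\<delta>>0. \<forall>a\<in>ball a0 \<delta>. \<forall>a'\<in>ball a0 \<delta>. \<forall>b\<in>ball b0 \<delta>. \<forall>b'\<in>ball b0 \<delta>.
        norm (h a b - h a' b' - \<alpha> * (a - a') - \<beta> * (b - b')) \<le> e * (norm (a - a') + norm (b - b'))"
  shows "\<exists>\<sigma> \<rho> \<phi> L. 0 < \<sigma> \<and> \<sigma> \<le> R \<and> 0 < \<rho> \<and> \<rho> \<le> R \<and> L-lipschitz_on (cball b0 \<rho>) \<phi> \<and> \<phi> b0 = a0 \<and>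
    (\<forall>b\<in>cball b0 \<rho>. \<phi> b \<in> ball a0 \<sigma> \<and> h (\<phi> b) b = 0) \<and>
    (\<forall>a\<in>ball a0 \<sigma>. \<forall>b\<in>cball b0 \<rho>. h a b = 0 \<longrightarrow> a = \<phi> b)"
proof -
  \<comment> \<open>With this tolerance the map \<open>?T\<close> below contracts by the factor
    1/2.\<close>
  define e where "e = norm \<alpha> / 2"
  have e: "e > 0" using \<alpha> by (simp add: e_def)
  obtain \<delta> where \<delta>: "\<delta> > 0" and st: "\<And>a a' b b'. a \<in> ball a0 \<delta> \<Longrightarrow> a' \<in> ball a0 \<delta> \<Longrightarrow> b \<in> ball b0 \<delta> \<Longrightarrow> b' \<in> ball b0 \<delta> \<Longrightarrow>
        norm (h a b - h a' b' - \<alpha> * (a - a') - \<beta> * (b - b')) \<le> e * (norm (a - a') + norm (b - b'))"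
    using strict[OF e] by blast
  define \<sigma> where "\<sigma> = min \<delta> R"
  have s: "\<sigma> > 0" "\<sigma> \<le> \<delta>" "\<sigma> \<le> R" using \<delta> R by (auto simp: \<sigma>_def)
  define K where "K = norm \<beta> + e"
  have K: "K > 0" using e by (simp add: K_def add_nonneg_pos)
  \<comment> \<open>The second bound gives
    \<open>norm (h a0 b) \<le> norm \<alpha> * \<sigma> / 4\<close>, which makes \<open>?T\<close>
    map \<open>cball a0 (\<sigma> / 2)\<close> into itself.\<close>
  define \<rho> where "\<rho> = min (\<sigma> / 2) (norm \<alpha> * \<sigma> / (4 * K))"
  have r: "\<rho> > 0" "\<rho> < \<sigma>" "K * \<rho> \<le> norm \<alpha> * \<sigma> / 4"
  proof -
    show "\<rho> > 0" using s K \<alpha> by (simp add: \<rho>_def)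
    have "\<rho> \<le> \<sigma> / 2" unfolding \<rho>_def by (rule min.cobounded1)
    thus "\<rho> < \<sigma>" using s by simp
    have "K * \<rho> \<le> K * (norm \<alpha> * \<sigma> / (4 * K))" using K by (intro mult_left_mono) (auto simp: \<rho>_def)
    thus "K * \<rho> \<le> norm \<alpha> * \<sigma> / 4" using K by simp
  qed
  \<comment> \<open>For two zeros the values of \<open>h\<close> drop out, and the error absorbs
    only half of \<open>\<alpha> * (a - a')\<close>. The estimate serves for the Lipschitz bound
    and, with \<open>b = b'\<close>, for uniqueness.\<close>
  have lip: "norm (a - a') \<le> (2 * norm \<beta> / norm \<alpha> + 1) * norm (b - b')"
    if "a \<in> ball a0 \<sigma>" "a' \<in> ball a0 \<sigma>" "b \<in> ball b0 \<sigma>" "b' \<in> ball b0 \<sigma>" "h a b = 0" "h a' b' = 0" for a a' b b'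
  proof -
    have "norm (\<alpha> * (a - a') + \<beta> * (b - b')) = norm (h a b - h a' b' - \<alpha> * (a - a') - \<beta> * (b - b'))"
      using that(5,6) by (simp add: norm_minus_commute[of 0] flip: norm_minus_cancel[of "\<alpha> * (a - a') + \<beta> * (b - b')"])
    also have "\<dots> \<le> e * (norm (a - a') + norm (b - b'))" using that s by (intro st) auto
    finally have 1: "norm (\<alpha> * (a - a') + \<beta> * (b - b')) \<le> e * (norm (a - a') + norm (b - b'))" .
    have "norm (\<alpha> * (a - a')) \<le> norm (\<alpha> * (a - a') + \<beta> * (b - b')) + norm (\<beta> * (b - b'))"
      by (metis add_diff_cancel_right' norm_triangle_ineq4)
    hence "norm \<alpha> * norm (a - a') \<le> norm \<alpha> / 2 * (norm (a - a') + norm (b - b')) + norm \<beta> * norm (b - b')"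
      using 1 by (simp add: norm_mult e_def)
    hence "norm \<alpha> * norm (a - a') \<le> (2 * norm \<beta> + norm \<alpha>) * norm (b - b')"
      by (simp add: algebra_simps)
    thus ?thesis using \<alpha> by (simp add: field_simps)
  qed
  have ex: "\<exists>a\<in>ball a0 \<sigma>. h a b = 0" if b: "b \<in> cball b0 \<rho>" for b
  proof -
    have bb: "b \<in> ball b0 \<delta>" "b0 \<in> ball b0 \<delta>" using b r s \<delta> by auto
    let ?T = "\<lambda>a. a - h a b / \<alpha>"
    have T: "norm (?T a - ?T a') \<le> 1/2 * norm (a - a')" if "a \<in> ball a0 \<sigma>" "a' \<in> ball a0 \<sigma>" for a a'
    proof -
      have "norm (h a b - h a' b - \<alpha> * (a - a') - \<beta> * (b - b)) \<le> e * (norm (a - a') + norm (b - b))"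
        using that s bb by (intro st) auto
      hence "norm (h a b - h a' b - \<alpha> * (a - a')) / norm \<alpha> \<le> e * norm (a - a') / norm \<alpha>"
        by (intro divide_right_mono) auto
      also have "norm (h a b - h a' b - \<alpha> * (a - a')) / norm \<alpha> = norm (?T a - ?T a')"
      proof -
        have "?T a - ?T a' = - ((h a b - h a' b - \<alpha> * (a - a')) / \<alpha>)"
          using \<alpha> by (simp add: diff_divide_distrib)
        thus ?thesis by (simp only: norm_minus_cancel norm_divide)
      qed
      also have "e * norm (a - a') / norm \<alpha> = 1/2 * norm (a - a')" using \<alpha> by (simp add: e_def)
      finally show ?thesis .
    qed
    have h0b: "norm (h a0 b) \<le> norm \<alpha> * \<sigma> / 4"
    proof -
      have "norm (h a0 b - h a0 b0 - \<alpha> * (a0 - a0) - \<beta> * (b - b0)) \<le> e * (norm (a0 - a0) + norm (b - b0))"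
        using s bb by (intro st) auto
      hence 1: "norm (h a0 b - \<beta> * (b - b0)) \<le> e * norm (b - b0)" by (simp add: h0)
      have "norm (h a0 b) - norm \<beta> * norm (b - b0) \<le> norm (h a0 b - \<beta> * (b - b0))"
        using norm_triangle_ineq2[of "h a0 b" "\<beta> * (b - b0)"] by (simp only: norm_mult)
      hence "norm (h a0 b) \<le> K * norm (b - b0)"
        using 1 unfolding K_def distrib_right by linarith
      also have "\<dots> \<le> K * \<rho>" using b K by (intro mult_left_mono) (auto simp: dist_norm norm_minus_commute)
      finally show ?thesis using r by linarith
    qed
    have "\<exists>!x. x \<in> cball a0 (\<sigma> / 2) \<and> ?T x = x"
    proof (rule Banach_fix[of _ "1/2"])
      show "?T ` cball a0 (\<sigma> / 2) \<subseteq> cball a0 (\<sigma> / 2)"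
      proof safe
        fix a assume a: "a \<in> cball a0 (\<sigma> / 2)"
        have "norm (?T a - ?T a0) \<le> 1/2 * norm (a - a0)" using a s by (intro T) auto
        also have "\<dots> \<le> \<sigma> / 4" using a by (simp add: dist_norm norm_minus_commute)
        finally have 1: "norm (?T a - ?T a0) \<le> \<sigma> / 4" .
        have "norm (?T a0 - a0) = norm (h a0 b) / norm \<alpha>" by (simp add: norm_divide)
        also have "\<dots> \<le> (norm \<alpha> * \<sigma> / 4) / norm \<alpha>" using h0b by (intro divide_right_mono) auto
        also have "\<dots> = \<sigma> / 4" using \<alpha> by simp
        finally have 2: "norm (?T a0 - a0) \<le> \<sigma> / 4" .
        have "norm (?T a - a0) \<le> norm (?T a - ?T a0) + norm (?T a0 - a0)"
          using dist_triangle[of "?T a" a0 "?T a0"] by (simp only: dist_norm)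
        thus "?T a \<in> cball a0 (\<sigma> / 2)" using 1 2 by (simp add: dist_norm norm_minus_commute)
      qed
      show "dist (?T x) (?T y) \<le> 1/2 * dist x y" if "x \<in> cball a0 (\<sigma> / 2)" "y \<in> cball a0 (\<sigma> / 2)" for x y
        unfolding dist_norm using that s by (intro T) auto
    qed (use s in \<open>auto simp: complete_eq_closed\<close>)
    then obtain a where "a \<in> cball a0 (\<sigma> / 2)" "?T a = a" by blast
    thus ?thesis using \<alpha> s by (intro bexI[of _ a]) auto
  qed
  define \<phi> where "\<phi> b = (SOME a. a \<in> ball a0 \<sigma> \<and> h a b = 0)" for b
  have \<phi>: "\<phi> b \<in> ball a0 \<sigma>" "h (\<phi> b) b = 0" if "b \<in> cball b0 \<rho>" for b
    using someI_ex[of "\<lambda>a. a \<in> ball a0 \<sigma> \<and> h a b = 0"] ex[OF that] unfolding \<phi>_def by blast+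
  have cb: "b \<in> ball b0 \<sigma>" if "b \<in> cball b0 \<rho>" for b using that r by auto
  have uniq: "a = \<phi> b" if "a \<in> ball a0 \<sigma>" "b \<in> cball b0 \<rho>" "h a b = 0" for a b
    using lip[OF that(1) \<phi>(1)[OF that(2)] cb[OF that(2)] cb[OF that(2)] that(3) \<phi>(2)[OF that(2)]] by simp
  have L: "(2 * norm \<beta> / norm \<alpha> + 1)-lipschitz_on (cball b0 \<rho>) \<phi>"
    unfolding lipschitz_on_def dist_norm using lip \<phi> cb by auto
  have "\<phi> b0 = a0" using uniq[of a0 b0] s r h0 by auto
  thus ?thesis using s r L \<phi> uniq
    by (intro exI[of _ \<sigma>] exI[of _ \<rho>] exI[of _ \<phi>] exI[of _ "2 * norm \<beta> / norm \<alpha> + 1"]) auto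
qed

section \<open>Weighted homogeneous polynomials\<close>

lemma continuous_on_eval3 [continuous_intros]:
  assumes "continuous_on S f"
  shows "continuous_on S (\<lambda>x. eval3 c (f x))"
proof -
  have "continuous_on UNIV (\<lambda>p. eval3 c p)"
    unfolding eval3_def split_beta by (intro continuous_intros)
  from continuous_on_compose2[OF this assms] show ?thesis by auto
qed

lemma eval3_box:
  assumes "is_poly3 c" "\<And>i j k. c (i, j, k) \<noteq> 0 \<Longrightarrow> i \<le> N \<and> j \<le> N \<and> k \<le> N"
  shows "eval3 c (x, y, z) = (\<Sum>i\<le>N. \<Sum>j\<le>N. \<Sum>k\<le>N. c (i, j, k) * x ^ i * y ^ j * z ^ k)"
proof -
  have "eval3 c (x, y, z) = (\<Sum>(i, j, k)\<in>{..N} \<times> {..N} \<times> {..N}. c (i, j, k) * x ^ i * y ^ j * z ^ k)"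
    unfolding eval3_def
    by (rule sum.mono_neutral_cong_left) (use assms in \<open>auto simp: poly3_support_def\<close>)
  thus ?thesis by (simp add: sum.cartesian_product)
qed

lemma is_poly3_bounded:
  assumes "is_poly3 c"
  obtains N where "\<And>i j k. c (i, j, k) \<noteq> 0 \<Longrightarrow> i \<le> N \<and> j \<le> N \<and> k \<le> N"
proof -
  have fin: "finite (poly3_support c)" using assms by (simp add: is_poly3_def)
  define N where "N = (\<Sum>(i, j, k)\<in>poly3_support c. i + j + k)"
  have "i + j + k \<le> N" if "c (i, j, k) \<noteq> 0" for i j k
    unfolding N_def using member_le_sum[of "(i,j,k)" "poly3_support c" "\<lambda>(i,j,k). i + j + k"] fin that
    by (auto simp: poly3_support_def)
  thus ?thesis by (intro that[of N]) force
qed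

lemma is_poly3_if_bounded:
  assumes "\<And>i j k. c (i, j, k) \<noteq> 0 \<Longrightarrow> i \<le> N \<and> j \<le> N \<and> k \<le> (N::nat)"
  shows "is_poly3 c"
  unfolding is_poly3_def
  by (rule finite_subset[of _ "{..N} \<times> {..N} \<times> {..N}"]) (use assms in \<open>auto simp: poly3_support_def\<close>)

lemma eval3_eq_0_imp:
  assumes "is_poly3 c" "\<And>x y z. eval3 c (x, y, z) = 0"
  shows "c (i, j, k) = 0"
proof -
  obtain N where N: "\<And>i j k. c (i, j, k) \<noteq> 0 \<Longrightarrow> i \<le> N \<and> j \<le> N \<and> k \<le> N"
    using is_poly3_bounded[OF assms(1)] by blast
  have "(\<Sum>i\<le>N. (\<Sum>j\<le>N. (\<Sum>k\<le>N. c (i, j, k) * z ^ k) * y ^ j) * x ^ i) = 0" for x y z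
  proof -
    have "eval3 c (x, y, z) = (\<Sum>i\<le>N. \<Sum>j\<le>N. \<Sum>k\<le>N. c (i, j, k) * x ^ i * y ^ j * z ^ k)"
      by (rule eval3_box[OF assms(1)]) (use N in blast)
    thus ?thesis using assms(2)[of x y z] by (simp add: sum_distrib_right sum_distrib_left mult_ac)
  qed
  hence "\<forall>i\<le>N. (\<Sum>j\<le>N. (\<Sum>k\<le>N. c (i, j, k) * z ^ k) * y ^ j) = 0" for y z
    by (subst polyfun_eq_0[symmetric]) auto
  hence "i \<le> N \<Longrightarrow> \<forall>j\<le>N. (\<Sum>k\<le>N. c (i, j, k) * z ^ k) = 0" for i z
    by (subst polyfun_eq_0[symmetric]) auto
  hence "i \<le> N \<Longrightarrow> j \<le> N \<Longrightarrow> \<forall>k\<le>N. c (i, j, k) = 0" for i j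
    by (subst polyfun_eq_0[symmetric]) auto
  thus ?thesis using N by blast
qed

text \<open>The derivative keeps the upper limit \<open>N\<close>, so its top term involves
  \<open>a (Suc N)\<close>; the hypothesis removes this excess term.\<close>

lemma sum_power_has_field_derivative:
  fixes a :: "nat \<Rightarrow> complex"
  assumes "a (Suc N) = 0"
  shows "((\<lambda>x. \<Sum>i\<le>N. a i * x ^ i) has_field_derivative (\<Sum>i\<le>N. of_nat (Suc i) * a (Suc i) * x ^ i)) (at x)"
proof -
  have "(\<Sum>i\<le>N. of_nat (Suc i) * a (Suc i) * x ^ i) = (\<Sum>i\<in>{1..Suc N}. of_nat i * a i * x ^ (i - 1))"
    by (rule sum.reindex_bij_witness[of _ "\<lambda>i. i - 1" Suc]) auto
  also have "\<dots> = (\<Sum>i\<le>N. a i * (of_nat i * x ^ (i - 1)))"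
    by (rule sum.mono_neutral_cong) (use assms in \<open>auto simp: le_Suc_eq not_le\<close>)
  finally show ?thesis
    by (auto intro!: derivative_eq_intros sum.cong)
qed

text \<open>Homogeneity at \<open>t = 2\<close> says that the polynomial \<open>g\<close> vanishes
  identically. A nonzero coefficient of \<open>c\<close> then forces two powers of 2 to
  agree.\<close>

lemma weighted_homogeneous3_monomials:
  assumes "is_poly3 c" "weighted_homogeneous3 c w1 w2 w3 d" "c (i, j, k) \<noteq> 0"
  shows "w1 * i + w2 * j + w3 * k = d"
proof -
  define g :: cpoly3 where "g = (\<lambda>(i, j, k). c (i, j, k) * (2 ^ (w1 * i + w2 * j + w3 * k) - 2 ^ d))"
  have sub: "poly3_support g \<subseteq> poly3_support c" by (auto simp: g_def poly3_support_def)
  have fin: "finite (poly3_support c)" using assms(1) by (simp add: is_poly3_def)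
  have g: "is_poly3 g" using fin sub finite_subset by (auto simp: is_poly3_def)
  have "eval3 g (x, y, z) = 0" for x y z
  proof -
    have "eval3 g (x, y, z) = (\<Sum>(i, j, k)\<in>poly3_support c. g (i, j, k) * x ^ i * y ^ j * z ^ k)"
      unfolding eval3_def
      by (rule sum.mono_neutral_cong_left[OF fin sub]) (auto simp: poly3_support_def)
    also have "\<dots> = eval3 c (2 ^ w1 * x, 2 ^ w2 * y, 2 ^ w3 * z) - 2 ^ d * eval3 c (x, y, z)"
      unfolding eval3_def sum_distrib_left sum_subtractf[symmetric]
      by (rule sum.cong) (auto simp: g_def power_mult_distrib power_add power_mult[symmetric] algebra_simps)
    also have "\<dots> = 0"
      using assms(2) unfolding weighted_homogeneous3_def by simp
    finally show ?thesis .
  qed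
  hence "g (i, j, k) = 0" using eval3_eq_0_imp[OF g] by blast
  hence "(2::complex) ^ (w1 * i + w2 * j + w3 * k) = 2 ^ d" using assms(3) by (simp add: g_def)
  hence "of_nat (2 ^ (w1 * i + w2 * j + w3 * k)) = (of_nat (2 ^ d) :: complex)" by simp
  hence "(2::nat) ^ (w1 * i + w2 * j + w3 * k) = 2 ^ d" by (metis of_nat_eq_iff)
  thus ?thesis by simp
qed

lemma sum_power_euler:
  fixes a :: "nat \<Rightarrow> complex"
  assumes "a (Suc N) = 0"
  shows "x * (\<Sum>i\<le>N. of_nat (Suc i) * a (Suc i) * x ^ i) = (\<Sum>i\<le>N. of_nat i * a i * x ^ i)"
proof -
  have "x * (\<Sum>i\<le>N. of_nat (Suc i) * a (Suc i) * x ^ i) = (\<Sum>i\<le>N. of_nat (Suc i) * a (Suc i) * x ^ Suc i)"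
    by (simp add: sum_distrib_left mult_ac)
  also have "\<dots> = (\<Sum>i\<in>{1..Suc N}. of_nat i * a i * x ^ i)"
    by (rule sum.reindex_bij_witness[of _ "\<lambda>i. i - 1" Suc]) auto
  also have "\<dots> = (\<Sum>i\<le>N. of_nat i * a i * x ^ i)"
    by (rule sum.mono_neutral_cong) (use assms in \<open>auto simp: le_Suc_eq not_le\<close>)
  finally show ?thesis .
qed

lemma norm_Pair_le_mult:
  assumes "norm a' \<le> c * norm a" "norm b' \<le> c * norm b" "c \<ge> 0"
  shows "norm (a', b') \<le> c * norm (a, b)"
proof -
  have "norm (a', b') = sqrt ((norm a')\<^sup>2 + (norm b')\<^sup>2)" by (simp add: norm_Pair)
  also have "\<dots> \<le> sqrt ((c * norm a)\<^sup>2 + (c * norm b)\<^sup>2)"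
    by (intro real_sqrt_le_mono add_mono power_mono assms) auto
  also have "\<dots> = sqrt (c\<^sup>2 * ((norm a)\<^sup>2 + (norm b)\<^sup>2))" by (simp add: power_mult_distrib distrib_left)
  also have "\<dots> = c * norm (a, b)" using assms(3) by (simp add: norm_Pair real_sqrt_mult)
  finally show ?thesis .
qed

section \<open>The weighted action on points and polynomials\<close>

locale whpoly =
  fixes F :: cpoly3 and w1 w2 w3 d :: nat
  assumes is_poly: "is_poly3 F"
    and w1_pos: "w1 > 0" and w2_pos: "w2 > 0" and w3_pos: "w3 > 0"
    and monomial: "\<And>i j k. F (i, j, k) \<noteq> 0 \<Longrightarrow> w1 * i + w2 * j + w3 * k = d"
begin

definition act :: "complex \<Rightarrow> complex \<times> complex \<times> complex \<Rightarrow> complex \<times> complex \<times> complex" where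
  "act t p = (t ^ w1 * fst p, t ^ w2 * fst (snd p), t ^ w3 * snd (snd p))"

lemma act_simp [simp]: "act t (x, y, z) = (t ^ w1 * x, t ^ w2 * y, t ^ w3 * z)"
  by (simp add: act_def)

lemma monomial_le: "F (i, j, k) \<noteq> 0 \<Longrightarrow> i \<le> d \<and> j \<le> d \<and> k \<le> d"
proof -
  assume "F (i, j, k) \<noteq> 0"
  hence "w1 * i + w2 * j + w3 * k = d" by (rule monomial)
  moreover have "i \<le> w1 * i" "j \<le> w2 * j" "k \<le> w3 * k"
    using w1_pos w2_pos w3_pos by auto
  ultimately show ?thesis by linarith
qed

lemma eval_sum: "eval3 F (x, y, z) = (\<Sum>i\<le>d. \<Sum>j\<le>d. \<Sum>k\<le>d. F (i, j, k) * x ^ i * y ^ j * z ^ k)"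
  by (rule eval3_box[OF is_poly]) (use monomial_le in blast)

lemma partial_bounded:
  "dx3 F (i, j, k) \<noteq> 0 \<Longrightarrow> i \<le> d \<and> j \<le> d \<and> k \<le> d"
  "dy3 F (i, j, k) \<noteq> 0 \<Longrightarrow> i \<le> d \<and> j \<le> d \<and> k \<le> d"
  "dz3 F (i, j, k) \<noteq> 0 \<Longrightarrow> i \<le> d \<and> j \<le> d \<and> k \<le> d"
  using monomial_le by (auto simp: dx3_def dy3_def dz3_def dest!: Suc_leD)

lemma eval_dx: "eval3 (dx3 F) (x, y, z) =
    (\<Sum>i\<le>d. \<Sum>j\<le>d. \<Sum>k\<le>d. of_nat (Suc i) * F (Suc i, j, k) * x ^ i * y ^ j * z ^ k)"
  by (subst eval3_box[where N=d])
     (use partial_bounded in \<open>blast intro: is_poly3_if_bounded\<close>, use partial_bounded in blast, simp add: dx3_def)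

lemma eval_dy: "eval3 (dy3 F) (x, y, z) =
    (\<Sum>i\<le>d. \<Sum>j\<le>d. \<Sum>k\<le>d. of_nat (Suc j) * F (i, Suc j, k) * x ^ i * y ^ j * z ^ k)"
  by (subst eval3_box[where N=d])
     (use partial_bounded in \<open>blast intro: is_poly3_if_bounded\<close>, use partial_bounded in blast, simp add: dy3_def)

lemma eval_dz: "eval3 (dz3 F) (x, y, z) =
    (\<Sum>i\<le>d. \<Sum>j\<le>d. \<Sum>k\<le>d. of_nat (Suc k) * F (i, j, Suc k) * x ^ i * y ^ j * z ^ k)"
  by (subst eval3_box[where N=d])
     (use partial_bounded in \<open>blast intro: is_poly3_if_bounded\<close>, use partial_bounded in blast, simp add: dz3_def)

lemma F_Suc_d: "F (Suc d, j, k) = 0" "F (i, Suc d, k) = 0" "F (i, j, Suc d) = 0"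
  using monomial_le by fastforce+

lemma DERIV_y: "((\<lambda>y. eval3 F (x, y, z)) has_field_derivative eval3 (dy3 F) (x, y, z)) (at y)"
proof -
  have "((\<lambda>y. \<Sum>i\<le>d. \<Sum>j\<le>d. (\<Sum>k\<le>d. F (i, j, k) * x ^ i * z ^ k) * y ^ j) has_field_derivative
     (\<Sum>i\<le>d. \<Sum>j\<le>d. of_nat (Suc j) * (\<Sum>k\<le>d. F (i, Suc j, k) * x ^ i * z ^ k) * y ^ j)) (at y)"
    by (intro DERIV_sum sum_power_has_field_derivative) (simp add: F_Suc_d)
  thus ?thesis unfolding eval_sum eval_dy by (simp add: sum_distrib_left sum_distrib_right mult_ac)
qed

lemma DERIV_z: "((\<lambda>z. eval3 F (x, y, z)) has_field_derivative eval3 (dz3 F) (x, y, z)) (at z)"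
proof -
  have "((\<lambda>z. \<Sum>i\<le>d. \<Sum>j\<le>d. \<Sum>k\<le>d. (F (i, j, k) * x ^ i * y ^ j) * z ^ k) has_field_derivative
     (\<Sum>i\<le>d. \<Sum>j\<le>d. \<Sum>k\<le>d. of_nat (Suc k) * (F (i, j, Suc k) * x ^ i * y ^ j) * z ^ k)) (at z)"
    by (intro DERIV_sum sum_power_has_field_derivative) (simp add: F_Suc_d)
  thus ?thesis unfolding eval_sum eval_dz by (simp add: mult_ac)
qed

lemma euler: "of_nat w1 * x * eval3 (dx3 F) (x, y, z) + of_nat w2 * y * eval3 (dy3 F) (x, y, z)
    + of_nat w3 * z * eval3 (dz3 F) (x, y, z) = of_nat d * eval3 F (x, y, z)"
proof -
  have X: "x * eval3 (dx3 F) (x, y, z) = (\<Sum>i\<le>d. \<Sum>j\<le>d. \<Sum>k\<le>d. of_nat i * F (i, j, k) * x ^ i * y ^ j * z ^ k)"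
    using sum_power_euler[of "\<lambda>i. \<Sum>j\<le>d. \<Sum>k\<le>d. F (i, j, k) * y ^ j * z ^ k" d x]
    unfolding eval_dx by (simp add: F_Suc_d sum_distrib_left sum_distrib_right mult_ac)
  have Y: "y * eval3 (dy3 F) (x, y, z) = (\<Sum>i\<le>d. \<Sum>j\<le>d. \<Sum>k\<le>d. of_nat j * F (i, j, k) * x ^ i * y ^ j * z ^ k)"
    unfolding eval_dy sum_distrib_left[of y "\<lambda>i. _ i"]
    by (rule sum.cong[OF refl])
       (use sum_power_euler[of "\<lambda>j. \<Sum>k\<le>d. F (i, j, k) * x ^ i * z ^ k" d y for i]
        in \<open>simp add: F_Suc_d sum_distrib_left sum_distrib_right mult_ac\<close>)
  have Z: "z * eval3 (dz3 F) (x, y, z) = (\<Sum>i\<le>d. \<Sum>j\<le>d. \<Sum>k\<le>d. of_nat k * F (i, j, k) * x ^ i * y ^ j * z ^ k)"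
  proof -
    have inner: "z * (\<Sum>k\<le>d. of_nat (Suc k) * F (i, j, Suc k) * x ^ i * y ^ j * z ^ k)
        = (\<Sum>k\<le>d. of_nat k * F (i, j, k) * x ^ i * y ^ j * z ^ k)" for i j
      using sum_power_euler[of "\<lambda>k. F (i, j, k) * x ^ i * y ^ j" d z] by (simp add: F_Suc_d mult_ac)
    have "z * eval3 (dz3 F) (x, y, z) = (\<Sum>i\<le>d. \<Sum>j\<le>d. z * (\<Sum>k\<le>d. of_nat (Suc k) * F (i, j, Suc k) * x ^ i * y ^ j * z ^ k))"
      unfolding eval_dz by (simp only: sum_distrib_left)
    thus ?thesis by (simp only: inner)
  qed
  have "of_nat w1 * (x * eval3 (dx3 F) (x, y, z)) + of_nat w2 * (y * eval3 (dy3 F) (x, y, z))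
    + of_nat w3 * (z * eval3 (dz3 F) (x, y, z)) = (\<Sum>i\<le>d. \<Sum>j\<le>d. \<Sum>k\<le>d.
        of_nat (w1 * i + w2 * j + w3 * k) * (F (i, j, k) * x ^ i * y ^ j * z ^ k))"
    unfolding X Y Z by (simp add: sum_distrib_left sum.distrib algebra_simps)
  also have "\<dots> = (\<Sum>i\<le>d. \<Sum>j\<le>d. \<Sum>k\<le>d. of_nat d * (F (i, j, k) * x ^ i * y ^ j * z ^ k))"
  proof (intro sum.cong refl)
    fix i j k show "of_nat (w1 * i + w2 * j + w3 * k) * (F (i, j, k) * x ^ i * y ^ j * z ^ k)
        = of_nat d * (F (i, j, k) * x ^ i * y ^ j * z ^ k)"
    proof (cases "F (i, j, k) = 0")
      case False
      show ?thesis by (simp only: monomial[OF False])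
    qed simp
  qed
  finally show ?thesis unfolding eval_sum by (simp add: sum_distrib_left mult_ac)
qed

lemma eval_act: "eval3 F (act t p) = t ^ d * eval3 F p"
proof -
  obtain x y z where p: "p = (x, y, z)" by (cases p)
  have T: "F (i, j, k) * (t ^ w1 * x) ^ i * (t ^ w2 * y) ^ j * (t ^ w3 * z) ^ k
      = t ^ d * (F (i, j, k) * x ^ i * y ^ j * z ^ k)" for i j k
    by (cases "F (i, j, k) = 0")
       (simp_all flip: monomial power_mult add: power_mult_distrib power_add mult_ac)
  show ?thesis unfolding p act_simp eval_sum by (simp only: sum_distrib_left T)
qed

text \<open>The powers of \<open>t\<close> stay on the left because an exponent such as
  \<open>d - w1\<close> could be truncated.\<close>

lemma eval_partial_act:
  "t ^ w1 * eval3 (dx3 F) (act t p) = t ^ d * eval3 (dx3 F) p"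
  "t ^ w2 * eval3 (dy3 F) (act t p) = t ^ d * eval3 (dy3 F) p"
  "t ^ w3 * eval3 (dz3 F) (act t p) = t ^ d * eval3 (dz3 F) p"
proof -
  obtain x y z where p: "p = (x, y, z)" by (cases p)
  have T1: "t ^ w1 * (of_nat (Suc i) * F (Suc i, j, k) * (t ^ w1 * x) ^ i * (t ^ w2 * y) ^ j * (t ^ w3 * z) ^ k)
      = t ^ d * (of_nat (Suc i) * F (Suc i, j, k) * x ^ i * y ^ j * z ^ k)" for i j k
    by (cases "F (Suc i, j, k) = 0")
       (simp_all flip: monomial power_mult add: power_mult_distrib power_add mult_ac)
  show "t ^ w1 * eval3 (dx3 F) (act t p) = t ^ d * eval3 (dx3 F) p"
    unfolding p act_simp eval_dx by (simp only: sum_distrib_left T1)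
  have T2: "t ^ w2 * (of_nat (Suc j) * F (i, Suc j, k) * (t ^ w1 * x) ^ i * (t ^ w2 * y) ^ j * (t ^ w3 * z) ^ k)
      = t ^ d * (of_nat (Suc j) * F (i, Suc j, k) * x ^ i * y ^ j * z ^ k)" for i j k
    by (cases "F (i, Suc j, k) = 0")
       (simp_all flip: monomial power_mult add: power_mult_distrib power_add mult_ac)
  show "t ^ w2 * eval3 (dy3 F) (act t p) = t ^ d * eval3 (dy3 F) p"
    unfolding p act_simp eval_dy by (simp only: sum_distrib_left T2)
  have T3: "t ^ w3 * (of_nat (Suc k) * F (i, j, Suc k) * (t ^ w1 * x) ^ i * (t ^ w2 * y) ^ j * (t ^ w3 * z) ^ k)
      = t ^ d * (of_nat (Suc k) * F (i, j, Suc k) * x ^ i * y ^ j * z ^ k)" for i j k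
    by (cases "F (i, j, Suc k) = 0")
       (simp_all flip: monomial power_mult add: power_mult_distrib power_add mult_ac)
  show "t ^ w3 * eval3 (dz3 F) (act t p) = t ^ d * eval3 (dz3 F) p"
    unfolding p act_simp eval_dz by (simp only: sum_distrib_left T3)
qed

lemma act_act: "act s (act t p) = act (s * t) p"
  by (simp add: act_def power_mult_distrib mult_ac)

lemma act_1 [simp]: "act 1 p = p"
  by (simp add: act_def)

lemma act_eq_0_iff: "t \<noteq> 0 \<Longrightarrow> act t p = 0 \<longleftrightarrow> p = 0"
  by (cases p) (auto simp: zero_prod_def)

lemma norm_act_le: "norm t \<le> 1 \<Longrightarrow> norm (act t p) \<le> norm t * norm p"
proof -
  assume t: "norm t \<le> 1"
  have c: "norm (t ^ w * x) \<le> norm t * norm x" if "w > 0" for w and x :: complex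
  proof -
    have "norm t ^ w \<le> norm t ^ 1" by (rule power_decreasing) (use that t in auto)
    thus ?thesis by (simp add: norm_mult norm_power mult_right_mono)
  qed
  obtain x y z where p: "p = (x, y, z)" by (cases p)
  show ?thesis unfolding p act_simp
    by (intro norm_Pair_le_mult c w1_pos w2_pos w3_pos) auto
qed

lemma zero_set_act: "p \<in> zero_set3 F \<Longrightarrow> act t p \<in> zero_set3 F"
  by (simp add: zero_set3_def eval_act)

lemma sing_act: "t \<noteq> 0 \<Longrightarrow> p \<in> sing3 F \<Longrightarrow> act t p \<in> sing3 F"
  using eval_partial_act[of t p] by (auto simp: sing3_def zero_set_act)

text \<open>The singular set is invariant under the action, and a small nonzero \<open>t\<close>
  moves any point into the given ball.\<close>

lemma isolated_imp_sing:
  assumes "r > 0" "sing3 F \<inter> ball 0 r = {0}" "p \<in> sing3 F"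
  shows "p = 0"
proof -
  define e where "e = min 1 (r / (norm p + 1))"
  have e: "0 < e" "e \<le> 1" "e * (norm p + 1) \<le> r"
    using assms(1) by (auto simp: e_def min_def field_simps add_pos_nonneg)
  define t where "t = complex_of_real (e / 2)"
  have t: "t \<noteq> 0" "norm t = e / 2" "norm t \<le> 1" using e by (auto simp: t_def norm_divide)
  have "norm (act t p) \<le> e / 2 * norm p" using norm_act_le[OF t(3)] t(2) by simp
  also have "\<dots> < r" using e assms(1)
    by (smt (verit) field_sum_of_halves mult_nonneg_nonneg norm_ge_zero distrib_left times_divide_eq_left)
  finally have "act t p \<in> ball 0 r" by simp
  moreover have "act t p \<in> sing3 F" using t assms(3) by (simp add: sing_act)
  ultimately have "act t p = 0" using assms(2) by blast
  thus ?thesis using t act_eq_0_iff by blast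
qed

lemma continuous_on_act [continuous_intros]:
  assumes "continuous_on S f" "continuous_on S g"
  shows "continuous_on S (\<lambda>x. act (f x) (g x))"
  unfolding act_def by (intro continuous_intros assms)

text \<open>Packaged in this form so that it can be transported along the exchange of x and y.
  \<open>W\<close> is a conical neighbourhood in the zero set of the orbit of \<open>p0\<close>, and
  \<open>Y\<close> bounds it. The last two clauses keep every other orbit in z = 0 out of
  both.\<close>

definition separable_at :: "complex \<times> complex \<times> complex \<Rightarrow> bool" where
  "separable_at p0 \<longleftrightarrow> (\<exists>W Y \<Omega>. Y \<subseteq> zero_set3 F \<and> 0 \<in> Y \<and> countably_rectifiable 3 Y \<and> upper_density 3 Y 0 = 0 \<and>
     open \<Omega> \<and> W = zero_set3 F \<inter> \<Omega> \<and> closed Y \<and> closed (W \<union> Y) \<and> p0 \<in> W \<and>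
     (\<forall>p t. t \<noteq> 0 \<longrightarrow> (act t p \<in> W \<longleftrightarrow> p \<in> W)) \<and> (\<forall>p t. t \<noteq> 0 \<longrightarrow> (act t p \<in> Y \<longleftrightarrow> p \<in> Y)) \<and>
     (\<forall>p\<in>W. snd (snd p) = 0 \<longrightarrow> (\<exists>t. t \<noteq> 0 \<and> p = act t p0)) \<and>
     (\<forall>p\<in>Y. snd (snd p) = 0 \<longrightarrow> p = 0))"

text \<open>\<open>V\<close> is arbitrary so that \<open>G\<close> can be placed inside or outside a
  given \<open>W\<close>. The bound \<open>t0\<close> keeps the cone over \<open>G\<close> in the
  unit ball, and connectedness of \<open>G\<close> puts that cone into one component.\<close>

definition thick_at :: "complex \<times> complex \<times> complex \<Rightarrow> bool" where
  "thick_at p0 \<longleftrightarrow> (\<forall>V t0. open V \<longrightarrow> p0 \<in> V \<longrightarrow> t0 > 0 \<longrightarrow>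
     (\<exists>G. G \<subseteq> zero_set3 F \<inter> V \<and> connected G \<and> p0 \<in> G \<and>
       lower_density 4 (\<Union>t\<in>{t. t \<noteq> 0 \<and> norm t \<le> t0}. act t ` G) 0 > 0))"

lemma orbit_connected: "connected ((\<lambda>t. act t p) ` (- {0}))"
  by (intro connected_continuous_image continuous_intros connected_punctured_universe)
     (simp add: Compl_eq_Diff_UNIV[symmetric])

end

section \<open>Connectedness of the punctured zero set\<close>

lemma residue_rational_sum:
  fixes P :: "complex poly" and c :: "'i \<Rightarrow> complex" and e :: "'i \<Rightarrow> nat"
  assumes "P \<noteq> 0" "finite I"
  shows "residue (\<lambda>w. (\<Sum>x\<in>I. c x * w ^ e x) / poly P w) s = (\<Sum>x\<in>I. c x * residue (\<lambda>w. w ^ e x / poly P w) s)"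
proof -
  define S where "S = insert s (- {z. poly P z = 0})"
  have Seq: "S = - ({z. poly P z = 0} - {s})" by (auto simp: S_def)
  have "finite ({z. poly P z = 0} - {s})" using poly_roots_finite[OF \<open>P \<noteq> 0\<close>] by simp
  hence "open (- ({z. poly P z = 0} - {s}))" by (intro open_Compl finite_imp_closed)
  hence S: "open S" "s \<in> S" unfolding Seq[symmetric] by (simp_all add: S_def)
  have hol: "(\<lambda>w. g w / poly P w) holomorphic_on S - {s}" if "g holomorphic_on UNIV" for g
    by (intro holomorphic_intros holomorphic_on_subset[OF that]) (auto simp: S_def)
  show ?thesis using \<open>finite I\<close>
  proof (induction I)
    case empty
    thus ?case by (simp add: residue_const)
  next
    case (insert x I)
    have "residue (\<lambda>w. (\<Sum>x\<in>insert x I. c x * w ^ e x) / poly P w) s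
        = residue (\<lambda>w. c x * (w ^ e x / poly P w) + (\<Sum>x\<in>I. c x * w ^ e x) / poly P w) s"
      using insert by (simp add: add_divide_distrib)
    also have "\<dots> = residue (\<lambda>w. c x * (w ^ e x / poly P w)) s + residue (\<lambda>w. (\<Sum>x\<in>I. c x * w ^ e x) / poly P w) s"
      by (intro residue_add[OF S] holomorphic_on_mult hol holomorphic_intros)
    also have "residue (\<lambda>w. c x * (w ^ e x / poly P w)) s = c x * residue (\<lambda>w. w ^ e x / poly P w) s"
      by (intro residue_lmul[OF S] hol holomorphic_intros)
    finally show ?case using insert by simp
  qed
qed

text \<open>Lagrange interpolation written with residues, so that multiple roots need no special treatment:
  for a root \<open>\<sigma>\<close>, the quotient \<open>(P(w) - P(\<sigma>)) / ((w - \<sigma>) P(w))\<close> is \<open>1 / (w - \<sigma>)\<close>.\<close>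

lemma residue_indicator:
  fixes P :: "complex poly"
  assumes P: "P \<noteq> 0" "degree P \<le> d" and \<sigma>: "poly P \<sigma> = 0" and Z: "finite Z"
  shows "(\<Sum>i\<le>d. coeff P i * (\<Sum>l<i. \<sigma> ^ (i - Suc l) * (\<Sum>s\<in>Z. residue (\<lambda>w. w ^ l / poly P w) s)))
       = (if \<sigma> \<in> Z then 1 else 0)"
proof -
  define I where "I = Sigma {..d} (\<lambda>i. {..<i})"
  have fin: "finite I" by (simp add: I_def)
  define W where "W l = (\<Sum>s\<in>Z. residue (\<lambda>w. w ^ l / poly P w) s)" for l
  define \<kappa> where "\<kappa> x = coeff P (fst x) * \<sigma> ^ (fst x - Suc (snd x))" for x
  define g where "g w = (\<Sum>x\<in>I. \<kappa> x * w ^ snd x)" for w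
  have "(\<Sum>i\<le>d. coeff P i * (\<Sum>l<i. \<sigma> ^ (i - Suc l) * W l))
      = (\<Sum>x\<in>I. \<kappa> x * W (snd x))"
    unfolding I_def \<kappa>_def by (simp add: sum_distrib_left mult_ac sum.Sigma split_beta)
  also have "\<dots> = (\<Sum>s\<in>Z. \<Sum>x\<in>I. \<kappa> x * residue (\<lambda>w. w ^ snd x / poly P w) s)"
    unfolding W_def sum_distrib_left by (rule sum.swap)
  also have "\<dots> = (\<Sum>s\<in>Z. residue (\<lambda>w. g w / poly P w) s)"
    unfolding g_def by (intro sum.cong refl residue_rational_sum[OF P(1) fin, symmetric])
  also have "\<dots> = (\<Sum>s\<in>Z. if s = \<sigma> then 1 else 0)"
  proof (rule sum.cong[OF refl])
    fix s
    have num: "(w - \<sigma>) * g w = poly P w" for w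
    proof -
      have "g w
          = (\<Sum>i\<le>d. coeff P i * (\<Sum>l<i. \<sigma> ^ (i - Suc l) * w ^ l))"
        unfolding I_def \<kappa>_def g_def by (simp add: sum_distrib_left mult_ac sum.Sigma split_beta)
      hence "(w - \<sigma>) * g w
          = (\<Sum>i\<le>d. coeff P i * ((w - \<sigma>) * (\<Sum>l<i. \<sigma> ^ (i - Suc l) * w ^ l)))"
        by (simp add: sum_distrib_left mult_ac)
      also have "\<dots> = (\<Sum>i\<le>d. coeff P i * w ^ i) - (\<Sum>i\<le>d. coeff P i * \<sigma> ^ i)"
        by (simp only: power_diff_sumr2[symmetric] right_diff_distrib sum_subtractf)
      also have "\<dots> = poly P w" using \<sigma> by (simp flip: poly_eq_sum_atMost[OF P(2)])
      finally show ?thesis .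
    qed
    have "residue (\<lambda>w. g w / poly P w) s
        = residue (\<lambda>w. 1 / (w - \<sigma>)) s"
    proof (rule residue_cong[OF _ refl])
      have "finite ({z. poly P z = 0} - {s})" using poly_roots_finite[OF P(1)] by simp
      hence "open (- ({z. poly P z = 0} - {s}))" by (intro open_Compl finite_imp_closed)
      hence "\<forall>\<^sub>F w in nhds s. w \<in> - ({z. poly P z = 0} - {s})" by (rule eventually_nhds_in_open) auto
      hence "\<forall>\<^sub>F w in at s. poly P w \<noteq> 0"
        unfolding eventually_at_filter by eventually_elim auto
      thus "\<forall>\<^sub>F w in at s. g w / poly P w = 1 / (w - \<sigma>)"
      proof eventually_elim
        case (elim w)
        hence "w \<noteq> \<sigma>" using \<sigma> by auto
        thus ?case using elim num[of w] by (simp add: field_simps)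
      qed
    qed
    also have "\<dots> = (if s = \<sigma> then 1 else 0)"
    proof (cases "s = \<sigma>")
      case True
      thus ?thesis using residue_simple[of UNIV s "\<lambda>_. 1"] by simp
    next
      case False
      thus ?thesis by (auto intro!: residue_holo[of "- {\<sigma>}"] holomorphic_intros)
    qed
    finally show "residue (\<lambda>w. g w / poly P w) s
       = (if s = \<sigma> then 1 else 0)" .
  qed
  also have "\<dots> = (if \<sigma> \<in> Z then 1 else 0)" using Z by simp
  finally show ?thesis unfolding W_def .
qed

text \<open>Only upper bounds for the degrees are used, so the top coefficient can be tracked even
  when it vanishes, as for \<open>\<nu> = 0\<close> or \<open>\<mu> = 0\<close> later.\<close>

lemma coeff_mult_top:
  fixes p q :: "'a::comm_semiring_1 poly"
  assumes "degree p \<le> m" "degree q \<le> n"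
  shows "degree (p * q) \<le> m + n" "coeff (p * q) (m + n) = coeff p m * coeff q n"
proof -
  show "degree (p * q) \<le> m + n" using degree_mult_le[of p q] assms by linarith
  have "coeff (p * q) (m + n) = (\<Sum>i\<le>m + n. coeff p i * coeff q (m + n - i))" by (rule coeff_mult)
  also have "\<dots> = (\<Sum>i\<in>{m}. coeff p i * coeff q (m + n - i))"
  proof (rule sum.mono_neutral_right)
    show "\<forall>i\<in>{..m + n} - {m}. coeff p i * coeff q (m + n - i) = 0"
    proof
      fix i assume "i \<in> {..m + n} - {m}"
      hence "i > m \<or> m + n - i > n" by auto
      thus "coeff p i * coeff q (m + n - i) = 0" using assms by (auto simp: coeff_eq_0)
    qed
  qed auto
  finally show "coeff (p * q) (m + n) = coeff p m * coeff q n" by simp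
qed

lemma coeff_power_top:
  fixes p :: "'a::comm_semiring_1 poly"
  assumes "degree p \<le> m"
  shows "degree (p ^ i) \<le> m * i \<and> coeff (p ^ i) (m * i) = coeff p m ^ i"
proof (induction i)
  case (Suc i)
  thus ?case using coeff_mult_top[OF assms, of "p ^ i" "m * i"] by simp
qed auto

section \<open>Polynomial families with entire coefficients\<close>

definition holo_coeffs :: "(complex \<Rightarrow> complex poly) \<Rightarrow> bool" where
  "holo_coeffs P \<longleftrightarrow> (\<forall>i. (\<lambda>t. coeff (P t) i) holomorphic_on UNIV)"

lemma holo_coeffs_const: "holo_coeffs (\<lambda>_. p)"
  by (simp add: holo_coeffs_def)

lemma holo_coeffs_add: "holo_coeffs P \<Longrightarrow> holo_coeffs Q \<Longrightarrow> holo_coeffs (\<lambda>t. P t + Q t)"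
  by (auto simp: holo_coeffs_def intro!: holomorphic_intros)

lemma holo_coeffs_mult: "holo_coeffs P \<Longrightarrow> holo_coeffs Q \<Longrightarrow> holo_coeffs (\<lambda>t. P t * Q t)"
  unfolding holo_coeffs_def coeff_mult by (auto intro!: holomorphic_intros)

lemma holo_coeffs_power: "holo_coeffs P \<Longrightarrow> holo_coeffs (\<lambda>t. P t ^ n)"
  by (induction n) (auto intro: holo_coeffs_mult holo_coeffs_const)

lemma holo_coeffs_smult: "holo_coeffs P \<Longrightarrow> holo_coeffs (\<lambda>t. smult c (P t))"
  by (auto simp: holo_coeffs_def intro!: holomorphic_intros)

lemma holo_coeffs_pCons0: "holo_coeffs (\<lambda>t. [:t:])"
  unfolding holo_coeffs_def
proof
  fix i show "(\<lambda>t. coeff [:t:] i) holomorphic_on UNIV" by (cases i) (auto intro!: holomorphic_intros)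
qed

lemma holo_coeffs_sum: "finite I \<Longrightarrow> (\<And>i. i \<in> I \<Longrightarrow> holo_coeffs (P i)) \<Longrightarrow> holo_coeffs (\<lambda>t. \<Sum>i\<in>I. P i t)"
  by (induction I rule: finite_induct) (auto intro: holo_coeffs_add holo_coeffs_const)

lemma complex_nth_root_exists:
  fixes a :: complex
  assumes "n > 0"
  shows "\<exists>t. t ^ n = a \<and> norm t ^ n = norm a"
proof -
  obtain t where "t ^ n = a"
  proof (cases "a = 0")
    case True
    thus ?thesis using that[of 0] assms by (auto simp: zero_power)
  next
    case False
    have "exp (Ln a / of_nat n) ^ n = a" using False assms by (simp flip: exp_of_nat_mult)
    thus ?thesis using that by blast
  qed
  thus ?thesis by (metis norm_power)
qed

context whpoly begin

text \<open>For a splitting by \<open>U\<close> and \<open>V\<close>, the indicator of lying outside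
  \<open>V\<close> turns out to be the single number \<open>c * \<kappa>\<close> at all points of
  \<open>X\<close>, although points of both kinds exist.\<close>

lemma connected_zero_set_minus_0:
  assumes "F \<noteq> (\<lambda>_. 0)" and F0: "eval3 F 0 = 0"
  shows "connected (zero_set3 F - {0})"
proof (rule ccontr)
  define X where "X = zero_set3 F - {0}"
  assume "\<not> connected (zero_set3 F - {0})"
  then obtain U V where UV: "open U" "open V" "X \<subseteq> U \<union> V" "U \<inter> V \<inter> X = {}" "U \<inter> X \<noteq> {}" "V \<inter> X \<noteq> {}"
    unfolding connected_def X_def by (auto simp: Int_commute)
  have Xact: "act t p \<in> X" if "p \<in> X" "t \<noteq> 0" for t p
    using that by (auto simp: X_def zero_set_act act_eq_0_iff)
  have Xact': "p \<in> X" if "act t p \<in> X" "t \<noteq> 0" for t p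
    using Xact[OF that(1), of "inverse t"] that(2) by (simp add: act_act)
  \<comment> \<open>An orbit is connected, hence lies on one side of the splitting.\<close>
  have orbit: "act t p \<in> V" if "p \<in> X" "t \<noteq> 0" "p \<in> V" for t p
  proof (rule ccontr)
    assume "act t p \<notin> V"
    let ?O = "(\<lambda>t. act t p) ` (- {0})"
    have "act t p \<in> ?O" "p \<in> ?O" using that(2) by (auto intro: rev_image_eqI[of 1])
    moreover have "?O \<subseteq> X" using that(1) Xact by blast
    ultimately show False
      using connectedD[OF orbit_connected[of p] UV(1,2)] UV(3,4) \<open>act t p \<notin> V\<close> that Xact by blast
  qed
  have orbit_iff: "act t p \<in> V \<longleftrightarrow> p \<in> V" if "p \<in> X" "t \<noteq> 0" for t p
    using orbit[OF that] orbit[OF Xact[OF that], of "inverse t"] that by (auto simp: act_act)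
  \<comment> \<open>Otherwise the action makes \<open>F\<close> vanish wherever z is nonzero, and by
    density everywhere.\<close>
  have "\<exists>\<nu> \<mu>. eval3 F (\<nu>, \<mu>, 1) \<noteq> 0"
  proof (rule ccontr)
    assume a: "\<not> (\<exists>\<nu> \<mu>. eval3 F (\<nu>, \<mu>, 1) \<noteq> 0)"
    have z: "eval3 F (x, y, z) = 0" if "z \<noteq> 0" for x y z
    proof -
      obtain t where t: "t ^ w3 = z" using complex_nth_root_exists[OF w3_pos] by blast
      hence "t \<noteq> 0" using that w3_pos by (auto simp: zero_power)
      hence "(x, y, z) = act t (x / t ^ w1, y / t ^ w2, 1)" using t by simp
      moreover have "eval3 F (x / t ^ w1, y / t ^ w2, 1) = 0" using a by blast
      ultimately show ?thesis by (simp add: eval_act del: act_simp)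
    qed
    have "eval3 F (x, y, z) = 0" for x y z
    proof (cases "z = 0")
      case True
      have "closed {z. eval3 F (x, y, z) = 0}"
        by (intro closed_Collect_eq continuous_intros)
      moreover have "- {0} \<subseteq> {z. eval3 F (x, y, z) = 0}" using z by auto
      ultimately have "closure (- {0}) \<subseteq> {z. eval3 F (x, y, z) = 0}" by (rule closure_minimal[rotated])
      thus ?thesis by (auto simp: closure_complement)
    qed (rule z)
    hence "F e = 0" for e using eval3_eq_0_imp[OF is_poly] by (cases e) auto
    thus False using assms(1) by auto
  qed
  then obtain \<nu> \<mu> where lm: "eval3 F (\<nu>, \<mu>, 1) \<noteq> 0" by blast
  define c where "c = eval3 F (\<nu>, \<mu>, 1)"
  have c: "c \<noteq> 0" using lm by (simp add: c_def)
  \<comment> \<open>\<open>m a b\<close> runs through the fibre over \<open>(a, b)\<close>. The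
    exponents of \<open>s\<close> are the weights of the coordinates, so each monomial of weight
    \<open>d\<close> contributes its value at \<open>(\<nu>, \<mu>, 1)\<close> to the coefficient of
    \<open>s ^ d\<close>.\<close>
  define m where "m a b s = (a + \<nu> * s ^ w1, b + \<mu> * s ^ w2, s ^ w3)" for a b s :: complex
  define Q where "Q a b = (\<Sum>(i, j, k)\<in>poly3_support F.
      smult (F (i, j, k)) (([:a:] + monom \<nu> w1) ^ i * ([:b:] + monom \<mu> w2) ^ j * monom 1 (w3 * k)))" for a b
  have fin: "finite (poly3_support F)" using is_poly by (simp add: is_poly3_def)
  have Qm: "poly (Q a b) s = eval3 F (m a b s)" for a b s
    unfolding Q_def eval3_def poly_sum
    by (rule sum.cong[OF refl])
       (auto simp: m_def poly_monom poly_power power_mult split: prod.splits)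
  have degQ: "degree (Q a b) \<le> d \<and> coeff (Q a b) d = c" for a b
  proof -
    have trm: "degree (([:a:] + monom \<nu> w1) ^ i * ([:b:] + monom \<mu> w2) ^ j * monom 1 (w3 * k)) \<le> d \<and>
        coeff (([:a:] + monom \<nu> w1) ^ i * ([:b:] + monom \<mu> w2) ^ j * monom 1 (w3 * k)) d = \<nu> ^ i * \<mu> ^ j"
      if "F (i, j, k) \<noteq> 0" for i j k
    proof -
      have 1: "degree ([:a:] + monom \<nu> w1) \<le> w1" for a \<nu>
        by (intro degree_add_le) (auto simp: degree_monom_le)
      have 2: "degree ([:b:] + monom \<mu> w2) \<le> w2" for b \<mu>
        by (intro degree_add_le) (auto simp: degree_monom_le)
      have c1: "coeff [:a:] w1 = 0" using w1_pos by (cases w1) auto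
      have c2: "coeff [:b:] w2 = 0" using w2_pos by (cases w2) auto
      note A = coeff_power_top[OF 1, of a \<nu> i] and B = coeff_power_top[OF 2, of b \<mu> j]
      note AB = coeff_mult_top[OF A[THEN conjunct1] B[THEN conjunct1]]
      have 3: "degree (monom (1::complex) (w3 * k)) \<le> w3 * k" by (rule degree_monom_le)
      note ABC = coeff_mult_top[OF AB(1) 3]
      show ?thesis using ABC AB A B monomial[OF that] by (simp add: c1 c2)
    qed
    have "degree (Q a b) \<le> d" unfolding Q_def
      by (rule degree_sum_le[OF fin])
         (use trm in \<open>auto simp: poly3_support_def intro: order_trans[OF degree_smult_le]\<close>)
    moreover have "coeff (Q a b) d = c"
      unfolding Q_def coeff_sum c_def eval3_def
      by (rule sum.cong[OF refl]) (use trm in \<open>auto simp: poly3_support_def\<close>)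
    ultimately show ?thesis by blast
  qed
  have Q0: "Q a b \<noteq> 0" for a b using degQ[of a b] c by auto
  have d: "d > 0"
  proof (rule ccontr)
    assume "\<not> d > 0"
    hence "eval3 F (m 0 0 0) = c"
      using degQ[of 0 0] poly_eq_sum_atMost[of "Q 0 0" 0 0] by (simp flip: Qm)
    thus False using c F0 w1_pos w2_pos w3_pos by (simp add: m_def zero_prod_def zero_power)
  qed
  have holQ: "holo_coeffs (\<lambda>a. Q a 1)" "holo_coeffs (\<lambda>b. Q 1 b)"
    unfolding Q_def split_beta
    by (intro holo_coeffs_sum fin holo_coeffs_smult holo_coeffs_mult holo_coeffs_power
        holo_coeffs_add holo_coeffs_pCons0 holo_coeffs_const)+
  have mact: "m (t ^ w1 * a) (t ^ w2 * b) (t * s) = act t (m a b s)" for t a b s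
    by (simp add: m_def algebra_simps power_mult_distrib)
  have Qact: "poly (Q (t ^ w1 * a) (t ^ w2 * b)) (t * s) = t ^ d * poly (Q a b) s" for t a b s
    unfolding Qm mact by (rule eval_act)
  have m0: "m a b s \<noteq> 0" if "a \<noteq> 0 \<or> b \<noteq> 0" for a b s
    using that w1_pos w2_pos w3_pos by (auto simp: m_def zero_prod_def zero_power)
  have mX: "m a b s \<in> X \<longleftrightarrow> poly (Q a b) s = 0" if "a \<noteq> 0 \<or> b \<noteq> 0" for a b s
    using m0[OF that] by (simp add: X_def zero_set3_def Qm)
  \<comment> \<open>For \<open>(a, b)\<close> not the origin these are the roots whose points lie in
    \<open>U\<close>.\<close>
  define Z where "Z a b = {s. poly (Q a b) s = 0 \<and> m a b s \<notin> V}" for a b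
  have finZ: "finite (Z a b)" for a b
    by (rule finite_subset[OF _ poly_roots_finite[OF Q0[of a b]]]) (auto simp: Z_def)
  define \<theta> where "\<theta> l a b = (\<Sum>s\<in>Z a b. residue (\<lambda>w. w ^ l / poly (Q a b) w) s)" for l a b
  have Zact: "Z (t ^ w1 * a) (t ^ w2 * b) = (\<lambda>s. t * s) ` Z a b" if t: "t \<noteq> 0" and ab: "a \<noteq> 0 \<or> b \<noteq> 0" for t a b
  proof -
    have *: "t * s \<in> Z (t ^ w1 * a) (t ^ w2 * b) \<longleftrightarrow> s \<in> Z a b" for s
      unfolding Z_def using t orbit_iff[of "m a b s" t] mX[OF ab, of s] by (auto simp: Qact mact)
    show ?thesis
    proof (intro set_eqI iffI)
      fix x assume "x \<in> Z (t ^ w1 * a) (t ^ w2 * b)"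
      hence "x / t \<in> Z a b" using *[of "x / t"] t by simp
      thus "x \<in> (\<lambda>s. t * s) ` Z a b" using t by (intro image_eqI[of _ _ "x / t"]) auto
    qed (use * in auto)
  qed
  \<comment> \<open>Scaling the variable by \<open>t\<close> multiplies the integrand by
    \<open>t ^ l / t ^ d\<close>, and the residue gains one more factor \<open>t\<close>.\<close>
  have \<theta>act: "t ^ d * \<theta> l (t ^ w1 * a) (t ^ w2 * b) = t ^ Suc l * \<theta> l a b" if t: "t \<noteq> 0" and ab: "a \<noteq> 0 \<or> b \<noteq> 0" for l t a b
  proof -
    let ?Q = "Q (t ^ w1 * a) (t ^ w2 * b)"
    have "\<theta> l (t ^ w1 * a) (t ^ w2 * b) = (\<Sum>s\<in>Z a b. residue (\<lambda>w. w ^ l / poly ?Q w) (t * s))"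
      unfolding \<theta>_def Zact[OF that] by (subst sum.reindex) (use t in \<open>auto simp: inj_on_def\<close>)
    also have "\<dots> = (\<Sum>s\<in>Z a b. t * (t ^ l / t ^ d * residue (\<lambda>w. w ^ l / poly (Q a b) w) s))"
    proof (rule sum.cong[OF refl])
      fix s
      have "residue (\<lambda>v. poly (monom 1 l) (t * v) / poly ?Q (t * v)) s
          = residue (\<lambda>w. poly (monom 1 l) w / poly ?Q w) (t * s) / t"
        by (rule residue_rational_scale[OF Q0 t])
      moreover have "(\<lambda>v. poly (monom 1 l) (t * v) / poly ?Q (t * v))
          = (\<lambda>v. (\<Sum>x\<in>{()}. t ^ l / t ^ d * v ^ l) / poly (Q a b) v)"
        by (auto simp: Qact poly_monom power_mult_distrib)
      ultimately have "residue (\<lambda>w. poly (monom 1 l) w / poly ?Q w) (t * s)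
          = t * residue (\<lambda>v. (\<Sum>x\<in>{()}. t ^ l / t ^ d * v ^ l) / poly (Q a b) v) s"
        using t by (simp add: field_simps)
      also have "residue (\<lambda>v. (\<Sum>x\<in>{()}. t ^ l / t ^ d * v ^ l) / poly (Q a b) v) s
          = (\<Sum>x\<in>{()}. t ^ l / t ^ d * residue (\<lambda>w. w ^ l / poly (Q a b) w) s)"
        by (rule residue_rational_sum[OF Q0]) simp
      finally show "residue (\<lambda>w. w ^ l / poly ?Q w) (t * s)
          = t * (t ^ l / t ^ d * residue (\<lambda>w. w ^ l / poly (Q a b) w) s)"
        by (simp add: poly_monom)
    qed
    also have "\<dots> = t * (t ^ l / t ^ d) * \<theta> l a b"
      unfolding \<theta>_def by (simp add: sum_distrib_left mult_ac)
    finally show ?thesis using t by simp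
  qed
  have hol: "(\<lambda>t. \<theta> l (g t) (h t)) holomorphic_on UNIV"
    if hc: "holo_coeffs (\<lambda>t. Q (g t) (h t))" and cont: "continuous_on UNIV g" "continuous_on UNIV h"
      and nz: "\<And>t. g t \<noteq> 0 \<or> h t \<noteq> 0" for g h l
  proof -
    \<comment> \<open>Using the complements of \<open>V\<close> and \<open>U\<close>, instead of
      \<open>U\<close> and \<open>V\<close> themselves, presents the two families of roots as closed
      sets.\<close>
    let ?A = "{x. poly (Q (g (fst x)) (h (fst x))) (snd x) = 0 \<and> m (g (fst x)) (h (fst x)) (snd x) \<in> - V}"
    let ?B = "{x. poly (Q (g (fst x)) (h (fst x))) (snd x) = 0 \<and> m (g (fst x)) (h (fst x)) (snd x) \<in> - U}"
    have mc: "continuous_on UNIV (\<lambda>x. m (g (fst x)) (h (fst x)) (snd x))"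
      unfolding m_def
      by (intro continuous_intros continuous_on_compose2[OF cont(1)] continuous_on_compose2[OF cont(2)]) auto
    have c0: "closed {x. poly (Q (g (fst x)) (h (fst x))) (snd x) = 0}"
      unfolding Qm by (intro closed_Collect_eq continuous_intros mc)
    have cv: "closed {x. m (g (fst x)) (h (fst x)) (snd x) \<in> - W}" if "open W" for W
      using closed_vimage[OF _ mc, of "- W"] that by (auto simp: vimage_def)
    have "(\<lambda>t. \<Sum>s | (t, s) \<in> ?A. residue (\<lambda>w. w ^ l / poly (Q (g t) (h t)) w) s) holomorphic_on UNIV"
    proof (rule residue_sum_holomorphic[where d=d and c=c and B="?B"])
      show "closed ?A" "closed ?B" unfolding Collect_conj_eq by (intro closed_Int c0 cv UV)+
      show "?A \<inter> ?B = {}" using UV(3) mX nz by fastforce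
      show "{(t, s). poly (Q (g t) (h t)) s = 0} = ?A \<union> ?B" using UV(4) mX nz by fastforce
    qed (use degQ c hc in \<open>auto simp: holo_coeffs_def\<close>)
    thus ?thesis unfolding \<theta>_def Z_def by simp
  qed
  have hol1: "(\<lambda>a. \<theta> l a 1) holomorphic_on UNIV" for l
    by (rule hol[OF holQ(1)]) auto
  have hol2: "(\<lambda>b. \<theta> l 1 b) holomorphic_on UNIV" for l
    by (rule hol[OF holQ(2)]) auto
  have cont2: "((\<lambda>b. \<theta> l 1 b) \<longlongrightarrow> \<theta> l 1 0) (at 0)" for l
    using holomorphic_on_imp_continuous_on[OF hol2[of l]] by (simp add: continuous_on_def)
  \<comment> \<open>Scaling carries \<open>(a, 1)\<close> to \<open>(1, b)\<close> with
    \<open>b\<close> tending to 0 as \<open>a\<close> grows. The power of 0 covers both cases: it is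
    0 for \<open>Suc l < d\<close>, and \<open>0 ^ 0 = 1\<close> for
    \<open>Suc l = d\<close>.\<close>
  have const: "\<theta> l a 1 = 0 ^ (d - Suc l) * \<theta> l 1 0" if l: "l < d" for l a
  proof (rule Liouville_weak[OF hol1])
    \<comment> \<open>Only \<open>T a ^ w1 = a\<close> and the growth of \<open>T\<close> are used,
      so the jump of \<open>Ln\<close> does no harm.\<close>
    define T where "T a = exp (Ln a / of_nat w1)" for a
    have T: "T a ^ w1 = a" "T a \<noteq> 0" if "a \<noteq> 0" for a
      using that w1_pos by (auto simp: T_def simp flip: exp_of_nat_mult)
    have Tinf: "filterlim T at_infinity at_infinity"
      unfolding filterlim_at_infinity_conv_norm_at_top filterlim_at_top
    proof
      fix Z :: real
      show "\<forall>\<^sub>F a in at_infinity. Z \<le> norm (T a)"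
        unfolding eventually_at_infinity
      proof (intro exI[of _ "max Z 1 ^ w1"] allI impI)
        fix a :: complex assume a: "max Z 1 ^ w1 \<le> norm a"
        have "1 \<le> max Z 1 ^ w1" by (intro one_le_power) auto
        hence "1 \<le> norm a" using a by (rule order_trans)
        hence "a \<noteq> 0" by auto
        hence "norm (T a) ^ w1 = norm a" using T(1) by (metis norm_power)
        hence "max Z 1 ^ w1 \<le> norm (T a) ^ w1" using a by simp
        hence "max Z 1 \<le> norm (T a)" using w1_pos by (simp add: power_mono_iff)
        thus "Z \<le> norm (T a)" by simp
      qed
    qed
    have inv: "((\<lambda>a. inverse (T a)) \<longlongrightarrow> 0) at_infinity"
      by (rule filterlim_compose[OF tendsto_inverse_0 Tinf])
    have "((\<lambda>a. inverse (T a) ^ (d - Suc l) * \<theta> l 1 (inverse (T a) ^ w2)) \<longlongrightarrow> 0 ^ (d - Suc l) * \<theta> l 1 0) at_infinity"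
    proof (intro tendsto_mult tendsto_power inv)
      have "isCont (\<lambda>b. \<theta> l 1 b) 0"
        using holomorphic_on_imp_continuous_on[OF hol2[of l]] by (simp add: continuous_on_eq_continuous_at)
      moreover have "((\<lambda>a. inverse (T a) ^ w2) \<longlongrightarrow> 0) at_infinity"
        using tendsto_power[OF inv, of w2] w2_pos by (simp add: zero_power)
      ultimately show "((\<lambda>a. \<theta> l 1 (inverse (T a) ^ w2)) \<longlongrightarrow> \<theta> l 1 0) at_infinity"
        by (rule isCont_tendsto_compose)
    qed
    moreover have "\<forall>\<^sub>F a in at_infinity. inverse (T a) ^ (d - Suc l) * \<theta> l 1 (inverse (T a) ^ w2) = \<theta> l a 1"
      unfolding eventually_at_infinity
    proof (intro exI[of _ 1] allI impI)
      fix a :: complex assume "1 \<le> norm a"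
      hence "a \<noteq> 0" by auto
      note t = T[OF this]
      have "T a ^ d * \<theta> l (T a ^ w1 * 1) (T a ^ w2 * inverse (T a) ^ w2) = T a ^ Suc l * \<theta> l 1 (inverse (T a) ^ w2)"
        by (rule \<theta>act) (use t in auto)
      hence e: "T a ^ d * \<theta> l a 1 = T a ^ Suc l * \<theta> l 1 (inverse (T a) ^ w2)"
        using t by (simp flip: power_mult_distrib)
      have "T a ^ d = T a ^ Suc l * T a ^ (d - Suc l)" using l by (subst power_add[symmetric]) simp
      hence "T a ^ (d - Suc l) * \<theta> l a 1 = \<theta> l 1 (inverse (T a) ^ w2)" using e t by simp
      thus "inverse (T a) ^ (d - Suc l) * \<theta> l 1 (inverse (T a) ^ w2) = \<theta> l a 1"
        using t by (simp add: field_simps)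
    qed
    ultimately show "((\<lambda>a. \<theta> l a 1) \<longlongrightarrow> 0 ^ (d - Suc l) * \<theta> l 1 0) at_infinity"
      by (rule Lim_transform_eventually)
  qed
  have zero1: "\<theta> l a 1 = 0" if "Suc l < d" for l a
    using const[of l a] that by simp
  \<comment> \<open>No scaling carries \<open>(1, 0)\<close> to some \<open>(a, 1)\<close>; it is
    reached as the limit of \<open>(1, b)\<close>.\<close>
  have zero2: "\<theta> l 1 0 = 0" if "Suc l < d" for l
  proof -
    have "\<theta> l 1 b = 0" if "b \<noteq> 0" for b
    proof -
      obtain t where t: "t ^ w2 = b" using complex_nth_root_exists[OF w2_pos] by blast
      hence "t \<noteq> 0" using that w2_pos by (auto simp: zero_power)
      hence "t ^ d * \<theta> l (t ^ w1 * inverse (t ^ w1)) (t ^ w2 * 1) = t ^ Suc l * \<theta> l (inverse (t ^ w1)) 1"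
        by (intro \<theta>act) auto
      thus ?thesis using t \<open>t \<noteq> 0\<close> zero1[OF \<open>Suc l < d\<close>] by simp
    qed
    hence "\<forall>\<^sub>F b in at 0. \<theta> l 1 b = 0" by (auto simp: eventually_at_filter)
    hence "((\<lambda>b. \<theta> l 1 b) \<longlongrightarrow> 0) (at 0)" by (rule tendsto_eventually)
    thus ?thesis using cont2[of l] tendsto_unique[OF at_neq_bot] by blast
  qed
  define \<kappa> where "\<kappa> = \<theta> (d - 1) 1 0"
  \<comment> \<open>In the interpolation formula \<open>l = d - 1\<close> forces
    \<open>i = d\<close>, with exponent 0 on \<open>s\<close>; what survives is the leading
    coefficient times \<open>\<kappa>\<close>.\<close>
  have ind: "(if s \<in> Z a b then 1 else 0) = c * \<kappa>"
    if s: "poly (Q a b) s = 0" and z: "\<And>l. Suc l < d \<Longrightarrow> \<theta> l a b = 0" and k: "\<theta> (d - 1) a b = \<kappa>" for a b s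
  proof -
    have "(if s \<in> Z a b then 1 else 0) = (\<Sum>i\<le>d. coeff (Q a b) i * (\<Sum>l<i. s ^ (i - Suc l) * \<theta> l a b))"
      unfolding \<theta>_def using residue_indicator[OF Q0 _ s finZ] degQ by simp
    also have "\<dots> = (\<Sum>i\<in>{d}. coeff (Q a b) i * (\<Sum>l<i. s ^ (i - Suc l) * \<theta> l a b))"
      by (rule sum.mono_neutral_right) (auto intro!: sum.neutral z)
    also have "\<dots> = c * (\<Sum>l<d. s ^ (d - Suc l) * \<theta> l a b)" using degQ by simp
    also have "(\<Sum>l<d. s ^ (d - Suc l) * \<theta> l a b) = (\<Sum>l\<in>{d - 1}. s ^ (d - Suc l) * \<theta> l a b)"
    proof (rule sum.mono_neutral_right)
      show "\<forall>l\<in>{..<d} - {d - 1}. s ^ (d - Suc l) * \<theta> l a b = 0"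
      proof
        fix l assume "l \<in> {..<d} - {d - 1}"
        hence "Suc l < d" by auto
        thus "s ^ (d - Suc l) * \<theta> l a b = 0" using z by simp
      qed
    qed (use d in auto)
    also have "\<dots> = \<kappa>" using d k by simp
    finally show ?thesis .
  qed
  have ind1: "(if s \<in> Z a 1 then 1 else 0) = c * \<kappa>" if "poly (Q a 1) s = 0" for a s
    by (rule ind[OF that zero1]) (use const[of "d - 1" a] d in \<open>auto simp: \<kappa>_def\<close>)
  have ind2: "(if s \<in> Z 1 0 then 1 else 0) = c * \<kappa>" if "poly (Q 1 0) s = 0" for s
    by (rule ind[OF that zero2]) (auto simp: \<kappa>_def)
  have key: "(if p \<in> V then 0 else 1) = c * \<kappa>" if p: "p \<in> X" for p
  proof -
    obtain x y z where xyz: "p = (x, y, z)" by (cases p)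
    obtain s where s: "s ^ w3 = z" using complex_nth_root_exists[OF w3_pos] by blast
    define a b where "a = x - \<nu> * s ^ w1" and "b = y - \<mu> * s ^ w2"
    have pm: "p = m a b s" using s by (simp add: xyz m_def a_def b_def)
    have Q: "poly (Q a b) s = 0" using p unfolding Qm pm[symmetric] by (simp add: X_def zero_set3_def)
    \<comment> \<open>Over \<open>(0, 0)\<close> the polynomial is \<open>c * s ^ d\<close>, whose
      only root belongs to the origin.\<close>
    have ab: "a \<noteq> 0 \<or> b \<noteq> 0"
    proof (rule ccontr)
      assume "\<not> (a \<noteq> 0 \<or> b \<noteq> 0)"
      hence ab0: "a = 0" "b = 0" by auto
      have e: "p = act s (\<nu>, \<mu>, 1)" unfolding pm by (simp add: m_def ab0 mult_ac)
      hence "s ^ d * c = 0" using p unfolding c_def eval_act[symmetric] by (simp add: X_def zero_set3_def)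
      hence "s = 0" using c by simp
      hence "p = 0" using e w1_pos w2_pos w3_pos by (simp add: zero_prod_def zero_power)
      thus False using p by (simp add: X_def)
    qed
    \<comment> \<open>Membership in \<open>V\<close> may be tested at a rescaled point; the targets
      are \<open>(a / t ^ w1, 1)\<close> and \<open>(1, 0)\<close>.\<close>
    have red: "(if p \<in> V then 0 else 1) = (if s' \<in> Z a' b' then 1 else (0::complex))"
      if "t \<noteq> 0" "a = t ^ w1 * a'" "b = t ^ w2 * b'" "s = t * s'" for t a' b' s'
    proof -
      have pa: "p = act t (m a' b' s')" unfolding pm that by (rule mact)
      have "m a' b' s' \<in> X" using p pa Xact' that by blast
      hence "p \<in> V \<longleftrightarrow> m a' b' s' \<in> V" using orbit_iff that pa by blast
      moreover have "poly (Q a' b') s' = 0" using Q that Qact[of t a' b' s'] by simp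
      ultimately show ?thesis by (simp add: Z_def)
    qed
    show ?thesis
    proof (cases "b = 0")
      case False
      obtain t where t: "t ^ w2 = b" using complex_nth_root_exists[OF w2_pos] by blast
      hence t0: "t \<noteq> 0" using False w2_pos by (auto simp: zero_power)
      have "poly (Q (a / t ^ w1) 1) (s / t) = 0"
        using Q Qact[of t "a / t ^ w1" 1 "s / t"] t t0 by simp
      from ind1[OF this] show ?thesis
        using red[of t "a / t ^ w1" 1 "s / t"] t t0 by simp
    next
      case True
      hence a0: "a \<noteq> 0" using ab by simp
      obtain t where t: "t ^ w1 = a" using complex_nth_root_exists[OF w1_pos] by blast
      hence t0: "t \<noteq> 0" using a0 w1_pos by (auto simp: zero_power)
      have "poly (Q 1 0) (s / t) = 0"
        using Q Qact[of t 1 0 "s / t"] t t0 True by simp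
      from ind2[OF this] show ?thesis
        using red[of t 1 0 "s / t"] t t0 True by simp
    qed
  qed
  obtain p q where "p \<in> U \<inter> X" "q \<in> V \<inter> X" using UV(5,6) by blast
  hence "p \<in> X" "p \<notin> V" "q \<in> X" "q \<in> V" using UV(4) by auto
  thus False using key[of p] key[of q] by (metis zero_neq_one)
qed

end

section \<open>Cones over a loop\<close>

lemma norm_power_diff_le:
  fixes s t :: complex
  assumes "norm s \<le> \<tau>" "norm t \<le> \<tau>" "\<tau> > 0" "w > 0"
  shows "norm (s ^ w - t ^ w) \<le> real w * \<tau> ^ (w - 1) * norm (s - t)"
proof -
  define s' t' where "s' = s / of_real \<tau>" and "t' = t / of_real \<tau>"
  have n: "norm s' \<le> 1" "norm t' \<le> 1" using assms by (auto simp: s'_def t'_def norm_divide)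
  have e: "s = of_real \<tau> * s'" "t = of_real \<tau> * t'" using assms by (auto simp: s'_def t'_def)
  have "norm (s ^ w - t ^ w) = \<tau> ^ w * norm (s' ^ w - t' ^ w)"
    using assms(3) by (simp add: e power_mult_distrib norm_mult norm_power flip: right_diff_distrib)
  also have "\<dots> \<le> \<tau> ^ w * (real w * norm (s' - t'))"
    using assms(3) norm_power_diff[OF n, of w] by (intro mult_left_mono) auto
  also have "\<dots> = real w * \<tau> ^ (w - 1) * (\<tau> * norm (s' - t'))"
    using assms(4) by (cases w) auto
  also have "\<tau> * norm (s' - t') = norm (s - t)"
    using assms(3) by (simp add: e norm_mult flip: right_diff_distrib)
  finally show ?thesis .
qed

lemma norm_power_mult_diff_le:
  fixes s t x y :: complex
  assumes "norm s \<le> \<tau>" "norm t \<le> \<tau>" "\<tau> > 0" "w > 0" "norm y \<le> M"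
  shows "norm (s ^ w * x - t ^ w * y) \<le> \<tau> ^ w * norm (x - y) + M * real w * \<tau> ^ (w - 1) * norm (s - t)"
proof -
  have "s ^ w * x - t ^ w * y = s ^ w * (x - y) + y * (s ^ w - t ^ w)" by (simp add: algebra_simps)
  hence "norm (s ^ w * x - t ^ w * y) \<le> norm (s ^ w * (x - y)) + norm (y * (s ^ w - t ^ w))"
    using norm_triangle_ineq by metis
  also have "norm (s ^ w * (x - y)) \<le> \<tau> ^ w * norm (x - y)"
    unfolding norm_mult norm_power using assms by (intro mult_right_mono power_mono) auto
  also have "norm (y * (s ^ w - t ^ w)) \<le> M * (real w * \<tau> ^ (w - 1) * norm (s - t))"
    unfolding norm_mult using assms
    by (intro mult_mono norm_power_diff_le order_trans[OF norm_ge_zero assms(5)]) auto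
  finally show ?thesis by (simp add: mult_ac)
qed

lemma norm_Pair3_le: "norm (a, b, c) \<le> norm a + norm b + norm c"
  using norm_Pair_le[of a "(b, c)"] norm_Pair_le[of b c] by simp

lemma abs_diff_lt_of_floor_eq:
  fixes x y :: real
  assumes "\<lfloor>x\<rfloor> = \<lfloor>y\<rfloor>"
  shows "\<bar>x - y\<bar> < 1"
  using assms by linarith

lemma norm_complex_lt_of_floor:
  fixes x y :: complex
  assumes "\<lfloor>Re x / \<delta>\<rfloor> = \<lfloor>Re y / \<delta>\<rfloor>" "\<lfloor>Im x / \<delta>\<rfloor> = \<lfloor>Im y / \<delta>\<rfloor>" "\<delta> > 0"
  shows "norm (x - y) \<le> 2 * \<delta>"
proof -
  have "\<bar>Re x / \<delta> - Re y / \<delta>\<bar> < 1" "\<bar>Im x / \<delta> - Im y / \<delta>\<bar> < 1"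
    using assms abs_diff_lt_of_floor_eq by blast+
  hence "\<bar>Re (x - y)\<bar> < \<delta>" "\<bar>Im (x - y)\<bar> < \<delta>"
    using assms(3) by (simp_all add: field_simps abs_less_iff)
  thus ?thesis using cmod_le[of "x - y"] by linarith
qed

text \<open>The action on the points \<open>(1, p \<theta>, q \<theta>)\<close> of a loop, with
  \<open>t\<close> and \<open>\<theta>\<close> as parameters.\<close>

definition cone_map :: "nat \<Rightarrow> nat \<Rightarrow> nat \<Rightarrow> (real \<Rightarrow> complex) \<Rightarrow> (real \<Rightarrow> complex) \<Rightarrow>
    complex \<times> real \<Rightarrow> complex \<times> complex \<times> complex" where
  "cone_map w1 w2 w3 p q x = (fst x ^ w1, fst x ^ w2 * p (snd x), fst x ^ w3 * q (snd x))"

text \<open>The lower bound \<open>m\<close> keeps the loop off z = 0; it is what ties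
  \<open>|t| ^ w3\<close> to the distance from the origin.\<close>

locale cone =
  fixes w1 w2 w3 :: nat and p q :: "real \<Rightarrow> complex" and L M m :: real
  assumes w: "w3 > 0" "w3 < w1" "w3 < w2"
    and L: "\<And>x y. norm (p x - p y) \<le> L * \<bar>x - y\<bar>" "\<And>x y. norm (q x - q y) \<le> L * \<bar>x - y\<bar>"
    and M: "\<And>x. norm (p x) \<le> M" "\<And>x. norm (q x) \<le> M" "M \<ge> 1" and L0: "L \<ge> 0"
    and m: "m > 0" "\<And>x. m \<le> norm (q x)"
begin

abbreviation "\<Psi> \<equiv> cone_map w1 w2 w3 p q"

lemma coordinate_diff:
  fixes s t :: complex and b :: "real \<Rightarrow> complex"
  assumes "norm s \<le> \<tau>" "norm t \<le> \<tau>" "\<tau> > 0" "w > 0" "norm (b y) \<le> M"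
    "norm (b x - b y) \<le> L * \<bar>x - y\<bar>"
  shows "norm (s ^ w * b x - t ^ w * b y) \<le> \<tau> ^ w * (L * \<bar>x - y\<bar>) + M * real w * \<tau> ^ (w - 1) * norm (s - t)"
proof -
  have "\<tau> ^ w * norm (b x - b y) \<le> \<tau> ^ w * (L * \<bar>x - y\<bar>)"
    using assms by (intro mult_left_mono) auto
  thus ?thesis using norm_power_mult_diff_le[of s \<tau> t w "b y" M "b x"] assms by linarith
qed

text \<open>Cut the parameters into O(n^3) cells. Over a cell x and y vary by at most
  \<open>e = B * \<tau> ^ (w3 + 1) / n\<close>, but z by up to \<open>e / \<tau>\<close>, so O(1 /
  \<tau>^2) squares of side \<open>e\<close> are needed for z. The total n^3 * e^3 / \<tau>^2 is of
  order \<open>\<tau> ^ (3 * w3 + 1)\<close>, one power better than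
  \<open>\<tau> ^ (3 * w3)\<close>.\<close>

lemma measure_cone_le:
  "\<exists>C\<ge>0. \<forall>\<tau>. 0 < \<tau> \<and> \<tau> \<le> 1 \<longrightarrow>
     hausdorff_measure 3 (\<Psi> ` (cball 0 \<tau> \<times> {0..8})) \<le> ennreal (C * \<tau> ^ (3 * w3 + 1))"
proof -
  \<comment> \<open>\<open>L\<close> accounts for an angular step \<open>1 / n\<close>, the other
    summand for a step of size \<open>2 * (\<tau> / n)\<close> in \<open>t\<close>.\<close>
  define B where "B = L + 2 * M * real (w1 + w2 + w3)"
  have B: "B > 0" using L0 M(3) w by (auto simp: B_def intro!: add_nonneg_pos mult_pos_pos)
  \<comment> \<open>\<open>1296 = 3 * 3 * 9 * 4 * 4\<close>: twice
    \<open>2 * n + 1 \<le> 3 * n\<close>, once \<open>8 * n + 1 \<le> 9 * n\<close>, and twice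
    \<open>card J \<le> 4 / \<tau>\<close>. The \<open>2 * B\<close> comes from half the diameter
    \<open>4 * e\<close>.\<close>
  define C where "C = 1296 * (unit_ball_vol 3 * (2 * B) ^ 3)"
  have "C \<ge> 0" using B by (auto simp: C_def)
  moreover have "hausdorff_measure 3 (\<Psi> ` (cball 0 \<tau> \<times> {0..8})) \<le> ennreal (C * \<tau> ^ (3 * w3 + 1))"
    if \<tau>: "0 < \<tau>" "\<tau> \<le> 1" for \<tau>
  proof (rule hausdorff_measure_leI)
    fix \<delta> :: real assume "\<delta> > 0"
    define n where "n = nat \<lceil>4 * B / \<delta>\<rceil> + 1"
    have n: "n > 0" "real n \<ge> 4 * B / \<delta>" unfolding n_def by linarith+
    have n1: "real n \<ge> 1" using n(1) by simp
    define e where "e = B * \<tau> ^ (w3 + 1) / real n"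
    have e: "e > 0" using B \<tau> n by (simp add: e_def)
    have "4 * e \<le> 4 * B / real n"
      using B \<tau> n power_le_one[of \<tau> "w3 + 1"] by (auto simp: e_def intro!: divide_right_mono mult_left_le)
    also have "\<dots> \<le> \<delta>" using n n1 \<open>\<delta> > 0\<close> by (simp add: field_simps)
    finally have ed: "4 * e \<le> \<delta>" .
    let ?P = "cball 0 \<tau> \<times> {0..8} :: (complex \<times> real) set"
    define k where "k x = (\<lfloor>Re (fst x) / (\<tau> / n)\<rfloor>, \<lfloor>Im (fst x) / (\<tau> / n)\<rfloor>, \<lfloor>snd x * n\<rfloor>)" for x :: "complex \<times> real"
    define zc where "zc x = snd (snd (\<Psi> x))" for x
    \<comment> \<open>One representative per cell. Measuring the third coordinate from it, as
      \<open>v\<close> does, bounds the number of squares by the variation over the cell.\<close>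
    define r where "r \<kappa> = (SOME x. x \<in> ?P \<and> k x = \<kappa>)" for \<kappa>
    have r: "r (k x) \<in> ?P" "k (r (k x)) = k x" if "x \<in> ?P" for x
      using someI_ex[of "\<lambda>y. y \<in> ?P \<and> k y = k x"] that unfolding r_def by blast+
    define v where "v x = zc x - zc (r (k x))" for x
    define key where "key x = (k x, \<lfloor>Re (v x) / e\<rfloor>, \<lfloor>Im (v x) / e\<rfloor>)" for x
    have close: "norm (fst x - fst y) \<le> 2 * (\<tau> / n)" "\<bar>snd x - snd y\<bar> \<le> 1 / n" if "k x = k y" for x y
    proof -
      show "norm (fst x - fst y) \<le> 2 * (\<tau> / n)"
        using that \<tau> n by (intro norm_complex_lt_of_floor) (auto simp: k_def)
      have "\<bar>snd x * n - snd y * n\<bar> < 1"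
        using that by (intro abs_diff_lt_of_floor_eq) (auto simp: k_def)
      also have "\<bar>snd x * n - snd y * n\<bar> = \<bar>snd x - snd y\<bar> * n"
        by (simp add: abs_mult flip: left_diff_distrib)
      finally show "\<bar>snd x - snd y\<bar> \<le> 1 / n" using n by (simp add: field_simps)
    qed
    have coord: "norm (fst x ^ w * b (snd x) - fst y ^ w * b (snd y)) \<le> B * \<tau> ^ w / n"
      if xy: "x \<in> ?P" "y \<in> ?P" "k x = k y" and wb: "w > 0" "w \<le> w1 + w2 + w3" "\<And>x. norm (b x) \<le> M"
        "\<And>x y. norm (b x - b y) \<le> L * \<bar>x - y\<bar>" for x y w b
    proof -
      have "norm (fst x ^ w * b (snd x) - fst y ^ w * b (snd y))
          \<le> \<tau> ^ w * (L * \<bar>snd x - snd y\<bar>) + M * real w * \<tau> ^ (w - 1) * norm (fst x - fst y)"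
        using xy \<tau> wb by (intro coordinate_diff) auto
      also have "\<dots> \<le> \<tau> ^ w * (L * (1 / n)) + M * real (w1 + w2 + w3) * \<tau> ^ (w - 1) * (2 * (\<tau> / n))"
        using close[OF xy(3)] \<tau> L0 M(3) wb by (intro add_mono mult_mono mult_left_mono) auto
      also have "\<dots> = \<tau> ^ w * (L * (1 / n)) + M * real (w1 + w2 + w3) * (2 * \<tau> ^ w / n)"
        using wb(1) by (cases w) auto
      also have "\<dots> = B * \<tau> ^ w / n"
      proof -
        have "\<tau> ^ w * (L * (1 / n)) + M * W * (2 * \<tau> ^ w / n) = (L + 2 * M * W) * \<tau> ^ w / n" for W
          by (simp add: add_divide_distrib algebra_simps)
        thus ?thesis unfolding B_def .
      qed
      finally show ?thesis .
    qed
    have one: "norm (fst x ^ w - fst y ^ w) \<le> B * \<tau> ^ w / n"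
      if "x \<in> ?P" "y \<in> ?P" "k x = k y" "w > 0" "w \<le> w1 + w2 + w3" for x y w
      using coord[OF that, of "\<lambda>_. 1"] M(3) L0 by simp
    have small: "B * \<tau> ^ w / n \<le> e" if "w > w3" for w
      unfolding e_def using B \<tau> that n by (intro divide_right_mono mult_left_mono power_decreasing) auto
    have vb: "norm (v x) \<le> e / \<tau>" if "x \<in> ?P" for x
    proof -
      have "norm (v x) \<le> B * \<tau> ^ w3 / n"
        unfolding v_def zc_def cone_map_def snd_conv using that r[OF that] w M L by (intro coord) auto
      also have "\<dots> = e / \<tau>" using \<tau> by (simp add: e_def)
      finally show ?thesis .
    qed
    define J where "J = {\<lfloor>- 1 / \<tau>\<rfloor>..\<lfloor>1 / \<tau>\<rfloor>}"
    have Jin: "\<lfloor>s / e\<rfloor> \<in> J" if "\<bar>s\<bar> \<le> e / \<tau>" for s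
    proof -
      have "\<bar>s / e\<bar> \<le> 1 / \<tau>" using that e \<tau> by (simp add: field_simps)
      hence "- 1 / \<tau> \<le> s / e" "s / e \<le> 1 / \<tau>" by linarith+
      thus ?thesis unfolding J_def by (auto intro: floor_mono)
    qed
    have cJ: "real (card J) \<le> 4 / \<tau>"
    proof -
      have "1 / \<tau> \<ge> 1" using \<tau> by simp
      moreover have "real (card J) \<le> 2 * (1 / \<tau>) + 2"
        unfolding J_def using \<open>1 / \<tau> \<ge> 1\<close> by (simp, linarith)
      ultimately show ?thesis by simp
    qed
    define I where "I = ({- int n..int n} \<times> {- int n..int n} \<times> {0..int (8 * n)}) \<times> J \<times> J"
    have "hausdorff_approx 3 (4 * e) (\<Psi> ` ?P) \<le> ennreal (real (card I) * (unit_ball_vol (real 3) * (4 * e / 2) ^ 3))"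
    proof (rule hausdorff_approx_image_le_card[where key=key])
      show "finite I" by (simp add: I_def J_def)
      show "key x \<in> I" if x: "x \<in> ?P" for x
      proof -
        have c: "\<lfloor>s / (\<tau> / n)\<rfloor> \<in> {- int n..int n}" if "\<bar>s\<bar> \<le> \<tau>" for s
        proof -
          have "\<bar>s / (\<tau> / n)\<bar> \<le> n" using that \<tau> n by (simp add: field_simps abs_mult)
          hence "- real n \<le> s / (\<tau> / n)" "s / (\<tau> / n) \<le> real n" by linarith+
          thus ?thesis by (auto simp: le_floor_iff floor_le_iff)
        qed
        have f: "norm (fst x) \<le> \<tau>" "0 \<le> snd x" "snd x \<le> 8" using x by auto
        have "\<bar>Re (fst x)\<bar> \<le> \<tau>" "\<bar>Im (fst x)\<bar> \<le> \<tau>"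
          using f(1) abs_Re_le_cmod[of "fst x"] abs_Im_le_cmod[of "fst x"] by linarith+
        moreover have "\<lfloor>snd x * n\<rfloor> \<in> {0..int (8 * n)}"
        proof -
          have "snd x * real n \<le> 8 * real n" using f by (intro mult_right_mono) auto
          thus ?thesis using f by (auto simp: le_floor_iff floor_le_iff)
        qed
        moreover have "\<bar>Re (v x)\<bar> \<le> e / \<tau>" "\<bar>Im (v x)\<bar> \<le> e / \<tau>"
          using vb[OF x] abs_Re_le_cmod[of "v x"] abs_Im_le_cmod[of "v x"] by linarith+
        ultimately show ?thesis using c Jin unfolding key_def k_def I_def by blast
      qed
      \<comment> \<open>Each of the first two coordinates contributes \<open>e\<close>, and the
        third \<open>2 * e\<close> from its square.\<close>
      show "dist (\<Psi> x) (\<Psi> y) \<le> 4 * e" if xy: "x \<in> ?P" "y \<in> ?P" "key x = key y" for x y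
      proof -
        have kk: "k x = k y" using xy(3) by (simp add: key_def)
        have "norm (v x - v y) \<le> 2 * e"
          using xy(3) e by (intro norm_complex_lt_of_floor) (auto simp: key_def)
        hence z: "norm (fst x ^ w3 * q (snd x) - fst y ^ w3 * q (snd y)) \<le> 2 * e"
          by (simp add: v_def kk zc_def cone_map_def)
        have b: "norm (fst x ^ w1 - fst y ^ w1) \<le> e"
          using order_trans[OF one[OF xy(1,2) kk] small] w by simp
        have u: "norm (fst x ^ w2 * p (snd x) - fst y ^ w2 * p (snd y)) \<le> e"
          using order_trans[OF coord[OF xy(1,2) kk] small] w M L by simp
        show ?thesis
          using norm_Pair3_le[of "fst x ^ w1 - fst y ^ w1" "fst x ^ w2 * p (snd x) - fst y ^ w2 * p (snd y)"
              "fst x ^ w3 * q (snd x) - fst y ^ w3 * q (snd y)"] z b u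
          unfolding dist_norm cone_map_def by simp
      qed
    qed (use e in auto)
    also have "\<dots> \<le> ennreal (C * \<tau> ^ (3 * w3 + 1))"
    proof (rule ennreal_leI)
      have cI: "real (card I) = (2 * real n + 1) * ((2 * real n + 1) * (8 * real n + 1)) * (real (card J) * real (card J))"
        unfolding I_def by (simp add: card_cartesian_product)
      have "real (card I) \<le> (3 * real n) * ((3 * real n) * (9 * real n)) * ((4 / \<tau>) * (4 / \<tau>))"
        unfolding cI using n1 cJ \<tau> by (intro mult_mono) auto
      hence "real (card I) * (unit_ball_vol (real 3) * (4 * e / 2) ^ 3)
        \<le> (3 * real n) * ((3 * real n) * (9 * real n)) * ((4 / \<tau>) * (4 / \<tau>)) * (unit_ball_vol (real 3) * (4 * e / 2) ^ 3)"
        using e by (intro mult_right_mono) auto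
      also have "\<dots> = 1296 * (real n ^ 3 * e ^ 3 / \<tau>\<^sup>2) * (unit_ball_vol 3 * 2 ^ 3)"
        by (simp add: field_simps power2_eq_square power3_eq_cube)
      also have "real n ^ 3 * e ^ 3 / \<tau>\<^sup>2 = B ^ 3 * \<tau> ^ (3 * w3 + 1)"
      proof -
        have "real n * e = B * \<tau> ^ (w3 + 1)" using n by (simp add: e_def)
        hence "real n ^ 3 * e ^ 3 = (B * \<tau> ^ (w3 + 1)) ^ 3" by (metis power_mult_distrib)
        also have "\<dots> = B ^ 3 * \<tau> ^ (3 * w3 + 1) * \<tau>\<^sup>2"
          by (simp add: power_mult_distrib flip: power_mult power_add) (simp add: algebra_simps eval_nat_numeral)
        finally show ?thesis using \<tau> by simp
      qed
      finally show "real (card I) * (unit_ball_vol (real 3) * (4 * e / 2) ^ 3) \<le> C * \<tau> ^ (3 * w3 + 1)"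
        by (simp add: C_def power_mult_distrib mult_ac)
    qed
    finally show "\<exists>\<delta>'\<le>\<delta>. hausdorff_approx 3 \<delta>' (\<Psi> ` ?P) \<le> ennreal (C * \<tau> ^ (3 * w3 + 1))"
      using ed by blast
  qed
  ultimately show ?thesis by blast
qed

text \<open>In the ball of radius \<open>\<epsilon>\<close> the third coordinate forces
  \<open>norm t \<le> T \<epsilon>\<close>, where \<open>T \<epsilon> ^ w3 = \<epsilon> / m\<close>.
  Hence measure over \<open>\<epsilon> ^ 3\<close> is at most
  \<open>C / m ^ 3 * T \<epsilon>\<close>.\<close>

lemma cone_upper_density: "upper_density 3 (\<Psi> ` (UNIV \<times> {0..8})) 0 = 0"
proof -
  obtain C where C: "C \<ge> 0" "\<And>\<tau>. 0 < \<tau> \<Longrightarrow> \<tau> \<le> 1 \<Longrightarrow>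
     hausdorff_measure 3 (\<Psi> ` (cball 0 \<tau> \<times> {0..8})) \<le> ennreal (C * \<tau> ^ (3 * w3 + 1))"
    using measure_cone_le by blast
  define T where "T \<epsilon> = root w3 (\<epsilon> / m)" for \<epsilon>
  have Tp: "T \<epsilon> ^ w3 = \<epsilon> / m" "T \<epsilon> > 0" if "\<epsilon> > 0" for \<epsilon>
    using that w m by (auto simp: T_def)
  show ?thesis
  proof (rule upper_density_zero[where V="\<lambda>\<epsilon>. C * T \<epsilon> ^ (3 * w3 + 1)"])
    have "((\<lambda>\<epsilon>. C / m ^ 3 * T \<epsilon>) \<longlongrightarrow> C / m ^ 3 * root w3 (0 / m)) (at_right 0)"
      unfolding T_def by (intro tendsto_intros) (use m in auto)
    hence lim: "((\<lambda>\<epsilon>. C / m ^ 3 * T \<epsilon>) \<longlongrightarrow> 0) (at_right 0)" by simp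
    have "\<forall>\<^sub>F \<epsilon> in at_right 0. C / m ^ 3 * T \<epsilon> = C * T \<epsilon> ^ (3 * w3 + 1) / \<epsilon> ^ 3"
      using eventually_at_right_less[of 0]
    proof eventually_elim
      case (elim \<epsilon>)
      have "T \<epsilon> ^ (3 * w3 + 1) = (T \<epsilon> ^ w3) ^ 3 * T \<epsilon>"
        by (simp add: mult.commute[of 3] flip: power_mult)
      thus ?case using Tp[OF elim] elim m by (simp add: power_divide)
    qed
    thus "((\<lambda>\<epsilon>. C * T \<epsilon> ^ (3 * w3 + 1) / \<epsilon> ^ 3) \<longlongrightarrow> 0) (at_right 0)"
      by (rule Lim_transform_eventually[OF lim])
    show "\<forall>\<^sub>F \<epsilon> in at_right 0. 0 \<le> C * T \<epsilon> ^ (3 * w3 + 1) \<and>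
       hausdorff_measure 3 (\<Psi> ` (UNIV \<times> {0..8}) \<inter> cball 0 \<epsilon>) \<le> ennreal (C * T \<epsilon> ^ (3 * w3 + 1))"
      unfolding eventually_at_right_field
    proof (intro exI[of _ m] conjI allI impI m(1))
      fix \<epsilon> :: real assume \<epsilon>: "0 < \<epsilon>" "\<epsilon> < m"
      note T = Tp[OF \<epsilon>(1)]
      have T1: "T \<epsilon> \<le> 1"
      proof (rule ccontr)
        assume "\<not> T \<epsilon> \<le> 1"
        hence "1 \<le> T \<epsilon> ^ w3" by (intro one_le_power) auto
        thus False using T \<epsilon> m by (simp add: field_simps)
      qed
      show "0 \<le> C * T \<epsilon> ^ (3 * w3 + 1)" using C(1) T by simp
      have "\<Psi> ` (UNIV \<times> {0..8}) \<inter> cball 0 \<epsilon> \<subseteq> \<Psi> ` (cball 0 (T \<epsilon>) \<times> {0..8})"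
      proof
        fix x assume x: "x \<in> \<Psi> ` (UNIV \<times> {0..8}) \<inter> cball 0 \<epsilon>"
        then obtain t \<theta> where t: "x = \<Psi> (t, \<theta>)" "\<theta> \<in> {0..8}" by auto
        have "norm t ^ w3 * m \<le> norm t ^ w3 * norm (q \<theta>)" using m by (intro mult_left_mono) auto
        also have "\<dots> = norm (snd (snd x))" by (simp add: t cone_map_def norm_mult norm_power)
        also have "\<dots> \<le> norm x" by (metis norm_snd_le order_trans prod.collapse)
        also have "\<dots> \<le> \<epsilon>" using x by simp
        also have "\<epsilon> = T \<epsilon> ^ w3 * m" using T m by simp
        finally have "norm t ^ w3 \<le> T \<epsilon> ^ w3" using m(1) by simp
        hence "norm t \<le> T \<epsilon>" using w T(2) by (simp add: power_mono_iff)
        thus "x \<in> \<Psi> ` (cball 0 (T \<epsilon>) \<times> {0..8})" using t by auto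
      qed
      hence "hausdorff_measure 3 (\<Psi> ` (UNIV \<times> {0..8}) \<inter> cball 0 \<epsilon>)
          \<le> hausdorff_measure 3 (\<Psi> ` (cball 0 (T \<epsilon>) \<times> {0..8}))" by (rule hausdorff_measure_mono)
      also have "\<dots> \<le> ennreal (C * T \<epsilon> ^ (3 * w3 + 1))" by (rule C(2)) (use T T1 in auto)
      finally show "hausdorff_measure 3 (\<Psi> ` (UNIV \<times> {0..8}) \<inter> cball 0 \<epsilon>) \<le> ennreal (C * T \<epsilon> ^ (3 * w3 + 1))" .
    qed
  qed
qed

text \<open>The definition takes parameter sets from the ambient space, so the parameters are placed
  as \<open>(t, \<theta>, 0)\<close> in a real 3-dimensional subspace. Bounding \<open>t\<close> by
  \<open>i\<close> makes the map Lipschitz on each piece.\<close>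

lemma cone_rectifiable: "countably_rectifiable 3 (\<Psi> ` (UNIV \<times> {0..8}))"
proof -
  define E where "E i = {x :: complex \<times> complex \<times> complex. \<exists>t \<theta>. x = (t, of_real \<theta>, 0) \<and> norm t \<le> real i \<and> \<theta> \<in> {0..8}}" for i :: nat
  define f where "f x = \<Psi> (fst x, Re (fst (snd x)))" for x :: "complex \<times> complex \<times> complex"
  have cov: "\<Psi> ` (UNIV \<times> {0..8}) \<subseteq> {} \<union> (\<Union>i. f ` E i)"
  proof
    fix x assume "x \<in> \<Psi> ` (UNIV \<times> {0..8})"
    then obtain t \<theta> where x: "x = \<Psi> (t, \<theta>)" and t: "\<theta> \<in> {0..8}" by auto
    obtain i :: nat where "norm t \<le> real i" using real_arch_simple by blast
    hence "(t, of_real \<theta>, 0) \<in> E i" using t by (auto simp: E_def)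
    moreover have "f (t, of_real \<theta>, 0) = \<Psi> (t, \<theta>)" by (simp add: f_def)
    ultimately have "\<Psi> (t, \<theta>) \<in> f ` E i" by (metis imageI)
    thus "x \<in> {} \<union> (\<Union>i. f ` E i)" unfolding x by blast
  qed
  have dim: "dim (E i) \<le> 3" for i
  proof -
    let ?B = "{(1, 0, 0), (\<i>, 0, 0), (0, 1, 0)} :: (complex \<times> complex \<times> complex) set"
    have "E i \<subseteq> span ?B"
    proof
      fix x assume "x \<in> E i"
      then obtain t \<theta> where "x = (t, of_real \<theta>, 0)" by (auto simp: E_def)
      hence "x = Re t *\<^sub>R (1, 0, 0) + (Im t *\<^sub>R (\<i>, 0, 0) + \<theta> *\<^sub>R (0, 1, 0))"
        by (auto simp: complex_eq_iff)
      moreover have "Re t *\<^sub>R (1, 0, 0) + (Im t *\<^sub>R (\<i>, 0, 0) + \<theta> *\<^sub>R (0, 1, 0)) \<in> span ?B"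
        by (intro span_add span_scale span_base) auto
      ultimately show "x \<in> span ?B" by simp
    qed
    hence "dim (E i) \<le> card ?B" by (intro dim_le_card) auto
    also have "\<dots> \<le> 3" by (rule order_trans[OF card_insert_le_m1]) (auto simp: card_insert_if)
    finally show ?thesis .
  qed
  have lip: "\<exists>K. K-lipschitz_on (E i) f" for i
  proof -
    define \<tau> where "\<tau> = max 1 (real i)"
    have \<tau>: "\<tau> > 0" "real i \<le> \<tau>" by (auto simp: \<tau>_def)
    define K where "K w = \<tau> ^ w * L + M * real w * \<tau> ^ (w - 1)" for w
    have K0: "K w \<ge> 0" for w using \<tau> L0 M(3) by (auto simp: K_def)
    have coord: "norm (fst x ^ w * b (Re (fst (snd x))) - fst y ^ w * b (Re (fst (snd y)))) \<le> K w * dist x y"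
      if xy: "x \<in> E i" "y \<in> E i" and wb: "w > 0" "\<And>x. norm (b x) \<le> M"
        "\<And>x y. norm (b x - b y) \<le> L * \<bar>x - y\<bar>" for x y w b
    proof -
      have d1: "norm (fst x - fst y) \<le> dist x y"
        using dist_fst_le[of x y] by (simp add: dist_norm)
      have "\<bar>Re (fst (snd x)) - Re (fst (snd y))\<bar> \<le> norm (fst (snd x) - fst (snd y))"
        using abs_Re_le_cmod[of "fst (snd x) - fst (snd y)"] by simp
      also have "\<dots> \<le> dist x y"
        using dist_fst_le[of "snd x" "snd y"] dist_snd_le[of x y] by (simp add: dist_norm)
      finally have d2: "\<bar>Re (fst (snd x)) - Re (fst (snd y))\<bar> \<le> dist x y" .
      have "norm (fst x ^ w * b (Re (fst (snd x))) - fst y ^ w * b (Re (fst (snd y))))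
        \<le> \<tau> ^ w * (L * \<bar>Re (fst (snd x)) - Re (fst (snd y))\<bar>) + M * real w * \<tau> ^ (w - 1) * norm (fst x - fst y)"
        using xy \<tau> wb by (intro coordinate_diff) (auto simp: E_def)
      also have "\<dots> \<le> \<tau> ^ w * (L * dist x y) + M * real w * \<tau> ^ (w - 1) * dist x y"
        using d1 d2 \<tau> L0 M(3) by (intro add_mono mult_left_mono) auto
      finally show ?thesis by (simp add: K_def algebra_simps)
    qed
    have "(K w1 + K w2 + K w3)-lipschitz_on (E i) f"
      unfolding lipschitz_on_def
    proof (intro conjI ballI)
      fix x y assume xy: "x \<in> E i" "y \<in> E i"
      have eq: "dist (f x) (f y) = norm (fst x ^ w1 - fst y ^ w1,
            fst x ^ w2 * p (Re (fst (snd x))) - fst y ^ w2 * p (Re (fst (snd y))),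
            fst x ^ w3 * q (Re (fst (snd x))) - fst y ^ w3 * q (Re (fst (snd y))))"
        by (simp add: dist_norm f_def cone_map_def)
      have "norm (fst x ^ w1 - fst y ^ w1) \<le> K w1 * dist x y"
        using coord[OF xy, of w1 "\<lambda>_. 1"] w M(3) L0 by simp
      moreover have "norm (fst x ^ w2 * p (Re (fst (snd x))) - fst y ^ w2 * p (Re (fst (snd y)))) \<le> K w2 * dist x y"
        using coord[OF xy, of w2 p] w M L by simp
      moreover have "norm (fst x ^ w3 * q (Re (fst (snd x))) - fst y ^ w3 * q (Re (fst (snd y)))) \<le> K w3 * dist x y"
        using coord[OF xy, of w3 q] w M L by simp
      ultimately show "dist (f x) (f y) \<le> (K w1 + K w2 + K w3) * dist x y"
        unfolding eq distrib_right
        using norm_Pair3_le[of "fst x ^ w1 - fst y ^ w1"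
            "fst x ^ w2 * p (Re (fst (snd x))) - fst y ^ w2 * p (Re (fst (snd y)))"
            "fst x ^ w3 * q (Re (fst (snd x))) - fst y ^ w3 * q (Re (fst (snd y)))"]
        by linarith
    qed (use K0 in auto)
    thus ?thesis by blast
  qed
  show ?thesis unfolding countably_rectifiable_def
    by (intro exI[of _ E] exI[of _ "\<lambda>_. f"] exI[of _ "{}"]) (use cov dim lip in auto)
qed

end

section \<open>Transversal slices\<close>

lemma norm_cis_diff_le: "norm (cis x - cis y) \<le> \<bar>x - y\<bar>"
proof -
  have "cis x - cis y = cis y * (cis (x - y) - 1)" by (simp add: algebra_simps cis_mult)
  hence "norm (cis x - cis y) = norm (exp (\<i> * of_real (x - y)) - 1)"
    by (simp add: norm_mult cis_conv_exp)
  also have "\<dots> = 2 * \<bar>sin ((x - y) / 2)\<bar>" by (rule dist_exp_i_1)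
  also have "\<dots> \<le> 2 * \<bar>(x - y) / 2\<bar>" by (intro mult_left_mono abs_sin_x_le_abs_x) auto
  finally show ?thesis by simp
qed

lemma prod_box_nhd:
  assumes "open N" "(a, b) \<in> N"
  shows "\<exists>\<eta>>0. \<forall>u z. norm (u - a) < \<eta> \<longrightarrow> norm (z - b) < \<eta> \<longrightarrow> (u, z) \<in> (N :: (complex \<times> complex) set)"
proof -
  obtain e where e: "e > 0" "ball (a, b) e \<subseteq> N" using assms open_contains_ball by blast
  show ?thesis
  proof (rule exI[of _ "e / 2"], intro conjI allI impI)
    fix u z assume uz: "norm (u - a) < e / 2" "norm (z - b) < e / 2"
    note uz' = uz[unfolded norm_minus_commute[of u] norm_minus_commute[of z]]
    have "dist (a, b) (u, z) \<le> norm (a - u) + norm (b - z)"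
      using norm_Pair_le[of "a - u" "b - z"] by (simp add: dist_norm)
    thus "(u, z) \<in> N" using uz' e by (intro subsetD[OF e(2)]) auto
  qed (use e in auto)
qed

lemma dist_forget:
  fixes x y :: "complex \<times> complex \<times> complex"
  shows "dist (fst x, snd (snd x)) (fst y, snd (snd y)) \<le> dist x y"
    "dist (fst x, fst (snd x)) (fst y, fst (snd y)) \<le> dist x y"
proof -
  have s: "sqrt (a + b) \<le> sqrt (a + (sqrt (c + e))\<^sup>2)" if "0 \<le> c" "0 \<le> e" "b = e \<or> b = c" for a b c e :: real
    using that by auto
  obtain a b c a' b' c' where e: "x = (a, b, c)" "y = (a', b', c')" by (cases x; cases y) auto
  show "dist (fst x, snd (snd x)) (fst y, snd (snd y)) \<le> dist x y"
    "dist (fst x, fst (snd x)) (fst y, fst (snd y)) \<le> dist x y"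
    unfolding e dist_Pair_Pair fst_conv snd_conv by (rule s; simp)+
qed

text \<open>The slice \<open>x = 1\<close> near \<open>(1, u0, 0)\<close>. The weights
  \<open>w1\<close> and \<open>w2\<close> are left unordered so that the exchanged polynomial is
  covered too. By \<open>nontriv\<close> the slice meets z = 0 in finitely many points.\<close>

locale wchart = whpoly +
  fixes u0 :: complex
  assumes w31: "w3 < w1" and w32: "w3 < w2"
    and smooth: "\<And>p. p \<in> sing3 F \<Longrightarrow> p = 0"
    and base: "eval3 F (1, u0, 0) = 0"
    and nontriv: "\<exists>u. eval3 F (1, u, 0) \<noteq> 0"
begin

definition h where "h u z = eval3 F (1, u, z)"
definition hu where "hu = eval3 (dy3 F) (1, u0, 0)"
definition hz where "hz = eval3 (dz3 F) (1, u0, 0)"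

lemma h_base: "h u0 0 = 0"
  using base by (simp add: h_def)

text \<open>If both derivatives vanished, Euler's identity at \<open>(1, u0, 0)\<close> would reduce
  to \<open>w1\<close> times the x derivative being 0, and the point would be singular.\<close>

lemma gradient_nonzero: "hu \<noteq> 0 \<or> hz \<noteq> 0"
proof (rule ccontr)
  assume "\<not> ?thesis"
  hence 0: "eval3 (dy3 F) (1, u0, 0) = 0" "eval3 (dz3 F) (1, u0, 0) = 0" by (auto simp: hu_def hz_def)
  hence "eval3 (dx3 F) (1, u0, 0) = 0" using euler[of 1 u0 0] base w1_pos by simp
  hence "(1, u0, 0) \<in> sing3 F" using 0 base by (simp add: sing3_def zero_set3_def)
  thus False using smooth[of "(1, u0, 0)"] by (simp add: zero_prod_def)
qed

text \<open>Mean value estimates in one variable at a time, along \<open>(u, z)\<close>,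
  \<open>(u', z)\<close>, \<open>(u', z')\<close>, with the partial derivatives close to their
  values at the base point.\<close>

lemma strictly_differentiable:
  assumes "e > 0"
  shows "\<exists>\<delta>>0. \<forall>u\<in>ball u0 \<delta>. \<forall>u'\<in>ball u0 \<delta>. \<forall>z\<in>ball 0 \<delta>. \<forall>z'\<in>ball 0 \<delta>.
      norm (h u z - h u' z' - hu * (u - u') - hz * (z - z')) \<le> e * (norm (u - u') + norm (z - z'))"
proof -
  have near: "\<exists>\<delta>>0. \<forall>u\<in>ball u0 \<delta>. \<forall>z\<in>ball 0 \<delta>. norm (eval3 c (1, u, z) - eval3 c (1, u0, 0)) < e" for c
  proof -
    have "continuous_on UNIV (\<lambda>x. eval3 c (1, fst x, snd x))" by (intro continuous_intros)
    then obtain \<delta> where d: "\<delta> > 0" "\<And>x. dist x (u0, 0) < \<delta> \<Longrightarrow> dist (eval3 c (1, fst x, snd x)) (eval3 c (1, u0, 0)) < e"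
      using assms unfolding continuous_on_iff by (metis UNIV_I fst_conv snd_conv)
    show ?thesis
    proof (intro exI[of _ "\<delta> / 2"] conjI ballI)
      fix u z :: complex assume uz: "u \<in> ball u0 (\<delta> / 2)" "z \<in> ball 0 (\<delta> / 2)"
      have "dist (u, z) (u0, 0) \<le> norm (u - u0) + norm z"
        using norm_Pair_le[of "u - u0" z] by (simp add: dist_norm)
      also have "\<dots> < \<delta>" using uz by (simp add: dist_norm norm_minus_commute)
      finally show "norm (eval3 c (1, u, z) - eval3 c (1, u0, 0)) < e" using d(2)[of "(u, z)"] by (simp add: dist_norm)
    qed (use d in auto)
  qed
  obtain \<delta>1 where d1: "\<delta>1 > 0" "\<And>u z. u \<in> ball u0 \<delta>1 \<Longrightarrow> z \<in> ball 0 \<delta>1 \<Longrightarrow> norm (eval3 (dy3 F) (1, u, z) - hu) < e"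
    using near[of "dy3 F"] unfolding hu_def by blast
  obtain \<delta>2 where d2: "\<delta>2 > 0" "\<And>u z. u \<in> ball u0 \<delta>2 \<Longrightarrow> z \<in> ball 0 \<delta>2 \<Longrightarrow> norm (eval3 (dz3 F) (1, u, z) - hz) < e"
    using near[of "dz3 F"] unfolding hz_def by blast
  show ?thesis
  proof (intro exI[of _ "min \<delta>1 \<delta>2"] conjI ballI)
    fix u u' z z' :: complex assume a: "u \<in> ball u0 (min \<delta>1 \<delta>2)" "u' \<in> ball u0 (min \<delta>1 \<delta>2)"
      "z \<in> ball 0 (min \<delta>1 \<delta>2)" "z' \<in> ball 0 (min \<delta>1 \<delta>2)"
    have 1: "norm ((h u z - hu * u) - (h u' z - hu * u')) \<le> e * norm (u - u')"
    proof (rule field_differentiable_bound[of "ball u0 \<delta>1" _ "\<lambda>u. eval3 (dy3 F) (1, u, z) - hu"])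
      show "((\<lambda>u. h u z - hu * u) has_field_derivative eval3 (dy3 F) (1, x, z) - hu) (at x within ball u0 \<delta>1)" for x
        unfolding h_def by (auto intro!: derivative_eq_intros has_field_derivative_at_within[OF DERIV_y])
    qed (use a d1(2)[of _ z] in \<open>auto intro: less_imp_le\<close>)
    have 2: "norm ((h u' z - hz * z) - (h u' z' - hz * z')) \<le> e * norm (z - z')"
    proof (rule field_differentiable_bound[of "ball 0 \<delta>2" _ "\<lambda>z. eval3 (dz3 F) (1, u', z) - hz"])
      show "((\<lambda>z. h u' z - hz * z) has_field_derivative eval3 (dz3 F) (1, u', x) - hz) (at x within ball 0 \<delta>2)" for x
        unfolding h_def by (auto intro!: derivative_eq_intros has_field_derivative_at_within[OF DERIV_z])
    qed (use a d2(2)[of u'] in \<open>auto intro: less_imp_le\<close>)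
    have "h u z - h u' z' - hu * (u - u') - hz * (z - z')
      = ((h u z - hu * u) - (h u' z - hu * u')) + ((h u' z - hz * z) - (h u' z' - hz * z'))"
      by (simp add: algebra_simps)
    hence "norm (h u z - h u' z' - hu * (u - u') - hz * (z - z'))
      \<le> norm ((h u z - hu * u) - (h u' z - hu * u')) + norm ((h u' z - hz * z) - (h u' z' - hz * z'))"
      using norm_triangle_ineq by metis
    thus "norm (h u z - h u' z' - hu * (u - u') - hz * (z - z')) \<le> e * (norm (u - u') + norm (z - z'))"
      using 1 2 by (simp add: distrib_left)
  qed (use d1 d2 in auto)
qed

lemma strictly_differentiable_swap:
  assumes "e > 0"
  shows "\<exists>\<delta>>0. \<forall>z\<in>ball 0 \<delta>. \<forall>z'\<in>ball 0 \<delta>. \<forall>u\<in>ball u0 \<delta>. \<forall>u'\<in>ball u0 \<delta>.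
      norm (h u z - h u' z' - hz * (z - z') - hu * (u - u')) \<le> e * (norm (z - z') + norm (u - u'))"
proof -
  have eq: "h u z - h u' z' - hz * (z - z') - hu * (u - u') = h u z - h u' z' - hu * (u - u') - hz * (z - z')" for u u' z z'
    by simp
  show ?thesis unfolding eq using strictly_differentiable[OF assms] by (metis add.commute)
qed

text \<open>Expansion about \<open>u0\<close> turns roots near \<open>u0\<close> into small roots,
  the subject of \<open>poly_small_root\<close>.\<close>

definition shifted :: "complex \<Rightarrow> complex poly" where
  "shifted z = (\<Sum>j\<le>d. smult (\<Sum>i\<le>d. \<Sum>k\<le>d. F (i, j, k) * z ^ k) ([:u0, 1:] ^ j))"

lemma poly_shifted: "poly (shifted z) v = h (u0 + v) z"
proof -
  have "poly (shifted z) v = (\<Sum>j\<le>d. \<Sum>i\<le>d. \<Sum>k\<le>d. F (i, j, k) * (u0 + v) ^ j * z ^ k)"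
    unfolding shifted_def by (simp add: poly_sum poly_power sum_distrib_right sum_distrib_left mult_ac)
  also have "\<dots> = (\<Sum>i\<le>d. \<Sum>j\<le>d. \<Sum>k\<le>d. F (i, j, k) * (u0 + v) ^ j * z ^ k)" by (rule sum.swap)
  finally show ?thesis by (simp add: h_def eval_sum)
qed

lemma degree_shifted: "degree (shifted z) \<le> d"
  unfolding shifted_def
proof (rule degree_sum_le)
  fix j assume "j \<in> {..d}"
  have "degree ([:u0, 1:] ^ j) = j" by (simp add: degree_linear_power)
  thus "degree (smult (\<Sum>i\<le>d. \<Sum>k\<le>d. F (i, j, k) * z ^ k) ([:u0, 1:] ^ j)) \<le> d"
    using \<open>j \<in> {..d}\<close> by (intro order_trans[OF degree_smult_le]) simp
qed simp

lemma continuous_coeff_shifted: "continuous_on S (\<lambda>z. coeff (shifted z) m)"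
  unfolding shifted_def by (auto simp: coeff_sum intro!: continuous_intros)

lemma finite_roots_axis: "finite {u. h u 0 = 0}"
proof -
  have "shifted 0 \<noteq> 0"
  proof
    assume 0: "shifted 0 = 0"
    obtain u where "h u 0 \<noteq> 0" using nontriv by (auto simp: h_def)
    thus False using poly_shifted[of 0 "u - u0"] 0 by simp
  qed
  hence "finite {v. poly (shifted 0) v = 0}" by (rule poly_roots_finite)
  hence "finite ((\<lambda>v. u0 + v) ` {v. poly (shifted 0) v = 0})" by simp
  moreover have "{u. h u 0 = 0} \<subseteq> (\<lambda>v. u0 + v) ` {v. poly (shifted 0) v = 0}"
  proof
    fix u assume "u \<in> {u. h u 0 = 0}"
    thus "u \<in> (\<lambda>v. u0 + v) ` {v. poly (shifted 0) v = 0}"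
      by (intro image_eqI[of _ _ "u - u0"]) (auto simp: poly_shifted)
  qed
  ultimately show ?thesis by (rule finite_subset[rotated])
qed

text \<open>At \<open>z = 0\<close> the constant coefficient vanishes while some other coefficient
  does not. For small \<open>z\<close> the constant one is still small, which forces a small root,
  even where \<open>hu = 0\<close>.\<close>

lemma near_root:
  assumes "\<eta> > 0"
  shows "\<exists>\<delta>>0. \<forall>z. norm z < \<delta> \<longrightarrow> (\<exists>u. norm (u - u0) < \<eta> \<and> h u z = 0)"
proof -
  have c0: "coeff (shifted 0) 0 = 0" using poly_shifted[of 0 0] h_base by (simp add: poly_0_coeff_0)
  obtain u where "h u 0 \<noteq> 0" using nontriv by (auto simp: h_def)
  hence "shifted 0 \<noteq> 0" using poly_shifted[of 0 "u - u0"] by auto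
  then obtain m where m: "coeff (shifted 0) m \<noteq> 0" by (auto simp: poly_eq_iff)
  hence m0: "m > 0" using c0 by (cases m) auto
  define g where "g z = norm (coeff (shifted z) m) * \<eta> ^ m - 2 ^ d * norm (coeff (shifted z) 0)" for z
  have "open {z. 0 < g z}"
    unfolding g_def by (intro open_Collect_less continuous_intros continuous_coeff_shifted)
  moreover have "0 \<in> {z. 0 < g z}" using m c0 assms by (simp add: g_def)
  ultimately obtain \<delta> where d: "\<delta> > 0" "ball 0 \<delta> \<subseteq> {z. 0 < g z}" using open_contains_ball by blast
  show ?thesis
  proof (intro exI[of _ \<delta>] conjI allI impI)
    fix z :: complex assume "norm z < \<delta>"
    hence g: "2 ^ d * norm (coeff (shifted z) 0) < norm (coeff (shifted z) m) * \<eta> ^ m"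
      using d by (auto simp: g_def)
    hence ne: "coeff (shifted z) m \<noteq> 0"
      by (smt (verit) mult_eq_0_iff mult_nonneg_nonneg norm_eq_zero norm_ge_zero zero_le_power)
    obtain v where v: "poly (shifted z) v = 0"
        "norm (coeff (shifted z) m) * norm v ^ m \<le> 2 ^ d * norm (coeff (shifted z) 0)"
      using poly_small_root[OF degree_shifted ne m0] by blast
    have "norm (coeff (shifted z) m) * norm v ^ m < norm (coeff (shifted z) m) * \<eta> ^ m" using v g by linarith
    hence "norm v ^ m < \<eta> ^ m" using ne by simp
    hence "norm v < \<eta>" using assms by (intro power_less_imp_less_base[of "norm v" m \<eta>]) auto
    thus "\<exists>u. norm (u - u0) < \<eta> \<and> h u z = 0"
      using v by (intro exI[of _ "u0 + v"]) (simp add: poly_shifted)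
  qed (rule d)
qed

lemma linear_root_u:
  assumes "hu \<noteq> 0"
  shows "\<exists>\<delta>>0. \<exists>K\<ge>0. \<forall>z. norm z < \<delta> \<longrightarrow> (\<exists>u. h u z = 0 \<and> norm (u - u0) \<le> K * norm z)"
proof -
  obtain \<sigma> \<rho> \<phi> L where c: "0 < \<rho>" "L-lipschitz_on (cball 0 \<rho>) \<phi>" "\<phi> 0 = u0" "\<forall>z\<in>cball 0 \<rho>. h (\<phi> z) z = 0"
    using implicit_curve[of h u0 0 hu 1 hz, OF h_base assms zero_less_one strictly_differentiable] by blast
  show ?thesis
  proof (rule exI[of _ \<rho>], rule conjI, rule c, rule exI[of _ L], intro conjI allI impI)
    show "L \<ge> 0" using c(2) by (rule lipschitz_on_nonneg)
    fix z :: complex assume z: "norm z < \<rho>"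
    hence "dist (\<phi> z) (\<phi> 0) \<le> L * dist z 0" using c(1) by (intro lipschitz_onD[OF c(2)]) auto
    thus "\<exists>u. h u z = 0 \<and> norm (u - u0) \<le> L * norm z"
      using c z by (intro exI[of _ "\<phi> z"]) (auto simp: dist_norm)
  qed
qed

text \<open>At \<open>z = 0\<close> the equation fails by \<open>h u 0\<close>. The slope
  \<open>hz\<close>, at most half of which is lost to the error, converts this defect into a bound
  for the root.\<close>

lemma linear_root_z:
  assumes "hz \<noteq> 0"
  shows "\<exists>\<delta>>0. \<exists>K\<ge>0. \<forall>u. norm (u - u0) < \<delta> \<longrightarrow> (\<exists>z. h u z = 0 \<and> norm z \<le> K * norm (h u 0))"
proof -
  obtain \<delta> where d: "\<delta> > 0" and st: "\<And>u u' z z'. u \<in> ball u0 \<delta> \<Longrightarrow> u' \<in> ball u0 \<delta> \<Longrightarrow> z \<in> ball 0 \<delta> \<Longrightarrow> z' \<in> ball 0 \<delta> \<Longrightarrow>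
      norm (h u z - h u' z' - hu * (u - u') - hz * (z - z')) \<le> norm hz / 2 * (norm (u - u') + norm (z - z'))"
    using strictly_differentiable[of "norm hz / 2"] assms by auto
  obtain \<sigma> \<rho> \<phi> L where c: "\<sigma> \<le> \<delta>" "0 < \<rho>" "\<rho> \<le> \<delta>" "\<forall>u\<in>cball u0 \<rho>. \<phi> u \<in> ball 0 \<sigma> \<and> h u (\<phi> u) = 0"
    using implicit_curve[of "\<lambda>z u. h u z" 0 u0 hz \<delta> hu, OF h_base assms d strictly_differentiable_swap] by blast
  show ?thesis
  proof (rule exI[of _ \<rho>], rule conjI, rule c, rule exI[of _ "2 / norm hz"], intro conjI allI impI)
    fix u assume u: "norm (u - u0) < \<rho>"
    hence u': "u \<in> cball u0 \<rho>" "u \<in> ball u0 \<delta>" using c(3) by (auto simp: dist_norm norm_minus_commute)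
    have "\<phi> u \<in> ball 0 \<delta>" using c(1,4) u'(1) by fastforce
    hence "norm (h u (\<phi> u) - h u 0 - hu * (u - u) - hz * (\<phi> u - 0)) \<le> norm hz / 2 * (norm (u - u) + norm (\<phi> u - 0))"
      using u' d by (intro st) auto
    hence "norm (h u 0 + hz * \<phi> u) \<le> norm hz / 2 * norm (\<phi> u)"
      using c u' by (simp add: norm_minus_commute[of 0] flip: norm_minus_cancel[of "h u 0 + hz * \<phi> u"])
    moreover have "norm (hz * \<phi> u) \<le> norm (h u 0 + hz * \<phi> u) + norm (h u 0)"
      by (metis add_diff_cancel_left' norm_triangle_ineq4)
    ultimately have "norm hz * norm (\<phi> u) \<le> 2 * norm (h u 0)" by (simp add: norm_mult)
    hence "norm (\<phi> u) \<le> 2 / norm hz * norm (h u 0)" using assms by (simp add: field_simps)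
    thus "\<exists>z. h u z = 0 \<and> norm z \<le> 2 / norm hz * norm (h u 0)" using c u' by blast
  qed (use c in auto)
qed

text \<open>The slice is a graph over z if \<open>hu\<close> is nonzero and over u otherwise. That
  it meets z = 0 only at its centre is clear in the first case; in the second it follows from the
  finiteness of the roots on the axis. The neighbourhoods for all smaller \<open>r\<close> allow the
  disc to be shrunk later.\<close>

lemma local_curve:
  "\<exists>\<gamma>1 \<gamma>2 \<rho> L. \<rho> > 0 \<and> L-lipschitz_on (cball 0 \<rho>) \<gamma>1 \<and> L-lipschitz_on (cball 0 \<rho>) \<gamma>2 \<and>
     \<gamma>1 0 = u0 \<and> \<gamma>2 0 = 0 \<and> (\<forall>s\<in>cball 0 \<rho>. h (\<gamma>1 s) (\<gamma>2 s) = 0 \<and> (\<gamma>2 s = 0 \<longrightarrow> s = 0)) \<and>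
     (\<forall>r. 0 < r \<and> r \<le> \<rho> \<longrightarrow> (\<exists>N. open N \<and> (u0, 0) \<in> N \<and>
        {x \<in> N. h (fst x) (snd x) = 0} = (\<lambda>s. (\<gamma>1 s, \<gamma>2 s)) ` ball (0::complex) r))"
proof (cases "hu = 0")
  case False
  obtain \<sigma> \<rho> \<phi> L where c: "0 < \<sigma>" "0 < \<rho>" "L-lipschitz_on (cball 0 \<rho>) \<phi>" "\<phi> 0 = u0"
      "\<forall>z\<in>cball 0 \<rho>. \<phi> z \<in> ball u0 \<sigma> \<and> h (\<phi> z) z = 0"
      "\<forall>u\<in>ball u0 \<sigma>. \<forall>z\<in>cball 0 \<rho>. h u z = 0 \<longrightarrow> u = \<phi> z"
    using implicit_curve[of h u0 0 hu 1 hz, OF h_base False zero_less_one strictly_differentiable] by blast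
  have L0: "L \<ge> 0" using c(3) by (rule lipschitz_on_nonneg)
  have lip: "(max L 1)-lipschitz_on (cball 0 \<rho>) \<phi>" by (rule lipschitz_on_mono[OF c(3)]) auto
  have lip': "(max L 1)-lipschitz_on (cball 0 \<rho>) (\<lambda>s::complex. s)"
    by (rule lipschitz_on_mono[OF lipschitz_on_id[unfolded id_def]]) auto
  have N: "\<exists>N. open N \<and> (u0, 0) \<in> N \<and>
        {x \<in> N. h (fst x) (snd x) = 0} = (\<lambda>s. (\<phi> s, s)) ` ball 0 r" if r: "0 < r" "r \<le> \<rho>" for r
  proof (intro exI[of _ "ball u0 \<sigma> \<times> ball 0 r"] conjI)
    show "{x \<in> ball u0 \<sigma> \<times> ball 0 r. h (fst x) (snd x) = 0} = (\<lambda>s. (\<phi> s, s)) ` ball 0 r"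
      using c(5,6) r by (force simp: image_iff)
  qed (use c r in \<open>auto simp: open_Times\<close>)
  show ?thesis
    by (rule exI[of _ \<phi>], rule exI[of _ "\<lambda>s. s"], rule exI[of _ \<rho>], rule exI[of _ "max L 1"]) (use c lip lip' N in auto)
next
  case True
  hence hz: "hz \<noteq> 0" using gradient_nonzero by blast
  have "finite ({u. h u 0 = 0} - {u0})" using finite_roots_axis by simp
  \<comment> \<open>Radius that excludes the other zeros of \<open>h\<close> on the axis.\<close>
  then obtain R where R: "R > 0" "\<And>u. h u 0 = 0 \<Longrightarrow> u \<noteq> u0 \<Longrightarrow> R < dist u0 u"
  proof -
    assume fin: "finite ({u. h u 0 = 0} - {u0})"
    hence "open (- ({u. h u 0 = 0} - {u0}))" by (intro open_Compl finite_imp_closed)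
    then obtain e where e: "e > 0" "ball u0 e \<subseteq> - ({u. h u 0 = 0} - {u0})" using open_contains_ball by blast
    have "e / 2 < dist u0 u" if "h u 0 = 0" "u \<noteq> u0" for u
    proof -
      have "u \<notin> ball u0 e" using e that by blast
      thus ?thesis using e(1) by simp
    qed
    thus thesis using e(1) by (intro that[of "e / 2"]) auto
  qed
  obtain \<sigma> \<rho> \<phi> L where c: "0 < \<sigma>" "0 < \<rho>" "\<rho> \<le> R" "L-lipschitz_on (cball u0 \<rho>) \<phi>" "\<phi> u0 = 0"
      "\<forall>u\<in>cball u0 \<rho>. \<phi> u \<in> ball 0 \<sigma> \<and> h u (\<phi> u) = 0"
      "\<forall>z\<in>ball 0 \<sigma>. \<forall>u\<in>cball u0 \<rho>. h u z = 0 \<longrightarrow> z = \<phi> u"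
    using implicit_curve[of "\<lambda>z u. h u z" 0 u0 hz R hu, OF h_base hz R(1) strictly_differentiable_swap] by blast
  have sh: "u0 + s \<in> cball u0 \<rho> \<longleftrightarrow> s \<in> cball 0 \<rho>" for s :: complex by (simp add: dist_norm)
  have lip: "(max L 1)-lipschitz_on (cball 0 \<rho>) (\<lambda>s. \<phi> (u0 + s))"
  proof (rule lipschitz_onI)
    fix x y :: complex assume xy: "x \<in> cball 0 \<rho>" "y \<in> cball 0 \<rho>"
    have "dist (\<phi> (u0 + x)) (\<phi> (u0 + y)) \<le> L * dist (u0 + x) (u0 + y)"
      using xy sh by (intro lipschitz_onD[OF c(4)]) auto
    also have "\<dots> \<le> max L 1 * dist x y" by (simp add: dist_norm mult_right_mono)
    finally show "dist (\<phi> (u0 + x)) (\<phi> (u0 + y)) \<le> max L 1 * dist x y" .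
  qed auto
  have lip': "(max L 1)-lipschitz_on (cball 0 \<rho>) (\<lambda>s::complex. u0 + s)"
  proof (rule lipschitz_onI)
    fix x y :: complex
    have "1 * dist x y \<le> max L 1 * dist x y" by (intro mult_right_mono) auto
    thus "dist (u0 + x) (u0 + y) \<le> max L 1 * dist x y" by (simp add: dist_norm)
  qed auto
  have N: "\<exists>N. open N \<and> (u0, 0) \<in> N \<and>
        {x \<in> N. h (fst x) (snd x) = 0} = (\<lambda>s. (u0 + s, \<phi> (u0 + s))) ` ball 0 r" if r: "0 < r" "r \<le> \<rho>" for r
  proof (intro exI[of _ "ball u0 r \<times> ball 0 \<sigma>"] conjI)
    show "{x \<in> ball u0 r \<times> ball 0 \<sigma>. h (fst x) (snd x) = 0} = (\<lambda>s. (u0 + s, \<phi> (u0 + s))) ` ball 0 r"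
    proof (intro set_eqI iffI)
      fix x assume x: "x \<in> {x \<in> ball u0 r \<times> ball 0 \<sigma>. h (fst x) (snd x) = 0}"
      hence "fst x \<in> cball u0 \<rho>" "snd x \<in> ball 0 \<sigma>" using r by auto
      hence "snd x = \<phi> (fst x)" using c(7) x by blast
      thus "x \<in> (\<lambda>s. (u0 + s, \<phi> (u0 + s))) ` ball 0 r"
        using x by (intro image_eqI[of _ _ "fst x - u0"]) (auto simp: prod_eq_iff dist_norm norm_minus_commute)
    next
      fix x assume "x \<in> (\<lambda>s. (u0 + s, \<phi> (u0 + s))) ` ball 0 r"
      then obtain s where s: "x = (u0 + s, \<phi> (u0 + s))" "norm s < r" by auto
      hence "u0 + s \<in> cball u0 \<rho>" using r by (simp add: dist_norm)
      thus "x \<in> {x \<in> ball u0 r \<times> ball 0 \<sigma>. h (fst x) (snd x) = 0}"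
        using c(6) s by (auto simp: dist_norm)
    qed
  qed (use c r in \<open>auto simp: open_Times\<close>)
  have z: "s = 0" if s: "s \<in> cball 0 \<rho>" "\<phi> (u0 + s) = 0" for s
  proof (rule ccontr)
    assume "s \<noteq> 0"
    have "h (u0 + s) (\<phi> (u0 + s)) = 0" using c(6) s sh by blast
    hence "R < dist u0 (u0 + s)" using s(2) \<open>s \<noteq> 0\<close> by (intro R(2)) auto
    thus False using s(1) c(3) by (simp add: dist_norm)
  qed
  show ?thesis
    by (rule exI[of _ "\<lambda>s. u0 + s"], rule exI[of _ "\<lambda>s. \<phi> (u0 + s)"], rule exI[of _ \<rho>], rule exI[of _ "max L 1"])
       (use c lip lip' N z sh in auto)
qed

section \<open>Positive lower density from projections to two coordinates\<close>

lemma norm_act_1_le: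
  "norm (act t (1, u, z)) \<le> norm t ^ w1 + norm t ^ w2 * norm u + norm t ^ w3 * norm z"
  using norm_Pair3_le[of "t ^ w1" "t ^ w2 * u" "t ^ w3 * z"] by (simp add: norm_mult norm_power)

lemma scaled_small:
  fixes t y :: complex
  assumes "t \<noteq> 0" "norm t < 1" "norm y \<le> norm t ^ w1" "w < w1"
  shows "norm (y / t ^ w) \<le> norm t ^ (w1 - w)" "norm (y / t ^ w) \<le> norm t"
proof -
  have p: "norm t ^ w > 0" using assms(1) by simp
  have "norm t ^ w1 = norm t ^ (w1 - w) * norm t ^ w" using assms(4) by (simp flip: power_add)
  thus 1: "norm (y / t ^ w) \<le> norm t ^ (w1 - w)"
    using assms(3) p by (simp add: norm_divide norm_power divide_le_eq)
  have "norm t ^ (w1 - w) \<le> norm t ^ 1" using assms by (intro power_decreasing) auto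
  thus "norm (y / t ^ w) \<le> norm t" using 1 by simp
qed

text \<open>Near 0 the map \<open>(x, \<pi>)\<close> sends the cone over the slice in
  \<open>N\<close> onto all pairs with |y| at most |x|, using only points of norm at most
  \<open>K\<close> times |x|.\<close>

definition fills :: "(complex \<times> complex) set \<Rightarrow> (complex \<times> complex \<times> complex \<Rightarrow> complex) \<Rightarrow> bool" where
  "fills N \<pi> \<longleftrightarrow> (\<exists>K\<ge>1. \<exists>e>0. \<forall>t y. t \<noteq> 0 \<longrightarrow> norm t < e \<longrightarrow> norm y \<le> norm t ^ w1 \<longrightarrow>
    (\<exists>u z. (u, z) \<in> N \<and> h u z = 0 \<and> norm (act t (1, u, z)) \<le> K * norm t ^ w1 \<and> \<pi> (act t (1, u, z)) = y))"

text \<open>If \<open>w1 \<le> w2\<close>, the second coordinate \<open>t ^ w2 * u\<close> is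
  O(|t|^w1) for every bounded \<open>u\<close>, so a root near \<open>u0\<close> suffices, without
  any rate.\<close>

lemma fill_z:
  assumes N: "open N" "(u0, 0) \<in> N" and "w1 \<le> w2"
  shows "fills N (\<lambda>x. snd (snd x))"
proof -
  obtain \<eta> where \<eta>: "\<eta> > 0" "\<And>u z. norm (u - u0) < \<eta> \<Longrightarrow> norm z < \<eta> \<Longrightarrow> (u, z) \<in> N"
    using prod_box_nhd[OF N] by auto
  obtain \<delta> where \<delta>: "\<delta> > 0" "\<And>z. norm z < \<delta> \<Longrightarrow> \<exists>u. norm (u - u0) < min \<eta> 1 \<and> h u z = 0"
    using near_root[of "min \<eta> 1"] \<eta>(1) by auto
  show ?thesis
    unfolding fills_def
  \<comment> \<open>The coordinates contribute 1, \<open>norm u0 + 1\<close> and 1.\<close>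
  proof (rule exI[of _ "norm u0 + 3"], rule conjI, simp, rule exI[of _ "min 1 (min \<eta> \<delta>)"], intro conjI allI impI)
    fix t y :: complex assume t: "t \<noteq> 0" "norm t < min 1 (min \<eta> \<delta>)" and y: "norm y \<le> norm t ^ w1"
    define z where "z = y / t ^ w3"
    have z: "norm z \<le> norm t" unfolding z_def by (rule scaled_small) (use t y w31 in auto)
    obtain u where u: "norm (u - u0) < min \<eta> 1" "h u z = 0" using \<delta>(2)[of z] z t by auto
    have "norm u \<le> norm u0 + 1" using u(1) norm_triangle_ineq2[of u u0] by simp
    hence "norm t ^ w2 * norm u \<le> norm t ^ w1 * (norm u0 + 1)"
      using t \<open>w1 \<le> w2\<close> by (intro mult_mono power_decreasing) auto
    moreover have "norm t ^ w3 * norm z = norm y" using t by (simp add: z_def norm_divide norm_power)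
    ultimately have "norm (act t (1, u, z)) \<le> (norm u0 + 3) * norm t ^ w1"
      using norm_act_1_le[of t u z] y by (simp add: algebra_simps)
    moreover have "(u, z) \<in> N" using u z t by (intro \<eta>(2)) auto
    ultimately show "\<exists>u z. (u, z) \<in> N \<and> h u z = 0 \<and> norm (act t (1, u, z)) \<le> (norm u0 + 3) * norm t ^ w1 \<and> snd (snd (act t (1, u, z))) = y"
      using u t by (intro exI[of _ u] exI[of _ z]) (auto simp: z_def)
  qed (use \<eta> \<delta> in auto)
qed

text \<open>Without an order on \<open>w1\<close> and \<open>w2\<close> a rate is needed:
  \<open>u\<close> is O(|z|) = O(|t|^(w1 - w3)), and \<open>w3 < w2\<close> then makes
  \<open>t ^ w2 * u\<close> of order |t|^w1.\<close>

lemma fill_z_linear: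
  assumes N: "open N" "(u0, 0) \<in> N" and "u0 = 0" "hu \<noteq> 0"
  shows "fills N (\<lambda>x. snd (snd x))"
proof -
  obtain \<eta> where \<eta>: "\<eta> > 0" "\<And>u z. norm u < \<eta> \<Longrightarrow> norm z < \<eta> \<Longrightarrow> (u, z) \<in> N"
    using prod_box_nhd[OF N] \<open>u0 = 0\<close> by auto
  obtain \<delta> K where \<delta>: "\<delta> > 0" "K \<ge> 0" "\<And>z. norm z < \<delta> \<Longrightarrow> \<exists>u. h u z = 0 \<and> norm u \<le> K * norm z"
    using linear_root_u[OF \<open>hu \<noteq> 0\<close>] \<open>u0 = 0\<close> by auto
  show ?thesis
    unfolding fills_def
  proof (rule exI[of _ "K + 2"], rule conjI, simp add: \<delta>, rule exI[of _ "min 1 (min (min \<eta> \<delta>) (\<eta> / (K + 1)))"], intro conjI allI impI)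
    fix t y :: complex assume t: "t \<noteq> 0" "norm t < min 1 (min (min \<eta> \<delta>) (\<eta> / (K + 1)))" and y: "norm y \<le> norm t ^ w1"
    define z where "z = y / t ^ w3"
    have z: "norm z \<le> norm t ^ (w1 - w3)" "norm z \<le> norm t"
      unfolding z_def by (rule scaled_small; use t y w31 in auto)+
    obtain u where u: "h u z = 0" "norm u \<le> K * norm z" using \<delta>(3)[of z] z t by auto
    have Kt: "(K + 1) * norm t < \<eta>" using t \<delta>(2) by (simp add: field_simps)
    have "norm u \<le> (K + 1) * norm t" using u(2) z(2) \<delta>(2) by (smt (verit) mult_mono norm_ge_zero)
    hence "(u, z) \<in> N" using z t Kt by (intro \<eta>(2)) auto
    have "norm t ^ w2 * norm u \<le> norm t ^ w3 * (K * norm t ^ (w1 - w3))"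
      using t w32 u z \<delta>(2)
      by (intro mult_mono power_decreasing order_trans[OF u(2)] mult_left_mono) auto
    also have "\<dots> = K * norm t ^ w1" using w31 by (simp add: mult_ac flip: power_add)
    finally have "norm t ^ w2 * norm u \<le> K * norm t ^ w1" .
    moreover have "norm t ^ w3 * norm z = norm y" using t by (simp add: z_def norm_divide norm_power)
    ultimately have "norm (act t (1, u, z)) \<le> (K + 2) * norm t ^ w1"
      using norm_act_1_le[of t u z] y by (simp add: algebra_simps)
    thus "\<exists>u z. (u, z) \<in> N \<and> h u z = 0 \<and> norm (act t (1, u, z)) \<le> (K + 2) * norm t ^ w1 \<and> snd (snd (act t (1, u, z))) = y"
      using u t \<open>(u, z) \<in> N\<close> by (intro exI[of _ u] exI[of _ z]) (auto simp: z_def)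
  qed (use \<eta> \<delta> in auto)
qed

text \<open>The monomial \<open>b^a z\<close> present because \<open>hz\<close> is nonzero forces every \<open>b^i u^j\<close> of the same weighted
  degree to satisfy \<open>i + j > a\<close>; hence the solution \<open>z\<close> over \<open>|u| \<le> |b|\<close> scales at least linearly.\<close>

lemma axis_value_small:
  assumes "hz \<noteq> 0" "u0 = 0" "w2 < w1"
  shows "\<exists>H\<ge>0. \<forall>\<tau> u. 0 \<le> \<tau> \<longrightarrow> \<tau> \<le> 1 \<longrightarrow> norm u \<le> \<tau> ^ (w1 - w2) \<longrightarrow> norm (h u 0) \<le> H * \<tau> ^ (w1 - w3)"
proof -
  have "hz = (\<Sum>i\<le>d. \<Sum>j\<le>d. \<Sum>k\<le>d. of_nat (Suc k) * F (i, j, Suc k) * u0 ^ j * 0 ^ k)"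
    unfolding hz_def eval_dz by simp
  then obtain a j k where "of_nat (Suc k) * F (a, j, Suc k) * u0 ^ j * 0 ^ k \<noteq> (0::complex)"
    using \<open>hz \<noteq> 0\<close> by (metis (no_types, lifting) sum.neutral)
  hence "F (a, 0, 1) \<noteq> 0" using \<open>u0 = 0\<close> by (cases j; cases k) auto
  hence a: "w1 * a + w3 = d" using monomial[of a 0 1] by simp
  define H where "H = (\<Sum>i\<le>d. \<Sum>j\<le>d. norm (F (i, j, 0)))"
  have "norm (h u 0) \<le> H * \<tau> ^ (w1 - w3)" if t: "0 \<le> \<tau>" "\<tau> \<le> 1" and u: "norm u \<le> \<tau> ^ (w1 - w2)" for \<tau> u
  proof -
    have trm: "norm (F (i, j, 0) * u ^ j) \<le> norm (F (i, j, 0)) * \<tau> ^ (w1 - w3)" for i j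
    proof (cases "F (i, j, 0) = 0")
      case False
      have ij: "w1 * i + w2 * j = w1 * a + w3" using monomial[OF False] a by simp
      \<comment> \<open>Multiplying \<open>a + 1 \<le> i + j\<close> by \<open>w1\<close> and
        cancelling \<open>w1 * a\<close> gives \<open>w1 \<le> w3 + (w1 - w2) * j\<close>.\<close>
      have le: "w1 - w3 \<le> (w1 - w2) * j"
      proof -
        have e: "w1 * (i + j) = w1 * a + (w3 + (w1 - w2) * j)"
          using ij \<open>w2 < w1\<close> by (simp add: distrib_left diff_mult_distrib) (use mult_le_mono1[of w2 w1 j] in linarith)
        hence "w1 * a < w1 * (i + j)" using w3_pos by simp
        hence "a + 1 \<le> i + j" by simp
        hence "w1 * (a + 1) \<le> w1 * (i + j)" by (rule mult_le_mono2)
        thus ?thesis using e by simp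
      qed
      have "norm u ^ j \<le> (\<tau> ^ (w1 - w2)) ^ j" using u by (intro power_mono) auto
      also have "\<dots> \<le> \<tau> ^ (w1 - w3)" using le t by (simp add: power_decreasing flip: power_mult)
      finally show ?thesis by (simp add: norm_mult norm_power mult_left_mono)
    qed simp
    have "h u 0 = (\<Sum>i\<le>d. \<Sum>j\<le>d. \<Sum>k\<le>d. if k = 0 then F (i, j, 0) * u ^ j else 0)"
      unfolding h_def eval_sum by (intro sum.cong refl) (auto simp: power_0_left)
    also have "\<dots> = (\<Sum>i\<le>d. \<Sum>j\<le>d. F (i, j, 0) * u ^ j)" by (simp add: sum.delta)
    finally have "norm (h u 0) \<le> (\<Sum>i\<le>d. \<Sum>j\<le>d. norm (F (i, j, 0)) * \<tau> ^ (w1 - w3))"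
      by (simp only:) (intro sum_norm_le trm)
    thus ?thesis by (simp add: H_def sum_distrib_right)
  qed
  moreover have "H \<ge> 0" by (auto simp: H_def intro!: sum_nonneg)
  ultimately show ?thesis by blast
qed

text \<open>As \<open>hz\<close> is nonzero, the slice is a graph over u, so the second coordinate
  is prescribed instead. By \<open>axis_value_small\<close> the root \<open>z\<close> is O(|t|^(w1 -
  w3)), which makes the third coordinate O(|t|^w1).\<close>

lemma fill_u_linear:
  assumes N: "open N" "(u0, 0) \<in> N" and u00: "u0 = 0" and hz: "hz \<noteq> 0" and w21: "w2 < w1"
  shows "fills N (\<lambda>x. fst (snd x))"
proof -
  obtain \<eta> where \<eta>: "\<eta> > 0" "\<And>u z. norm u < \<eta> \<Longrightarrow> norm z < \<eta> \<Longrightarrow> (u, z) \<in> N"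
    using prod_box_nhd[OF N] u00 by auto
  obtain \<delta> K0 where \<delta>: "\<delta> > 0" "K0 \<ge> 0" "\<And>u. norm u < \<delta> \<Longrightarrow> \<exists>z. h u z = 0 \<and> norm z \<le> K0 * norm (h u 0)"
    using linear_root_z[OF hz] u00 by auto
  obtain H where H: "H \<ge> 0" "\<And>\<tau> u. 0 \<le> \<tau> \<Longrightarrow> \<tau> \<le> 1 \<Longrightarrow> norm u \<le> \<tau> ^ (w1 - w2) \<Longrightarrow> norm (h u 0) \<le> H * \<tau> ^ (w1 - w3)"
    using axis_value_small[OF hz u00 w21] by blast
  define K where "K = K0 * H"
  have K: "K \<ge> 0" using \<delta> H by (simp add: K_def)
  show ?thesis
    unfolding fills_def
  proof (rule exI[of _ "K + 2"], rule conjI, simp add: K, rule exI[of _ "min 1 (min (min \<eta> \<delta>) (\<eta> / (K + 1)))"], intro conjI allI impI)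
    fix t y :: complex assume t: "t \<noteq> 0" "norm t < min 1 (min (min \<eta> \<delta>) (\<eta> / (K + 1)))" and y: "norm y \<le> norm t ^ w1"
    define u where "u = y / t ^ w2"
    have u: "norm u \<le> norm t ^ (w1 - w2)" "norm u \<le> norm t"
      unfolding u_def by (rule scaled_small; use t y w21 in auto)+
    obtain z where z: "h u z = 0" "norm z \<le> K0 * norm (h u 0)" using \<delta>(3)[of u] u t by auto
    have "K0 * norm (h u 0) \<le> K0 * (H * norm t ^ (w1 - w3))"
      using u t \<delta>(2) by (intro mult_left_mono H(2)) auto
    hence z2: "norm z \<le> K * norm t ^ (w1 - w3)" using z(2) by (simp add: K_def mult.assoc)
    have "norm t ^ (w1 - w3) \<le> norm t ^ 1" using t w31 by (intro power_decreasing) auto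
    hence "K * norm t ^ (w1 - w3) \<le> K * norm t" using K by (intro mult_left_mono) auto
    hence "norm z \<le> (K + 1) * norm t" using z2 by (simp add: distrib_right) (smt (verit) norm_ge_zero)
    moreover have "(K + 1) * norm t < \<eta>" using t K by (simp add: field_simps)
    ultimately have "(u, z) \<in> N" using u t by (intro \<eta>(2)) auto
    have "norm t ^ w3 * norm z \<le> norm t ^ w3 * (K * norm t ^ (w1 - w3))"
      using z2 by (intro mult_left_mono) auto
    also have "\<dots> = K * norm t ^ w1" using w31 by (simp add: mult_ac flip: power_add)
    finally have "norm t ^ w3 * norm z \<le> K * norm t ^ w1" .
    moreover have "norm t ^ w2 * norm u = norm y" using t by (simp add: u_def norm_divide norm_power)
    ultimately have "norm (act t (1, u, z)) \<le> (K + 2) * norm t ^ w1"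
      using norm_act_1_le[of t u z] y by (simp add: algebra_simps)
    thus "\<exists>u z. (u, z) \<in> N \<and> h u z = 0 \<and> norm (act t (1, u, z)) \<le> (K + 2) * norm t ^ w1 \<and> fst (snd (act t (1, u, z))) = y"
      using z t \<open>(u, z) \<in> N\<close> by (intro exI[of _ u] exI[of _ z]) (auto simp: u_def)
  qed (use \<eta> \<delta> K in auto)
qed

text \<open>The filled region, where |y| is at most |x|, contains a ball of radius comparable to
  \<open>\<epsilon>\<close>. Its points lift to norm at most \<open>\<epsilon>\<close>, since
  lifting costs only the factor \<open>K\<close>.\<close>

lemma ball_to_density:
  fixes \<pi> :: "complex \<times> complex \<times> complex \<Rightarrow> complex \<times> complex"
  assumes \<pi>: "\<And>x y. dist (\<pi> x) (\<pi> y) \<le> dist x y" and K: "K \<ge> 1" and e: "e > 0" "e \<le> t0"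
    and fill: "\<And>t y. t \<noteq> 0 \<Longrightarrow> norm t < e \<Longrightarrow> norm y \<le> norm t ^ w1 \<Longrightarrow>
      \<exists>g\<in>G. norm (act t g) \<le> K * norm t ^ w1 \<and> \<pi> (act t g) = (t ^ w1, y)"
  shows "lower_density 4 (\<Union>t\<in>{t. t \<noteq> 0 \<and> norm t \<le> t0}. act t ` G) 0 > 0"
proof -
  let ?S = "\<Union>t\<in>{t. t \<noteq> 0 \<and> norm t \<le> t0}. act t ` G"
  have "lower_density DIM(complex \<times> complex) ?S 0 > 0"
  proof (rule lower_density_pos[where \<kappa>="1 / (8 * K)" and ?\<epsilon>0.0="e ^ w1" and g=\<pi>])
    show "1 / (8 * K) > 0" "e ^ w1 > 0" using K e by auto
    fix \<epsilon> assume \<epsilon>: "0 < \<epsilon>" "\<epsilon> < e ^ w1"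
    \<comment> \<open>With \<open>D = \<epsilon> / (8 * K)\<close> the ball has radius
      \<open>D\<close> and its centre has norm \<open>4 * D\<close>. On it |x| lies between
      \<open>3 * D\<close> and \<open>5 * D\<close> and |y| is below \<open>D\<close>, hence |y| <
      |x| and \<open>K\<close> times |x| is below \<open>\<epsilon>\<close>.\<close>
    define c where "c = (complex_of_real (\<epsilon> / (2 * K)), 0 :: complex)"
    have "ball c (1 / (8 * K) * \<epsilon>) \<subseteq> \<pi> ` (?S \<inter> cball 0 \<epsilon>)"
    proof
      fix x assume x: "x \<in> ball c (1 / (8 * K) * \<epsilon>)"
      define b y where "b = fst x" and "y = snd x"
      define D where "D = \<epsilon> / (8 * K)"
      have D: "D > 0" "8 * D \<le> \<epsilon>" "K * (8 * D) = \<epsilon>" using K \<epsilon> by (auto simp: D_def field_simps)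
      have "dist x c < D" using x by (simp add: D_def dist_commute)
      hence d: "dist b (fst c) < D" "dist y (snd c) < D"
        using dist_fst_le[of x c] dist_snd_le[of x c] unfolding b_def y_def by linarith+
      have fc: "norm (fst c) = 4 * D" using K \<epsilon> by (simp add: c_def D_def norm_divide norm_mult)
      have b: "3 * D < norm b" "norm b < 5 * D"
        using d(1) fc norm_triangle_ineq3[of b "fst c"] unfolding dist_norm by linarith+
      have yb: "norm y \<le> norm b" using d(2) b(1) D by (simp add: c_def)
      obtain t where t: "t ^ w1 = b" "norm t ^ w1 = norm b" using complex_nth_root_exists[OF w1_pos] by blast
      have t0: "t \<noteq> 0" using t b D w1_pos by (auto simp: zero_power)
      have "norm t ^ w1 < e ^ w1" using t(2) b D \<epsilon> by linarith
      hence te: "norm t < e" using e(1) by (intro power_less_imp_less_base[of "norm t" w1 e]) auto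
      have "norm y \<le> norm t ^ w1" using yb t(2) by simp
      from fill[OF t0 te this] obtain g where g: "g \<in> G" "norm (act t g) \<le> K * norm t ^ w1" "\<pi> (act t g) = (t ^ w1, y)"
        by blast
      have "K * norm b \<le> K * (8 * D)" using K b D by (intro mult_left_mono) auto
      hence "norm (act t g) \<le> \<epsilon>" using g(2) t(2) D(3) by simp
      hence "act t g \<in> ?S \<inter> cball 0 \<epsilon>" using g(1) t0 te e by auto
      moreover have "x = \<pi> (act t g)" using g(3) t by (simp add: b_def y_def)
      ultimately show "x \<in> \<pi> ` (?S \<inter> cball 0 \<epsilon>)" by blast
    qed
    thus "\<exists>c. ball c (1 / (8 * K) * \<epsilon>) \<subseteq> \<pi> ` (?S \<inter> cball 0 \<epsilon>)" by blast
  qed (rule \<pi>)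
  thus ?thesis by simp
qed

lemma fills_density:
  assumes "fills N \<pi>" "t0 > 0" and GN: "\<And>u z. (u, z) \<in> N \<Longrightarrow> h u z = 0 \<Longrightarrow> (1, u, z) \<in> G"
    and \<pi>: "\<And>x y. dist (fst x, \<pi> x) (fst y, \<pi> y) \<le> dist x y"
  shows "lower_density 4 (\<Union>t\<in>{t. t \<noteq> 0 \<and> norm t \<le> t0}. act t ` G) 0 > 0"
proof -
  obtain K e where K: "K \<ge> 1" "e > 0" and *: "\<And>t y. t \<noteq> 0 \<Longrightarrow> norm t < e \<Longrightarrow> norm y \<le> norm t ^ w1 \<Longrightarrow>
      \<exists>u z. (u, z) \<in> N \<and> h u z = 0 \<and> norm (act t (1, u, z)) \<le> K * norm t ^ w1 \<and> \<pi> (act t (1, u, z)) = y"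
    using assms(1) unfolding fills_def by blast
  show ?thesis
  proof (rule ball_to_density[where \<pi>="\<lambda>x. (fst x, \<pi> x)" and K=K and e="min e t0"])
    fix t y :: complex assume a: "t \<noteq> 0" "norm t < min e t0" "norm y \<le> norm t ^ w1"
    then obtain u z where "(u, z) \<in> N" "h u z = 0" "norm (act t (1, u, z)) \<le> K * norm t ^ w1" "\<pi> (act t (1, u, z)) = y"
      using *[of t y] by auto
    thus "\<exists>g\<in>G. norm (act t g) \<le> K * norm t ^ w1 \<and> (fst (act t g), \<pi> (act t g)) = (t ^ w1, y)"
      using GN by (intro bexI[of _ "(1, u, z)"]) auto
  qed (use K \<open>t0 > 0\<close> \<pi> in auto)
qed

text \<open>For \<open>w2 < w1\<close> and \<open>u0\<close> nonzero the second coordinate dominates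
  along the orbit and no bound \<open>K * norm t ^ w1\<close> can hold. Such orbits are treated
  after the exchange of x and y.\<close>

lemma thick_at_base:
  assumes cond: "w1 \<le> w2 \<or> u0 = 0"
  shows "thick_at (1, u0, 0)"
  unfolding thick_at_def
proof (intro allI impI)
  fix V :: "(complex \<times> complex \<times> complex) set" and t0 :: real assume V: "open V" "(1, u0, 0) \<in> V" and t0: "t0 > 0"
  obtain \<gamma>1 \<gamma>2 \<rho> L where c: "\<rho> > 0" "L-lipschitz_on (cball 0 \<rho>) \<gamma>1" "L-lipschitz_on (cball 0 \<rho>) \<gamma>2"
     "\<gamma>1 0 = u0" "\<gamma>2 0 = 0" "\<forall>s\<in>cball 0 \<rho>. h (\<gamma>1 s) (\<gamma>2 s) = 0 \<and> (\<gamma>2 s = 0 \<longrightarrow> s = 0)"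
     and N: "\<forall>r. 0 < r \<and> r \<le> \<rho> \<longrightarrow> (\<exists>N. open N \<and> (u0, 0) \<in> N \<and>
        {x \<in> N. h (fst x) (snd x) = 0} = (\<lambda>s. (\<gamma>1 s, \<gamma>2 s)) ` ball (0::complex) r)"
    using local_curve by (elim exE conjE) (rule that; assumption)
  define \<gamma> where "\<gamma> s = (1 :: complex, \<gamma>1 s, \<gamma>2 s)" for s
  have cont: "continuous_on (cball 0 \<rho>) \<gamma>" unfolding \<gamma>_def
    by (intro continuous_intros lipschitz_on_continuous_on[OF c(2)] lipschitz_on_continuous_on[OF c(3)])
  have \<gamma>0: "\<gamma> 0 = (1, u0, 0)" using c by (simp add: \<gamma>_def)
  obtain \<epsilon> where \<epsilon>: "\<epsilon> > 0" "ball (1, u0, 0) \<epsilon> \<subseteq> V" using V open_contains_ball by blast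
  obtain r0 where r0: "r0 > 0" "\<And>s. s \<in> cball 0 \<rho> \<Longrightarrow> dist s 0 < r0 \<Longrightarrow> dist (\<gamma> s) (\<gamma> 0) < \<epsilon>"
    using cont \<epsilon>(1) c(1) unfolding continuous_on_iff by (metis centre_in_cball less_imp_le)
  define r where "r = min r0 \<rho>"
  have r: "0 < r" "r \<le> \<rho>" "r \<le> r0" using r0 c by (auto simp: r_def)
  obtain N where N: "open N" "(u0, 0) \<in> N" "{x \<in> N. h (fst x) (snd x) = 0} = (\<lambda>s. (\<gamma>1 s, \<gamma>2 s)) ` ball 0 r"
    using N r(1,2) by (elim allE[of _ r]) blast
  define G where "G = \<gamma> ` ball 0 r"
  have GN: "(1, u, z) \<in> G" if "(u, z) \<in> N" "h u z = 0" for u z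
  proof -
    have "(u, z) \<in> {x \<in> N. h (fst x) (snd x) = 0}" using that by simp
    hence "(u, z) \<in> (\<lambda>s. (\<gamma>1 s, \<gamma>2 s)) ` ball 0 r" unfolding N(3) .
    thus ?thesis by (auto simp: G_def \<gamma>_def)
  qed
  have "G \<subseteq> zero_set3 F \<inter> V"
  proof
    fix x assume "x \<in> G"
    then obtain s where s: "x = \<gamma> s" "norm s < r" by (auto simp: G_def)
    have "dist (\<gamma> s) (\<gamma> 0) < \<epsilon>" using s r by (intro r0(2)) auto
    hence "x \<in> V" using \<epsilon>(2) s(1) \<gamma>0 by (auto simp: dist_commute)
    moreover have "h (\<gamma>1 s) (\<gamma>2 s) = 0" using s r c(6) by auto
    ultimately show "x \<in> zero_set3 F \<inter> V" by (simp add: s \<gamma>_def zero_set3_def h_def)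
  qed
  moreover have "connected G" unfolding G_def
    using r by (intro connected_continuous_image continuous_on_subset[OF cont]) auto
  moreover have "(1, u0, 0) \<in> G" unfolding G_def using \<gamma>0 r by (metis centre_in_ball imageI)
  moreover have "lower_density 4 (\<Union>t\<in>{t. t \<noteq> 0 \<and> norm t \<le> t0}. act t ` G) 0 > 0"
  proof -
    have "fills N (\<lambda>x. snd (snd x)) \<or> fills N (\<lambda>x. fst (snd x))"
    proof (cases "w1 \<le> w2")
      case True
      show ?thesis by (rule disjI1, rule fill_z[OF N(1,2) True])
    next
      case False
      hence u00: "u0 = 0" and w21: "w2 < w1" using cond by auto
      show ?thesis
      proof (cases "hu = 0")
        case True
        hence "hz \<noteq> 0" using gradient_nonzero by blast
        show ?thesis by (rule disjI2, rule fill_u_linear[OF N(1,2) u00 \<open>hz \<noteq> 0\<close> w21])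
      next
        case False
        show ?thesis by (rule disjI1, rule fill_z_linear[OF N(1,2) u00 False])
      qed
    qed
    thus ?thesis
    proof
      assume "fills N (\<lambda>x. snd (snd x))"
      thus ?thesis using t0 GN dist_forget(1) by (intro fills_density) auto
    next
      assume "fills N (\<lambda>x. fst (snd x))"
      thus ?thesis using t0 GN dist_forget(2) by (intro fills_density) auto
    qed
  qed
  ultimately show "\<exists>G. G \<subseteq> zero_set3 F \<inter> V \<and> connected G \<and> (1, u0, 0) \<in> G \<and>
      lower_density 4 (\<Union>t\<in>{t. t \<noteq> 0 \<and> norm t \<le> t0}. act t ` G) 0 > 0" by blast
qed

text \<open>The first coordinate of \<open>act t k\<close> is \<open>t ^ w1\<close>, so a bounded
  part of the set involves bounded \<open>t\<close> only and comes from a compact set. Allowing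
  \<open>t = 0\<close> supplies the limit point at the origin.\<close>

lemma closed_act_image:
  assumes K: "compact K" and K1: "\<And>k. k \<in> K \<Longrightarrow> fst k = 1"
  shows "closed {act t k |t k. k \<in> K}"
proof -
  let ?A = "{act t k |t k. k \<in> K}"
  have c: "closed (?A \<inter> cball 0 R)" for R
  proof -
    let ?B = "(\<lambda>x. act (fst x) (snd x)) ` (cball 0 (max 1 R) \<times> K)"
    have "?A \<inter> cball 0 R = ?B \<inter> cball 0 R"
    proof (intro set_eqI iffI)
      fix x assume "x \<in> ?A \<inter> cball 0 R"
      then obtain t k where x: "x = act t k" "k \<in> K" "norm x \<le> R" by auto
      have "norm t ^ w1 = norm (fst x)" using K1[OF x(2)] x(1) by (simp add: act_def norm_power)
      also have "\<dots> \<le> R" using x(3) norm_fst_le[of "fst x" "snd x"] by simp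
      finally have tR: "norm t ^ w1 \<le> R" .
      have "norm t \<le> max 1 R"
      proof (cases "norm t \<le> 1")
        case False
        hence "norm t ^ 1 \<le> norm t ^ w1" using w1_pos by (intro power_increasing) auto
        thus ?thesis using tR by simp
      qed simp
      hence "x \<in> ?B" using x by (intro image_eqI[of _ _ "(t, k)"]) auto
      thus "x \<in> ?B \<inter> cball 0 R" using x by simp
    next
      fix x assume "x \<in> ?B \<inter> cball 0 R"
      then obtain y where "x = act (fst y) (snd y)" "snd y \<in> K" "x \<in> cball 0 R" by auto
      thus "x \<in> ?A \<inter> cball 0 R" by blast
    qed
    moreover have "compact ?B"
      by (intro compact_continuous_image compact_Times compact_cball K continuous_intros)
    ultimately show ?thesis by (simp add: closed_Int compact_imp_closed)
  qed
  show ?thesis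
    unfolding closed_sequential_limits
  proof (intro allI impI, elim conjE)
    fix x l assume x: "\<forall>n. x n \<in> ?A" "x \<longlonglongrightarrow> l"
    have "Bseq x" using x(2) convergent_imp_Bseq convergent_def by blast
    then obtain R where "\<And>n. norm (x n) \<le> R" unfolding Bseq_def by blast
    hence "\<forall>n. x n \<in> ?A \<inter> cball 0 R" using x(1) by simp
    hence "l \<in> ?A \<inter> cball 0 R" using c[of R] x(2) unfolding closed_sequential_limits by blast
    thus "l \<in> ?A" by blast
  qed
qed

text \<open>Near a given point the \<open>w1\<close>-th root of the first coordinate has a
  continuous branch passing through the \<open>t\<close> at hand, and normalising with this branch
  is continuous.\<close>

lemma open_act_saturation:
  fixes N :: "(complex \<times> complex) set"
  assumes "open N"
  shows "open {(b, u, z). \<exists>t. t \<noteq> 0 \<and> t ^ w1 = b \<and> (u / t ^ w2, z / t ^ w3) \<in> N}" (is "open ?\<Omega>")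
  unfolding open_contains_ball
proof
  fix x assume "x \<in> ?\<Omega>"
  then obtain b u z t where x: "x = (b, u, z)" and t: "t \<noteq> 0" "t ^ w1 = b" "(u / t ^ w2, z / t ^ w3) \<in> N" by auto
  have b0: "b \<noteq> 0" using t by auto
  define T where "T y = t * exp (Ln (fst y / b) / of_nat w1)" for y :: "complex \<times> complex \<times> complex"
  define S where "S = {y :: complex \<times> complex \<times> complex. fst y / b \<in> - \<real>\<^sub>\<le>\<^sub>0}"
  have oS: "open S"
  proof -
    have "open ((\<lambda>y :: complex \<times> complex \<times> complex. fst y / b) -` (- \<real>\<^sub>\<le>\<^sub>0))"
      by (intro open_vimage continuous_intros) (use b0 in \<open>auto simp: open_Compl\<close>)
    thus ?thesis by (simp add: S_def vimage_def)
  qed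
  have cT: "continuous_on S T" unfolding T_def S_def
    by (intro continuous_intros) (use b0 w1_pos in auto)
  have T0: "T y \<noteq> 0" for y using t by (simp add: T_def)
  have Tw: "T y ^ w1 = fst y" if "y \<in> S" for y
  proof -
    have "fst y / b \<noteq> 0" using that by (auto simp: S_def)
    hence "exp (Ln (fst y / b) / of_nat w1) ^ w1 = fst y / b" using w1_pos by (simp flip: exp_of_nat_mult)
    thus ?thesis using t b0 by (simp add: T_def power_mult_distrib)
  qed
  define g where "g y = (fst (snd y) / T y ^ w2, snd (snd y) / T y ^ w3)" for y
  have cg: "continuous_on S g" unfolding g_def by (intro continuous_intros cT) (use T0 in auto)
  have "open (S \<inter> g -` N)" by (rule continuous_open_preimage[OF cg oS assms])
  moreover have "x \<in> S \<inter> g -` N"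
    using b0 t(3) by (simp add: S_def g_def T_def x)
  ultimately obtain e where e: "e > 0" "ball x e \<subseteq> S \<inter> g -` N" using open_contains_ball by blast
  have "S \<inter> g -` N \<subseteq> ?\<Omega>"
  proof
    fix y assume y: "y \<in> S \<inter> g -` N"
    obtain b' u' z' where yy: "y = (b', u', z')" by (cases y)
    show "y \<in> ?\<Omega>" using y T0[of y] Tw[of y] by (auto simp: yy g_def)
  qed
  thus "\<exists>e>0. ball x e \<subseteq> ?\<Omega>" using e by blast
qed

lemma separable_at_base: "separable_at (1, u0, 0)"
proof -
  obtain \<gamma>1 \<gamma>2 \<rho> L where c: "\<rho> > 0" "L-lipschitz_on (cball 0 \<rho>) \<gamma>1" "L-lipschitz_on (cball 0 \<rho>) \<gamma>2"
     "\<gamma>1 0 = u0" "\<gamma>2 0 = 0" "\<forall>s\<in>cball 0 \<rho>. h (\<gamma>1 s) (\<gamma>2 s) = 0 \<and> (\<gamma>2 s = 0 \<longrightarrow> s = 0)"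
     and N: "\<forall>r. 0 < r \<and> r \<le> \<rho> \<longrightarrow> (\<exists>N. open N \<and> (u0, 0) \<in> N \<and>
        {x \<in> N. h (fst x) (snd x) = 0} = (\<lambda>s. (\<gamma>1 s, \<gamma>2 s)) ` ball (0::complex) r)"
    using local_curve by (elim exE conjE) (rule that; assumption)
  have L0: "L \<ge> 0" using c(2) by (rule lipschitz_on_nonneg)
  obtain N where N: "open N" "(u0, 0) \<in> N" "{x \<in> N. h (fst x) (snd x) = 0} = (\<lambda>s. (\<gamma>1 s, \<gamma>2 s)) ` ball 0 \<rho>"
    using N c(1) by (elim allE[of _ \<rho>]) blast
  define \<gamma> where "\<gamma> s = (1 :: complex, \<gamma>1 s, \<gamma>2 s)" for s
  have cont: "continuous_on (cball 0 \<rho>) \<gamma>" unfolding \<gamma>_def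
    by (intro continuous_intros lipschitz_on_continuous_on[OF c(2)] lipschitz_on_continuous_on[OF c(3)])
  have \<gamma>0: "\<gamma> 0 = (1, u0, 0)" using c by (simp add: \<gamma>_def)
  have \<gamma>X: "\<gamma> s \<in> zero_set3 F" if "s \<in> cball 0 \<rho>" for s
    using c(6) that by (simp add: \<gamma>_def zero_set3_def h_def)
  \<comment> \<open>\<open>W\<close> excludes \<open>t = 0\<close>, as befits the trace of the open
    set \<open>\<Omega>\<close>. \<open>Y\<close> admits it, which puts the origin into
    \<open>Y\<close> and makes \<open>Y\<close> closed.\<close>
  define W where "W = {act t (\<gamma> s) |t s. t \<noteq> 0 \<and> s \<in> ball 0 \<rho>}"
  define Y where "Y = {act t (\<gamma> s) |t s. s \<in> sphere 0 \<rho>}"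
  define \<Omega> where "\<Omega> = {(b, u, z). \<exists>t. t \<noteq> 0 \<and> t ^ w1 = b \<and> (u / t ^ w2, z / t ^ w3) \<in> N}"
  have WX: "W = zero_set3 F \<inter> \<Omega>"
  proof (intro set_eqI iffI)
    fix x assume "x \<in> W"
    then obtain t s where x: "x = act t (\<gamma> s)" "t \<noteq> 0" "s \<in> ball 0 \<rho>" by (auto simp: W_def)
    have "(\<gamma>1 s, \<gamma>2 s) \<in> N" using N(3) x(3) by blast
    hence "x \<in> \<Omega>" using x by (auto simp: \<Omega>_def \<gamma>_def intro!: exI[of _ t])
    moreover have "x \<in> zero_set3 F" unfolding x(1) by (intro zero_set_act \<gamma>X) (use x in auto)
    ultimately show "x \<in> zero_set3 F \<inter> \<Omega>" by blast
  next
    fix x assume x: "x \<in> zero_set3 F \<inter> \<Omega>"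
    obtain b u z where xx: "x = (b, u, z)" by (cases x)
    obtain t where t: "t \<noteq> 0" "t ^ w1 = b" "(u / t ^ w2, z / t ^ w3) \<in> N" using x by (auto simp: xx \<Omega>_def)
    have e: "x = act t (1, u / t ^ w2, z / t ^ w3)" using t by (simp add: xx)
    hence "t ^ d * h (u / t ^ w2) (z / t ^ w3) = 0"
      using x unfolding h_def eval_act[symmetric] by (simp add: zero_set3_def)
    hence "(u / t ^ w2, z / t ^ w3) \<in> {x \<in> N. h (fst x) (snd x) = 0}" using t by simp
    then obtain s where "s \<in> ball 0 \<rho>" "(u / t ^ w2, z / t ^ w3) = (\<gamma>1 s, \<gamma>2 s)" unfolding N(3) by blast
    thus "x \<in> W" using e t by (auto simp: W_def \<gamma>_def)
  qed
  have inv_W: "act t p \<in> W" if "t \<noteq> 0" "p \<in> W" for t p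
    using that unfolding W_def by (force simp: act_act)
  have inv_Y: "act t p \<in> Y" if "p \<in> Y" for t p
    using that unfolding Y_def by (force simp: act_act)
  have inv: "act t p \<in> W \<longleftrightarrow> p \<in> W" "act t p \<in> Y \<longleftrightarrow> p \<in> Y" if "t \<noteq> 0" for t p
  proof -
    have e: "act (inverse t) (act t p) = p" using that by (simp add: act_act)
    show "act t p \<in> W \<longleftrightarrow> p \<in> W" using inv_W[of "inverse t" "act t p"] inv_W[of t p] that e by auto
    show "act t p \<in> Y \<longleftrightarrow> p \<in> Y" using inv_Y[of "act t p" "inverse t"] inv_Y[of p t] e by auto
  qed
  have sph: "complex_of_real \<rho> \<in> sphere 0 \<rho>" using c(1) by simp
  have Y0: "0 \<in> Y"
  proof -
    have "act 0 (\<gamma> (of_real \<rho>)) = 0" using w1_pos w2_pos w3_pos by (simp add: act_def zero_prod_def zero_power)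
    thus ?thesis using sph unfolding Y_def by force
  qed
  have YX: "Y \<subseteq> zero_set3 F"
  proof
    fix x assume "x \<in> Y"
    then obtain t s where "x = act t (\<gamma> s)" "s \<in> cball 0 \<rho>" by (auto simp: Y_def)
    thus "x \<in> zero_set3 F" by (simp only: zero_set_act \<gamma>X)
  qed
  have WY: "W \<union> Y = {act t k |t k. k \<in> \<gamma> ` cball 0 \<rho>}"
  proof (intro set_eqI iffI)
    fix x assume "x \<in> W \<union> Y"
    then obtain t s where "x = act t (\<gamma> s)" "s \<in> cball 0 \<rho>" by (auto simp: W_def Y_def)
    thus "x \<in> {act t k |t k. k \<in> \<gamma> ` cball 0 \<rho>}" by blast
  next
    fix x assume "x \<in> {act t k |t k. k \<in> \<gamma> ` cball 0 \<rho>}"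
    then obtain t s where x: "x = act t (\<gamma> s)" "s \<in> cball 0 \<rho>" by blast
    hence "norm s \<le> \<rho>" by simp
    then consider "t = 0" | "t \<noteq> 0" "norm s < \<rho>" | "norm s = \<rho>" by linarith
    thus "x \<in> W \<union> Y"
    proof cases
      case 1
      hence "x = 0" using w1_pos w2_pos w3_pos by (simp add: x act_def zero_prod_def zero_power)
      thus ?thesis using Y0 by simp
    next
      case 2
      thus ?thesis unfolding W_def using x by auto
    next
      case 3
      thus ?thesis unfolding Y_def using x by auto
    qed
  qed
  have clWY: "closed (W \<union> Y)" unfolding WY
    by (rule closed_act_image) (use compact_continuous_image[OF cont] in \<open>auto simp: \<gamma>_def\<close>)
  have "Y = {act t k |t k. k \<in> \<gamma> ` sphere 0 \<rho>}" unfolding Y_def by blast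
  also have "closed \<dots>"
    by (rule closed_act_image)
       (use compact_continuous_image[OF continuous_on_subset[OF cont sphere_cball]] in \<open>auto simp: \<gamma>_def\<close>)
  finally have clY: "closed Y" .
  \<comment> \<open>The disc meets z = 0 only at its centre, so \<open>norm (\<gamma>2 s)\<close>
    has a positive minimum on the boundary circle; it becomes the constant \<open>m\<close> of the
    cone.\<close>
  have sph_cpt: "compact (sphere (0::complex) \<rho>)" "sphere (0::complex) \<rho> \<noteq> {}" using sph by auto
  have "continuous_on (sphere 0 \<rho>) (\<lambda>s. norm (\<gamma>2 s))"
    by (intro continuous_on_norm continuous_on_subset[OF lipschitz_on_continuous_on[OF c(3)]]) auto
  from continuous_attains_inf[OF sph_cpt this]
  obtain s0 where s0: "s0 \<in> sphere 0 \<rho>" "\<forall>s\<in>sphere 0 \<rho>. norm (\<gamma>2 s0) \<le> norm (\<gamma>2 s)" by blast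
  have m0: "norm (\<gamma>2 s0) > 0"
  proof -
    have "s0 \<noteq> 0" "s0 \<in> cball 0 \<rho>" using s0(1) c(1) by auto
    thus ?thesis using c(6) by auto
  qed
  define q1 q2 where "q1 \<theta> = \<gamma>1 (of_real \<rho> * cis \<theta>)" and "q2 \<theta> = \<gamma>2 (of_real \<rho> * cis \<theta>)" for \<theta>
  have cs: "of_real \<rho> * cis \<theta> \<in> sphere 0 \<rho>" "of_real \<rho> * cis \<theta> \<in> cball 0 \<rho>" for \<theta>
    using c(1) by (auto simp: norm_mult)
  define M where "M = norm u0 + L * \<rho> + 1"
  have bd: "norm (g s) \<le> M" if "L-lipschitz_on (cball 0 \<rho>) g" "norm (g 0) \<le> norm u0" "s \<in> cball 0 \<rho>"
    for g :: "complex \<Rightarrow> complex" and s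
  proof -
    have "norm (g s - g 0) \<le> L * norm (s - 0)"
      using lipschitz_onD[OF that(1) that(3), of 0] c(1) by (simp add: dist_norm)
    also have "\<dots> \<le> L * \<rho>" using that(3) L0 by (intro mult_left_mono) auto
    finally show ?thesis using that(2) norm_triangle_ineq2[of "g s" "g 0"] by (simp add: M_def)
  qed
  have lipc: "norm (g (of_real \<rho> * cis x) - g (of_real \<rho> * cis y)) \<le> (L * \<rho>) * \<bar>x - y\<bar>"
    if "L-lipschitz_on (cball 0 \<rho>) g" for g :: "complex \<Rightarrow> complex" and x y
  proof -
    have "norm (g (of_real \<rho> * cis x) - g (of_real \<rho> * cis y)) \<le> L * dist (of_real \<rho> * cis x) (of_real \<rho> * cis y)"
      unfolding dist_norm[of "g _", symmetric] by (rule lipschitz_onD[OF that cs(2) cs(2)])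
    also have "dist (of_real \<rho> * cis x) (of_real \<rho> * cis y) = \<rho> * norm (cis x - cis y)"
      using c(1) by (simp add: dist_norm norm_mult flip: right_diff_distrib)
    also have "L * (\<rho> * norm (cis x - cis y)) \<le> L * (\<rho> * \<bar>x - y\<bar>)"
      using L0 c(1) norm_cis_diff_le by (intro mult_left_mono) auto
    finally show ?thesis by (simp add: mult.assoc)
  qed
  interpret C: cone w1 w2 w3 q1 q2 "L * \<rho>" M "norm (\<gamma>2 s0)"
  proof
    show "w3 > 0" "w3 < w1" "w3 < w2" using w3_pos w31 w32 by auto
    show "norm (q1 x - q1 y) \<le> L * \<rho> * \<bar>x - y\<bar>" for x y unfolding q1_def by (rule lipc[OF c(2)])
    show "norm (q2 x - q2 y) \<le> L * \<rho> * \<bar>x - y\<bar>" for x y unfolding q2_def by (rule lipc[OF c(3)])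
    show "norm (q1 x) \<le> M" for x unfolding q1_def using c cs by (intro bd[OF c(2)]) auto
    show "norm (q2 x) \<le> M" for x unfolding q2_def using c cs by (intro bd[OF c(3)]) auto
    show "1 \<le> M" "0 \<le> L * \<rho>" using L0 c(1) by (auto simp: M_def)
    show "norm (\<gamma>2 s0) \<le> norm (q2 x)" for x unfolding q2_def using s0(2) cs by blast
  qed (rule m0)
  \<comment> \<open>The interval \<open>{0..8}\<close> contains a full turn because
    \<open>2 * pi < 8\<close>; covering part of the circle twice is harmless.\<close>
  have Yimg: "Y = cone_map w1 w2 w3 q1 q2 ` (UNIV \<times> {0..8})"
  proof (intro set_eqI iffI)
    fix x assume "x \<in> Y"
    then obtain t s where x: "x = act t (\<gamma> s)" "norm s = \<rho>" by (auto simp: Y_def)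
    have s: "s = of_real \<rho> * cis (Arg2pi s)" using Arg2pi_eq[of s] x(2) by (simp add: cis_conv_exp)
    have "Arg2pi s \<in> {0..8}" using Arg2pi_ge_0[of s] Arg2pi_lt_2pi[of s] pi_less_4 by simp
    moreover have "x = cone_map w1 w2 w3 q1 q2 (t, Arg2pi s)"
      using s by (simp add: x(1) cone_map_def \<gamma>_def q1_def q2_def)
    ultimately show "x \<in> cone_map w1 w2 w3 q1 q2 ` (UNIV \<times> {0..8})" by blast
  next
    fix x assume "x \<in> cone_map w1 w2 w3 q1 q2 ` (UNIV \<times> {0..8})"
    then obtain t \<theta> where "x = cone_map w1 w2 w3 q1 q2 (t, \<theta>)" by auto
    hence "x = act t (\<gamma> (of_real \<rho> * cis \<theta>))" by (simp add: cone_map_def \<gamma>_def q1_def q2_def)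
    thus "x \<in> Y" using cs unfolding Y_def by blast
  qed
  have baseW: "(1, u0, 0) \<in> W" unfolding W_def \<gamma>0[symmetric] using c(1)
    by (intro CollectI exI[of _ 1] exI[of _ 0]) auto
  have axW: "\<forall>p\<in>W. snd (snd p) = 0 \<longrightarrow> (\<exists>t. t \<noteq> 0 \<and> p = act t (1, u0, 0))"
  proof (intro ballI impI)
    fix p assume p: "p \<in> W" "snd (snd p) = 0"
    then obtain t s where x: "p = act t (\<gamma> s)" "t \<noteq> 0" "norm s < \<rho>" by (auto simp: W_def)
    hence "\<gamma>2 s = 0" using p(2) by (simp add: \<gamma>_def)
    hence "s = 0" using c(6) x(3) by simp
    thus "\<exists>t. t \<noteq> 0 \<and> p = act t (1, u0, 0)" using x \<gamma>0 by auto
  qed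
  have axY: "\<forall>p\<in>Y. snd (snd p) = 0 \<longrightarrow> p = 0"
  proof (intro ballI impI)
    fix p assume p: "p \<in> Y" "snd (snd p) = 0"
    then obtain t s where x: "p = act t (\<gamma> s)" "norm s = \<rho>" by (auto simp: Y_def)
    have "\<gamma>2 s \<noteq> 0" using c(6) x(2) c(1) by (metis mem_cball_0 norm_zero order_refl less_irrefl)
    hence "t = 0" using p(2) x(1) by (simp add: \<gamma>_def)
    thus "p = 0" using w1_pos w2_pos w3_pos by (simp add: x(1) act_def zero_prod_def zero_power)
  qed
  have rect: "countably_rectifiable 3 Y" "upper_density 3 Y 0 = 0"
    unfolding Yimg by (rule C.cone_rectifiable, rule C.cone_upper_density)
  have op: "open \<Omega>" unfolding \<Omega>_def by (rule open_act_saturation[OF N(1)])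
  show ?thesis
    unfolding separable_at_def
    by (rule exI[of _ W], rule exI[of _ Y], rule exI[of _ \<Omega>], intro conjI allI impI)
       (rule YX Y0 rect op WX clY clWY baseW inv axW axY; assumption)+
qed

end

section \<open>Exchanging the first two coordinates\<close>

definition swap_xy :: "complex \<times> complex \<times> complex \<Rightarrow> complex \<times> complex \<times> complex" where
  "swap_xy p = (fst (snd p), fst p, snd (snd p))"

lemma swap_xy_simp [simp]: "swap_xy (x, y, z) = (y, x, z)"
  by (simp add: swap_xy_def)

lemma swap_xy_swap_xy [simp]: "swap_xy (swap_xy p) = p"
  by (simp add: swap_xy_def)

lemma dist_swap_xy [simp]: "dist (swap_xy p) (swap_xy q) = dist p q"
proof -
  obtain x y z x' y' z' where "p = (x, y, z)" "q = (x', y', z')" by (metis prod.collapse)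
  thus ?thesis by (simp add: dist_Pair_Pair add_ac)
qed

lemma swap_xy_0 [simp]: "swap_xy 0 = 0"
  by (simp add: swap_xy_def zero_prod_def)

lemma norm_swap_xy [simp]: "norm (swap_xy p) = norm p"
  using dist_swap_xy[of p 0] by (simp add: dist_norm)

lemma image_swap_xy: "swap_xy ` S = swap_xy -` S"
proof (intro set_eqI iffI)
  fix x assume "x \<in> swap_xy -` S"
  thus "x \<in> swap_xy ` S" by (intro image_eqI[of _ _ "swap_xy x"]) auto
qed auto

lemma continuous_on_swap_xy [continuous_intros]:
  "continuous_on S f \<Longrightarrow> continuous_on S (\<lambda>x. swap_xy (f x))"
  unfolding swap_xy_def by (intro continuous_intros)

lemma open_swap_xy: "open S \<Longrightarrow> open (swap_xy ` S)"
  unfolding image_swap_xy by (intro open_vimage continuous_intros)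

lemma closed_swap_xy: "closed S \<Longrightarrow> closed (swap_xy ` S)"
  unfolding image_swap_xy by (intro closed_vimage continuous_intros)

lemma hausdorff_measure_swap_xy: "hausdorff_measure j (swap_xy ` S) = hausdorff_measure j S"
proof (rule antisym)
  show "hausdorff_measure j (swap_xy ` S) \<le> hausdorff_measure j S"
    by (rule hausdorff_measure_image_le) simp
  have "hausdorff_measure j (swap_xy ` (swap_xy ` S)) \<le> hausdorff_measure j (swap_xy ` S)"
    by (rule hausdorff_measure_image_le) simp
  thus "hausdorff_measure j S \<le> hausdorff_measure j (swap_xy ` S)" by (simp add: image_image)
qed

lemma swap_xy_Int_cball: "swap_xy ` S \<inter> cball 0 \<epsilon> = swap_xy ` (S \<inter> cball 0 \<epsilon>)"
proof (rule set_eqI)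
  fix x show "x \<in> swap_xy ` S \<inter> cball 0 \<epsilon> \<longleftrightarrow> x \<in> swap_xy ` (S \<inter> cball 0 \<epsilon>)"
    using norm_swap_xy[of x] by (simp add: image_swap_xy)
qed

lemma density_swap_xy:
  "lower_density j (swap_xy ` S) 0 = lower_density j S 0"
  "upper_density j (swap_xy ` S) 0 = upper_density j S 0"
  by (simp_all add: lower_density_def upper_density_def swap_xy_Int_cball hausdorff_measure_swap_xy)

lemma countably_rectifiable_swap_xy:
  assumes "countably_rectifiable m Y"
  shows "countably_rectifiable m (swap_xy ` Y)"
proof -
  obtain E :: "nat \<Rightarrow> (complex \<times> complex \<times> complex) set"
    and f :: "nat \<Rightarrow> complex \<times> complex \<times> complex \<Rightarrow> complex \<times> complex \<times> complex" and N
    where *: "hausdorff_measure m N = 0" "Y \<subseteq> N \<union> (\<Union>i. f i ` E i)"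
    "\<forall>i. dim (E i) \<le> m \<and> (\<exists>L. L-lipschitz_on (E i) (f i))"
    using assms unfolding countably_rectifiable_def by (elim exE conjE) (rule that; assumption)
  show ?thesis unfolding countably_rectifiable_def
  proof (rule exI[of _ E], rule exI[of _ "\<lambda>i x. swap_xy (f i x)"], rule exI[of _ "swap_xy ` N"], intro conjI allI)
    show "hausdorff_measure m (swap_xy ` N) = 0" using * by (simp add: hausdorff_measure_swap_xy)
    show "swap_xy ` Y \<subseteq> swap_xy ` N \<union> (\<Union>i. (\<lambda>x. swap_xy (f i x)) ` E i)" using *(2) by blast
    show "dim (E i) \<le> m" for i using *(3) by blast
    show "\<exists>L. L-lipschitz_on (E i) (\<lambda>x. swap_xy (f i x))" for i
      using *(3)[rule_format, of i] by (simp add: lipschitz_on_def)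
  qed
qed

definition swap_poly :: "cpoly3 \<Rightarrow> cpoly3" where
  "swap_poly c = (\<lambda>(i, j, k). c (j, i, k))"

lemma eval3_swap_poly: "eval3 (swap_poly c) (swap_xy p) = eval3 c p"
  unfolding eval3_def
  by (rule sum.reindex_bij_witness[of _ "\<lambda>(i, j, k). (j, i, k)" "\<lambda>(i, j, k). (j, i, k)"])
     (auto simp: swap_poly_def poly3_support_def swap_xy_def)

lemma is_poly3_swap_poly: "is_poly3 c \<Longrightarrow> is_poly3 (swap_poly c)"
proof -
  assume "is_poly3 c"
  hence "finite ((\<lambda>(i, j, k). (j, i, k)) ` poly3_support c)" by (simp add: is_poly3_def)
  moreover have "poly3_support (swap_poly c) \<subseteq> (\<lambda>(i, j, k). (j, i, k)) ` poly3_support c"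
    by (force simp: poly3_support_def swap_poly_def)
  ultimately show ?thesis unfolding is_poly3_def by (rule finite_subset[rotated])
qed

lemma zero_set3_swap_poly: "swap_xy p \<in> zero_set3 (swap_poly c) \<longleftrightarrow> p \<in> zero_set3 c"
  by (simp add: zero_set3_def eval3_swap_poly)

lemma sing3_swap_poly: "swap_xy p \<in> sing3 (swap_poly c) \<longleftrightarrow> p \<in> sing3 c"
proof -
  have "dx3 (swap_poly c) = swap_poly (dy3 c)" "dy3 (swap_poly c) = swap_poly (dx3 c)"
    "dz3 (swap_poly c) = swap_poly (dz3 c)"
    by (auto simp: swap_poly_def dx3_def dy3_def dz3_def)
  thus ?thesis by (auto simp: sing3_def zero_set3_swap_poly eval3_swap_poly)
qed

section \<open>The separating set\<close>

context whpoly begin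

text \<open>Along the positive real part of the action the norm increases strictly from 0 to
  infinity, so each orbit ray meets the sphere once. Moving points there is a continuous map of the
  punctured zero set onto the link.\<close>

lemma connected_link_zero_set:
  assumes conn: "connected (zero_set3 F - {0})"
  shows "connected_link (zero_set3 F) 0"
  unfolding connected_link_def
proof (rule exI[of _ 1], intro conjI allI impI)
  fix \<epsilon> :: real assume \<epsilon>: "0 < \<epsilon> \<and> \<epsilon> < 1"
  let ?X = "zero_set3 F - {0}"
  define n where "n s p = norm (act (of_real s) p)" for s p
  \<comment> \<open>Write \<open>s = (s / s') * s'\<close>: acting by a number below 1 shrinks the
    norm.\<close>
  have mono: "n s p < n s' p" if "0 < s" "s < s'" "p \<noteq> 0" for s s' p
  proof -
    have "act (of_real s) p = act (of_real (s / s')) (act (of_real s') p)" using that by (simp add: act_act)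
    hence "n s p \<le> norm (complex_of_real (s / s')) * n s' p"
      unfolding n_def using that by (simp only:) (intro norm_act_le, simp add: norm_divide)
    also have "\<dots> = s / s' * n s' p" using that by (simp add: norm_divide)
    also have "\<dots> < 1 * n s' p"
      using that act_eq_0_iff[of "of_real s'" p] by (intro mult_strict_right_mono) (auto simp: n_def)
    finally show ?thesis by simp
  qed
  have cont: "continuous_on S (\<lambda>x. n (f x) (g x))" if "continuous_on S f" "continuous_on S g"
    for S and f :: "'z::topological_space \<Rightarrow> real" and g
    unfolding n_def by (intro continuous_intros that)
  have ex: "\<exists>s>0. n s p = \<epsilon>" if "p \<noteq> 0" for p
  proof -
    define R where "R = max 1 (\<epsilon> / norm p)"
    have R: "R \<ge> 1" "\<epsilon> \<le> R * norm p" using that by (auto simp: R_def max_def field_simps)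
    have "p = act (of_real (1 / R)) (act (of_real R) p)" using R by (simp add: act_act)
    hence "norm p \<le> norm (complex_of_real (1 / R)) * n R p"
      unfolding n_def using norm_act_le[of "of_real (1 / R)" "act (of_real R) p"] R by (simp add: norm_divide)
    hence "\<epsilon> \<le> n R p" using R by (simp add: norm_divide field_simps)
    moreover have "n 0 p = 0" using w1_pos w2_pos w3_pos by (simp add: n_def act_def zero_power)
    ultimately obtain s where s: "0 \<le> s" "s \<le> R" "n s p = \<epsilon>"
      using IVT'[of "\<lambda>s. n s p" 0 \<epsilon> R] \<epsilon> R cont[of "{0..R}" "\<lambda>s. s" "\<lambda>_. p"] by auto
    have "s \<noteq> 0" using s \<open>n 0 p = 0\<close> \<epsilon> by auto
    thus ?thesis using s by (intro exI[of _ s]) auto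
  qed
  define T where "T p = (SOME s. s > 0 \<and> n s p = \<epsilon>)" for p
  have T: "T p > 0" "n (T p) p = \<epsilon>" if "p \<noteq> 0" for p
    using someI_ex[OF ex[OF that, unfolded]] unfolding T_def by blast+
  \<comment> \<open>By monotonicity, \<open>n a q < \<epsilon> < n b q\<close> traps
    \<open>T q\<close> between \<open>a\<close> and \<open>b\<close>, and this is an open condition
    on \<open>q\<close>. The maximum with \<open>T p / 2\<close> keeps \<open>a\<close>
    positive.\<close>
  have cT: "continuous_on ?X T"
    unfolding continuous_on_iff
  proof (intro ballI allI impI)
    fix p :: "complex \<times> complex \<times> complex" and e :: real assume p: "p \<in> ?X" and e: "e > 0"
    define a b where "a = max (T p - e) (T p / 2)" and "b = T p + e"
    have p0: "p \<noteq> 0" using p by simp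
    have ab: "0 < a" "a < T p" "T p < b" using T[OF p0] e by (auto simp: a_def b_def)
    have "n a p < \<epsilon>" "\<epsilon> < n b p" using mono[of a "T p" p] mono[of "T p" b p] T[OF p0] ab p0 by auto
    moreover have "open {q. n a q < \<epsilon> \<and> \<epsilon> < n b q}"
      unfolding Collect_conj_eq by (intro open_Int open_Collect_less cont continuous_intros)
    ultimately obtain d where d: "d > 0" "ball p d \<subseteq> {q. n a q < \<epsilon> \<and> \<epsilon> < n b q}"
      using open_contains_ball[of "{q. n a q < \<epsilon> \<and> \<epsilon> < n b q}"] by blast
    show "\<exists>d>0. \<forall>q\<in>?X. dist q p < d \<longrightarrow> dist (T q) (T p) < e"
    proof (rule exI[of _ d], intro conjI ballI impI d(1))
      fix q assume q: "q \<in> ?X" "dist q p < d"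
      hence q0: "q \<noteq> 0" by simp
      have "q \<in> ball p d" using q(2) by (simp add: dist_commute)
      hence "n a q < \<epsilon> \<and> \<epsilon> < n b q" using d(2) by blast
      hence nq: "n a q < n (T q) q" "n (T q) q < n b q" using T(2)[OF q0] by auto
      have "a < T q"
      proof (rule ccontr)
        assume "\<not> a < T q"
        hence "T q < a \<or> T q = a" by linarith
        thus False using nq(1) mono[of "T q" a q] T(1)[OF q0] q0 by auto
      qed
      moreover have "T q < b"
      proof (rule ccontr)
        assume "\<not> T q < b"
        hence "b < T q \<or> T q = b" by linarith
        thus False using nq(2) mono[of b "T q" q] ab q0 by auto
      qed
      ultimately show "dist (T q) (T p) < e" by (auto simp: dist_real_def a_def b_def)
    qed
  qed
  have "(\<lambda>p. act (of_real (T p)) p) ` ?X = zero_set3 F \<inter> sphere 0 \<epsilon>"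
  proof (intro set_eqI iffI)
    fix q assume "q \<in> (\<lambda>p. act (of_real (T p)) p) ` ?X"
    then obtain p where p: "p \<in> ?X" "q = act (of_real (T p)) p" by blast
    hence "norm q = \<epsilon>" using T(2)[of p] by (simp add: n_def)
    thus "q \<in> zero_set3 F \<inter> sphere 0 \<epsilon>" using p zero_set_act by simp
  next
    fix q assume q: "q \<in> zero_set3 F \<inter> sphere 0 \<epsilon>"
    hence q0: "q \<noteq> 0" using \<epsilon> by auto
    have "n 1 q = \<epsilon>" using q by (simp add: n_def)
    hence "T q = 1"
      using mono[of 1 "T q" q] mono[of "T q" 1 q] T[OF q0] q0 by (metis less_irrefl linorder_neqE zero_less_one)
    thus "q \<in> (\<lambda>p. act (of_real (T p)) p) ` ?X" using q q0 by (intro image_eqI[of _ _ q]) auto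
  qed
  moreover have "connected ((\<lambda>p. act (of_real (T p)) p) ` ?X)"
    by (intro connected_continuous_image conn continuous_intros cT)
  ultimately show "connected (zero_set3 F \<inter> sphere 0 \<epsilon>)" by simp
qed simp

text \<open>The punctured closed disc is the image of a half-plane under \<open>exp\<close>, hence
  connected.\<close>

lemma connected_truncated_saturation:
  assumes "connected G" "t0 > 0"
  shows "connected (\<Union>t\<in>{t. t \<noteq> 0 \<and> norm t \<le> t0}. act t ` G)"
proof -
  have "{t :: complex. t \<noteq> 0 \<and> norm t \<le> t0} = exp ` {w. Re w \<le> ln t0}"
  proof (intro set_eqI iffI)
    fix t :: complex assume "t \<in> {t. t \<noteq> 0 \<and> norm t \<le> t0}"
    hence t: "t \<noteq> 0" "norm t \<le> t0" by auto
    have "Re (Ln t) = ln (norm t)" using t by simp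
    also have "\<dots> \<le> ln t0" using t assms(2) by simp
    finally show "t \<in> exp ` {w. Re w \<le> ln t0}" using t by (intro image_eqI[of _ _ "Ln t"]) auto
  next
    fix t :: complex assume "t \<in> exp ` {w. Re w \<le> ln t0}"
    then obtain w where w: "t = exp w" "Re w \<le> ln t0" by auto
    have "norm t = exp (Re w)" using w by simp
    also have "\<dots> \<le> exp (ln t0)" using w(2) by (simp del: exp_ln)
    finally show "t \<in> {t. t \<noteq> 0 \<and> norm t \<le> t0}" using w assms(2) by simp
  qed
  moreover have "connected (exp ` {w. Re w \<le> ln t0})"
    by (intro connected_continuous_image continuous_intros convex_connected convex_halfspace_Re_le)
  ultimately have "connected ({t :: complex. t \<noteq> 0 \<and> norm t \<le> t0} \<times> G)" using assms(1) by (simp add: connected_Times)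
  hence "connected ((\<lambda>x. act (fst x) (snd x)) ` ({t. t \<noteq> 0 \<and> norm t \<le> t0} \<times> G))"
    by (intro connected_continuous_image continuous_intros)
  moreover have "(\<lambda>x. act (fst x) (snd x)) ` ({t. t \<noteq> 0 \<and> norm t \<le> t0} \<times> G)
      = (\<Union>t\<in>{t. t \<noteq> 0 \<and> norm t \<le> t0}. act t ` G)" by force
  ultimately show ?thesis by simp
qed

text \<open>On the zero set without \<open>Y\<close>, the open sets \<open>\<Omega>\<close> and
  \<open>- (W \<union> Y)\<close> are complementary, so no component meets both. The thick cone at
  \<open>p0\<close> lies in the first and the one at \<open>q0\<close> in the second.\<close>

lemma separating_set_if:
  assumes sep: "separable_at p0" and thick: "thick_at p0" "thick_at q0"
    and p0: "p0 \<noteq> 0" "snd (snd p0) = 0"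
    and q0: "q0 \<in> zero_set3 F" "q0 \<noteq> 0" "snd (snd q0) = 0" "\<And>t. t \<noteq> 0 \<Longrightarrow> q0 \<noteq> act t p0"
    and nz: "F \<noteq> (\<lambda>_. 0)" and F0: "eval3 F 0 = 0"
  shows "has_separating_set 4 (zero_set3 F) 0"
proof -
  let ?X = "zero_set3 F"
  obtain W Y \<Omega> where Y: "Y \<subseteq> ?X" "0 \<in> Y" "countably_rectifiable 3 Y" "upper_density 3 Y 0 = 0"
     and W: "open \<Omega>" "W = ?X \<inter> \<Omega>" "closed Y" "closed (W \<union> Y)" "p0 \<in> W"
     and inv: "\<forall>p t. t \<noteq> 0 \<longrightarrow> (act t p \<in> W \<longleftrightarrow> p \<in> W)" "\<forall>p t. t \<noteq> 0 \<longrightarrow> (act t p \<in> Y \<longleftrightarrow> p \<in> Y)"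
     and ax: "\<forall>p\<in>W. snd (snd p) = 0 \<longrightarrow> (\<exists>t. t \<noteq> 0 \<and> p = act t p0)" "\<forall>p\<in>Y. snd (snd p) = 0 \<longrightarrow> p = 0"
    using sep unfolding separable_at_def by (elim exE conjE) (rule that; assumption)
  have pY: "p0 \<notin> Y" and qY: "q0 \<notin> Y" and qW: "q0 \<notin> W" using ax p0 q0 by blast+
  \<comment> \<open>Acting with \<open>norm t \<le> t0\<close> moves the balls of radius
    \<open>norm p0 + 1\<close> and \<open>norm q0 + 1\<close> into the unit ball.\<close>
  define t0 where "t0 = 1 / (norm p0 + norm q0 + 1)"
  have t0: "t0 > 0" "t0 \<le> 1" "t0 * (norm p0 + 1) \<le> 1" "t0 * (norm q0 + 1) \<le> 1"
    by (auto simp: t0_def field_simps add_pos_nonneg add_nonneg_pos)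
  define VA VB where "VA = \<Omega> \<inter> - Y \<inter> ball 0 (norm p0 + 1)" and "VB = - (W \<union> Y) \<inter> ball 0 (norm q0 + 1)"
  have VA: "open VA" "p0 \<in> VA" unfolding VA_def using W pY by (auto intro!: open_Int open_Compl)
  have VB: "open VB" "q0 \<in> VB"
    unfolding VB_def by (intro open_Int open_Compl open_ball W(4)) (use qY qW in simp)
  define sat where "sat G = (\<Union>t\<in>{t. t \<noteq> 0 \<and> norm t \<le> t0}. act t ` G)" for G
  obtain GA where GA: "GA \<subseteq> ?X \<inter> VA" "connected GA" "p0 \<in> GA" "lower_density 4 (sat GA) 0 > 0"
    using thick(1) VA t0(1) unfolding thick_at_def sat_def by blast
  obtain GB where GB: "GB \<subseteq> ?X \<inter> VB" "connected GB" "q0 \<in> GB" "lower_density 4 (sat GB) 0 > 0"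
    using thick(2) VB t0(1) unfolding thick_at_def sat_def by blast
  have conn: "connected (sat GA)" "connected (sat GB)"
    unfolding sat_def by (intro connected_truncated_saturation GA GB t0)+
  have small: "norm (act t g) \<le> 1" if "norm t \<le> t0" "norm g \<le> R + 1" "t0 * (R + 1) \<le> 1" for t g R
  proof -
    have "norm (act t g) \<le> norm t * norm g" using that t0 by (intro norm_act_le) auto
    also have "\<dots> \<le> t0 * (R + 1)" using that t0 by (intro mult_mono) auto
    finally show ?thesis using that by simp
  qed
  define U where "U = (cball 0 1 \<inter> ?X) - Y"
  have sA: "sat GA \<subseteq> W \<inter> U"
  proof
    fix x assume "x \<in> sat GA"
    then obtain t g where x: "x = act t g" "g \<in> GA" "t \<noteq> 0" "norm t \<le> t0" unfolding sat_def by blast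
    hence g: "g \<in> ?X" "g \<in> VA" using GA by auto
    hence "g \<in> W" "g \<notin> Y" "norm g \<le> norm p0 + 1" using W(2) by (auto simp: VA_def)
    hence "act t g \<in> W" "act t g \<notin> Y" "norm (act t g) \<le> 1"
      using inv x(3) small[OF x(4) _ t0(3)] by blast+
    thus "x \<in> W \<inter> U" using zero_set_act[OF g(1), of t] unfolding U_def x(1) by simp
  qed
  have sB: "sat GB \<subseteq> - (W \<union> Y) \<inter> U"
  proof
    fix x assume "x \<in> sat GB"
    then obtain t g where x: "x = act t g" "g \<in> GB" "t \<noteq> 0" "norm t \<le> t0" unfolding sat_def by blast
    hence g: "g \<in> ?X" "g \<in> VB" using GB by auto
    hence "g \<notin> W" "g \<notin> Y" "norm g \<le> norm q0 + 1" by (auto simp: VB_def)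
    hence "act t g \<notin> W" "act t g \<notin> Y" "norm (act t g) \<le> 1"
      using inv x(3) small[OF x(4) _ t0(4)] by blast+
    thus "x \<in> - (W \<union> Y) \<inter> U" using zero_set_act[OF g(1), of t] unfolding U_def x(1) by simp
  qed
  have ne: "act (of_real t0) p0 \<in> sat GA" "act (of_real t0) q0 \<in> sat GB"
    unfolding sat_def using GA(3) GB(3) t0(1) by (auto simp del: act_simp intro!: exI[of _ "complex_of_real t0"])
  define A B where "A = connected_component_set U (act (of_real t0) p0)" and "B = connected_component_set U (act (of_real t0) q0)"
  have AB: "A \<in> components U" "B \<in> components U" unfolding A_def B_def components_def using ne sA sB by blast+
  have subA: "sat GA \<subseteq> A" unfolding A_def by (rule connected_component_maximal) (use ne conn sA in auto)
  have subB: "sat GB \<subseteq> B" unfolding B_def by (rule connected_component_maximal) (use ne conn sB in auto)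
  have "A \<noteq> B"
  proof
    assume "A = B"
    have "connected A" unfolding A_def by (rule connected_connected_component)
    moreover have AU: "A \<subseteq> U" unfolding A_def by (rule connected_component_subset)
    have "\<Omega> \<inter> A \<noteq> {}" using subA ne(1) sA W(2) by blast
    moreover have "- (W \<union> Y) \<inter> A \<noteq> {}" using subB ne(2) sB \<open>A = B\<close> by blast
    moreover have "A \<subseteq> \<Omega> \<union> - (W \<union> Y)" using AU W(2) unfolding U_def by blast
    moreover have "\<Omega> \<inter> - (W \<union> Y) \<inter> A = {}" using AU W(2) unfolding U_def by blast
    moreover have "open (- (W \<union> Y))" using W(4) by (rule open_Compl)
    ultimately show False using connectedD[of A \<Omega> "- (W \<union> Y)"] W(1) by blast
  qed
  have dA: "lower_density 4 A 0 > 0" by (rule less_le_trans[OF GA(4) lower_density_mono[OF subA]])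
  have dB: "lower_density 4 B 0 > 0" by (rule less_le_trans[OF GB(4) lower_density_mono[OF subB]])
  have "A \<subseteq> ?X" using connected_component_subset[of U "act (of_real t0) p0"] unfolding A_def U_def by blast
  from less_le_trans[OF dA lower_density_mono[OF this]] have dX: "lower_density 4 ?X 0 > 0" .
  have "is_separating_set 4 ?X 0 Y"
    unfolding is_separating_set_def
  proof (intro conjI)
    show "countably_rectifiable (4 - 1) Y" using Y(3) by simp
    show "\<exists>\<epsilon>>0. \<exists>A B. A \<in> components ((cball 0 \<epsilon> \<inter> ?X) - Y) \<and> B \<in> components ((cball 0 \<epsilon> \<inter> ?X) - Y) \<and>
        A \<noteq> B \<and> upper_density (4 - 1) Y 0 = 0 \<and> lower_density 4 A 0 > 0 \<and> lower_density 4 B 0 > 0"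
      by (rule exI[of _ 1], rule conjI, simp, rule exI[of _ A], rule exI[of _ B])
         (use AB[unfolded U_def] \<open>A \<noteq> B\<close> Y(4) dA dB in simp)
  qed (use Y in auto)
  moreover have "0 \<in> ?X" using F0 by (simp add: zero_set3_def)
  moreover have "connected_link ?X 0"
    by (rule connected_link_zero_set[OF connected_zero_set_minus_0[OF nz F0]])
  ultimately show ?thesis using dX unfolding has_separating_set_def by blast
qed

text \<open>The action reaches every nonzero \<open>x\<close>; continuity gives
  \<open>x = 0\<close>.\<close>

lemma axis_vanishing:
  assumes "\<And>u. eval3 F (1, u, 0) = 0"
  shows "eval3 F (x, y, 0) = 0"
proof -
  have nz: "eval3 F (x, y, 0) = 0" if "x \<noteq> 0" for x
  proof -
    obtain t where t: "t ^ w1 = x" using complex_nth_root_exists[OF w1_pos] by blast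
    hence "t \<noteq> 0" using that w1_pos by (auto simp: zero_power)
    hence "(x, y, 0) = act t (1, y / t ^ w2, 0)" using t by simp
    thus ?thesis using assms by (simp add: eval_act del: act_simp)
  qed
  have "closed {x. eval3 F (x, y, 0) = 0}" by (intro closed_Collect_eq continuous_intros)
  moreover have "- {0} \<subseteq> {x. eval3 F (x, y, 0) = 0}" using nz by auto
  ultimately have "closure (- {0}) \<subseteq> {x. eval3 F (x, y, 0) = 0}" by (rule closure_minimal[rotated])
  thus ?thesis by (auto simp: closure_complement)
qed

end

section \<open>Transport along the exchange of x and y, and the conclusion\<close>

lemma whpoly_swap_poly:
  assumes "whpoly F w1 w2 w3 d"
  shows "whpoly (swap_poly F) w2 w1 w3 d"
proof -
  interpret whpoly F w1 w2 w3 d by fact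
  show ?thesis
  proof
    fix i j k assume "swap_poly F (i, j, k) \<noteq> 0"
    hence "w1 * j + w2 * i + w3 * k = d" by (intro monomial) (simp add: swap_poly_def)
    thus "w2 * i + w1 * j + w3 * k = d" by simp
  qed (use is_poly is_poly3_swap_poly w1_pos w2_pos w3_pos in auto)
qed

context whpoly begin

lemma swap_transfer:
  shows "whpoly.separable_at (swap_poly F) w2 w1 w3 p \<Longrightarrow> separable_at (swap_xy p)"
    and "whpoly.thick_at (swap_poly F) w2 w1 w3 p \<Longrightarrow> thick_at (swap_xy p)"
proof -
  interpret S: whpoly "swap_poly F" w2 w1 w3 d by (rule whpoly_swap_poly) unfold_locales
  have sact: "swap_xy (S.act t p) = act t (swap_xy p)" for t p
    by (simp add: S.act_def act_def swap_xy_def)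
  have sX: "swap_xy ` zero_set3 (swap_poly F) = zero_set3 F"
    unfolding image_swap_xy using zero_set3_swap_poly[of "swap_xy _" F] zero_set3_swap_poly[of _ F] by auto
  have mem: "x \<in> swap_xy ` T \<longleftrightarrow> swap_xy x \<in> T" for x T by (simp add: image_swap_xy)
  {
    assume "S.separable_at p"
    then obtain W Y \<Omega> where *: "Y \<subseteq> zero_set3 (swap_poly F)" "0 \<in> Y" "countably_rectifiable 3 Y" "upper_density 3 Y 0 = 0"
     "open \<Omega>" "W = zero_set3 (swap_poly F) \<inter> \<Omega>" "closed Y" "closed (W \<union> Y)" "p \<in> W"
     "\<forall>p t. t \<noteq> 0 \<longrightarrow> (S.act t p \<in> W \<longleftrightarrow> p \<in> W)" "\<forall>p t. t \<noteq> 0 \<longrightarrow> (S.act t p \<in> Y \<longleftrightarrow> p \<in> Y)"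
     "\<forall>q\<in>W. snd (snd q) = 0 \<longrightarrow> (\<exists>t. t \<noteq> 0 \<and> q = S.act t p)" "\<forall>p\<in>Y. snd (snd p) = 0 \<longrightarrow> p = 0"
      unfolding S.separable_at_def by (elim exE conjE) (rule that; assumption)
    have sact': "swap_xy (act t q) = S.act t (swap_xy q)" for t q
      using sact[of t "swap_xy q"] by (metis swap_xy_swap_xy)
    have z: "snd (snd (swap_xy q)) = snd (snd q)" for q by (simp add: swap_xy_def)
    show "separable_at (swap_xy p)"
      unfolding separable_at_def
    proof (rule exI[of _ "swap_xy ` W"], rule exI[of _ "swap_xy ` Y"], rule exI[of _ "swap_xy ` \<Omega>"], intro conjI allI ballI impI)
      show "swap_xy ` Y \<subseteq> zero_set3 F" using *(1) sX by blast
      show "0 \<in> swap_xy ` Y" using *(2) by (simp add: mem)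
      show "countably_rectifiable 3 (swap_xy ` Y)" by (rule countably_rectifiable_swap_xy[OF *(3)])
      show "upper_density 3 (swap_xy ` Y) 0 = 0" using *(4) by (simp add: density_swap_xy)
      show "open (swap_xy ` \<Omega>)" by (rule open_swap_xy[OF *(5)])
      show "swap_xy ` W = zero_set3 F \<inter> swap_xy ` \<Omega>"
        unfolding *(6) sX[symmetric] by (auto simp: image_swap_xy)
      show "closed (swap_xy ` Y)" by (rule closed_swap_xy[OF *(7)])
      show "closed (swap_xy ` W \<union> swap_xy ` Y)" using closed_swap_xy[OF *(8)] by (simp add: image_Un)
      show "swap_xy p \<in> swap_xy ` W" using *(9) by blast
      show "(act t q \<in> swap_xy ` W) = (q \<in> swap_xy ` W)" if "t \<noteq> 0" for q t
        using *(10)[rule_format, OF that, of "swap_xy q"] by (simp only: mem sact')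
      show "(act t q \<in> swap_xy ` Y) = (q \<in> swap_xy ` Y)" if "t \<noteq> 0" for q t
        using *(11)[rule_format, OF that, of "swap_xy q"] by (simp only: mem sact')
      show "\<exists>t. t \<noteq> 0 \<and> q = act t (swap_xy p)" if "q \<in> swap_xy ` W" "snd (snd q) = 0" for q
      proof -
        have "swap_xy q \<in> W" "snd (snd (swap_xy q)) = 0" using that by (simp_all add: mem z)
        then obtain t where "t \<noteq> 0" "swap_xy q = S.act t p" using *(12) by blast
        thus ?thesis using sact[of t p] by (metis swap_xy_swap_xy)
      qed
      show "q = 0" if "q \<in> swap_xy ` Y" "snd (snd q) = 0" for q
        using *(13) that by (metis mem z swap_xy_0 swap_xy_swap_xy)
    qed
  }
  {
    assume th: "S.thick_at p"
    show "thick_at (swap_xy p)"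
      unfolding thick_at_def
    proof (intro allI impI)
      fix V and t0 :: real assume V: "open V" "swap_xy p \<in> V" "t0 > 0"
      have "p \<in> swap_xy ` V" using V(2) by (simp add: mem)
      then obtain G where G: "G \<subseteq> zero_set3 (swap_poly F) \<inter> swap_xy ` V" "connected G" "p \<in> G"
        "lower_density 4 (\<Union>t\<in>{t. t \<noteq> 0 \<and> norm t \<le> t0}. S.act t ` G) 0 > 0"
        using th open_swap_xy[OF V(1)] V(3) unfolding S.thick_at_def by blast
      have e: "(\<Union>t\<in>{t. t \<noteq> 0 \<and> norm t \<le> t0}. act t ` swap_xy ` G)
          = swap_xy ` (\<Union>t\<in>{t. t \<noteq> 0 \<and> norm t \<le> t0}. S.act t ` G)"
        by (simp add: image_UN image_image sact)
      show "\<exists>G. G \<subseteq> zero_set3 F \<inter> V \<and> connected G \<and> swap_xy p \<in> G \<and>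
          0 < lower_density 4 (\<Union>t\<in>{t. t \<noteq> 0 \<and> norm t \<le> t0}. act t ` G) 0"
      proof (rule exI[of _ "swap_xy ` G"], intro conjI)
        have "swap_xy ` G \<subseteq> swap_xy ` zero_set3 (swap_poly F) \<inter> swap_xy ` swap_xy ` V" using G(1) by blast
        thus "swap_xy ` G \<subseteq> zero_set3 F \<inter> V" by (simp add: sX image_image)
        show "connected (swap_xy ` G)" by (intro connected_continuous_image continuous_intros G(2))
        show "swap_xy p \<in> swap_xy ` G" using G(3) by blast
        show "0 < lower_density 4 (\<Union>t\<in>{t. t \<noteq> 0 \<and> norm t \<le> t0}. act t ` swap_xy ` G) 0"
          unfolding e density_swap_xy by (rule G(4))
      qed
    qed
  }
qed

end

theorem theorem3p1:
  fixes f :: cpoly3 and w1 w2 w3 d :: nat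
  assumes poly: "is_poly3 f"
    and weights: "w1 \<ge> w2" "w2 > w3" "w3 > 0"
    and whom: "weighted_homogeneous3 f w1 w2 w3 d"
    and sing0: "0 \<in> sing3 f"
    and isolated: "\<exists>r>0. sing3 f \<inter> ball 0 r = {0}"
    and disconn: "\<not> connected ((zero_set3 f - {0}) \<inter> {p. snd (snd p) = 0})"
  shows "has_separating_set 4 (zero_set3 f) 0"
proof -
  interpret whpoly f w1 w2 w3 d
    using poly weights weighted_homogeneous3_monomials[OF poly whom] by unfold_locales auto
  interpret S: whpoly "swap_poly f" w2 w1 w3 d by (rule whpoly_swap_poly) unfold_locales
  define D where "D = (zero_set3 f - {0}) \<inter> {p. snd (snd p) = 0}"
  have smooth: "p = 0" if "p \<in> sing3 f" for p
    using isolated isolated_imp_sing that by blast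
  have smooth': "p = 0" if "p \<in> sing3 (swap_poly f)" for p
    using smooth[of "swap_xy p"] sing3_swap_poly[of "swap_xy p" f] that by (metis swap_xy_0 swap_xy_swap_xy)
  \<comment> \<open>Otherwise \<open>D\<close> is all of C^2 without its origin, which is
    connected.\<close>
  have not_all: "\<exists>x y. eval3 f (x, y, 0) \<noteq> 0"
  proof (rule ccontr)
    assume "\<not> ?thesis"
    hence "D = (\<lambda>(x, y). (x, y, 0)) ` (- {0})"
      by (force simp: D_def zero_set3_def zero_prod_def image_iff)
    moreover have "connected ((\<lambda>(x, y). (x, y, 0 :: complex)) ` (- {0 :: complex \<times> complex}))"
      unfolding split_beta
      by (intro connected_continuous_image continuous_intros connected_punctured_universe) simp
    ultimately show False using disconn by (simp add: D_def)
  qed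
  have nontriv: "\<exists>u. eval3 f (1, u, 0) \<noteq> 0" using axis_vanishing not_all by blast
  have nontriv': "\<exists>u. eval3 (swap_poly f) (1, u, 0) \<noteq> 0"
    using S.axis_vanishing not_all eval3_swap_poly[of f "(_, _, 0)"] by (metis swap_xy_simp)
  have f0: "f \<noteq> (\<lambda>_. 0)" using not_all by (auto simp: eval3_def poly3_support_def)
  have F0: "eval3 f 0 = 0" using sing0 by (simp add: sing3_def zero_set3_def)
  \<comment> \<open>The two normal forms match the two alternatives of \<open>thick_at_base\<close>:
    after the exchange the first weight \<open>w2\<close> is at most the second weight
    \<open>w1\<close>, while for \<open>y = 0\<close> the base point has
    \<open>u0 = 0\<close>.\<close>
  have rep: "\<exists>p0 t. t \<noteq> 0 \<and> p = act t p0 \<and> separable_at p0 \<and> thick_at p0" if p: "p \<in> D" for p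
  proof -
    obtain x y where xy: "p = (x, y, 0)" using p by (cases p) (auto simp: D_def)
    have ne: "x \<noteq> 0 \<or> y \<noteq> 0" and ev: "eval3 f p = 0" using p by (auto simp: D_def xy zero_set3_def zero_prod_def)
    show ?thesis
    proof (cases "y = 0")
      case False
      obtain t where t: "t ^ w2 = y" using complex_nth_root_exists[OF w2_pos] by blast
      hence t0: "t \<noteq> 0" using False w2_pos by (auto simp: zero_power)
      define u0 where "u0 = x / t ^ w1"
      have e: "p = act t (swap_xy (1, u0, 0))" using t t0 by (simp add: xy u0_def)
      hence "eval3 f (swap_xy (1, u0, 0)) = 0" using ev t0 unfolding e eval_act by simp
      hence b: "eval3 (swap_poly f) (1, u0, 0) = 0"
        using eval3_swap_poly[of f "swap_xy (1, u0, 0)"] by (simp del: swap_xy_simp)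
      interpret C: wchart "swap_poly f" w2 w1 w3 d u0
        using weights smooth' b nontriv' by unfold_locales auto
      show ?thesis using e t0 swap_transfer C.separable_at_base C.thick_at_base weights by blast
    next
      case True
      hence x: "x \<noteq> 0" using ne by simp
      obtain t where t: "t ^ w1 = x" using complex_nth_root_exists[OF w1_pos] by blast
      hence t0: "t \<noteq> 0" using x w1_pos by (auto simp: zero_power)
      have e: "p = act t (1, 0, 0)" using t True by (simp add: xy)
      hence "eval3 f (1, 0, 0) = 0" using ev t0 unfolding e eval_act by simp
      then interpret C: wchart f w1 w2 w3 d 0
        using weights smooth nontriv by unfold_locales auto
      show ?thesis using e t0 C.separable_at_base C.thick_at_base by blast
    qed
  qed
  have actD: "p \<in> D" if "act t p \<in> D" "t \<noteq> 0" for t p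
    using that zero_set_act[of "act t p" "inverse t"] by (auto simp: D_def act_act act_eq_0_iff) (simp add: act_def)
  have Dact: "act t p \<in> D" if "p \<in> D" "t \<noteq> 0" for t p
    using that zero_set_act[of p t] by (auto simp: D_def act_eq_0_iff) (simp add: act_def)
  have "D \<noteq> {}" using disconn by (auto simp: D_def)
  then obtain p where p: "p \<in> D" by blast
  obtain p0 s where p0: "s \<noteq> 0" "p = act s p0" "separable_at p0" "thick_at p0" using rep[OF p] by blast
  have p0D: "p0 \<in> D" using actD p p0 by blast
  \<comment> \<open>A single orbit is connected, so it cannot exhaust \<open>D\<close>.\<close>
  obtain q where q: "q \<in> D" "q \<notin> (\<lambda>t. act t p0) ` (- {0})"
  proof -
    have "(\<lambda>t. act t p0) ` (- {0}) \<subseteq> D" using Dact[OF p0D] by blast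
    moreover have "(\<lambda>t. act t p0) ` (- {0}) \<noteq> D" using disconn orbit_connected[of p0] unfolding D_def by metis
    ultimately show ?thesis using that by blast
  qed
  obtain q0 r where q0: "r \<noteq> 0" "q = act r q0" "thick_at q0" using rep[OF q(1)] by blast
  have q0D: "q0 \<in> D" using actD q q0 by blast
  have "q0 \<noteq> act t p0" if "t \<noteq> 0" for t
    using q(2) q0(1,2) that by (auto simp: act_act)
  thus ?thesis
    using separating_set_if[OF p0(3,4) q0(3) _ _ _ _ _ _ f0 F0] p0D q0D by (auto simp: D_def)
qed

end
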